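(* Let $s,q$ be positive integers with $q<s$. Let $f:[-\pi,\pi]\to\mathbb{C}^{s\times s}$, $g:[-\pi,\pi]\to\mathbb{C}^{s\times q}$ and $h:[-\pi,\pi]\to\mathbb{C}^{q\times s}$ be matrix-valued functions all of whose entries belong to $L^1([-\pi,\pi])$. Then $$\{T_n(f)T_n(g)\}_n\sim_{\sigma}(f\cdot g,[-\pi,\pi])$$ and $$\{T_n(h)T_n(f)\}_n\sim_{\sigma}(h\cdot f,[-\pi,\pi]),$$ where $f\cdot g$ and $h\cdot f$ denote the pointwise matrix products.
   Context: Block Toeplitz matrices: for positive integers $a,b$ (possibly $a\neq b$) and a function $\varphi:[-\pi,\pi]\to\mathbb{C}^{a\times b}$ with entries in $L^1([-\pi,\pi])$, the Fourier coefficients are $t_j:=\frac{1}{2\pi}\int_{-\pi}^{\pi}\varphi(\theta)e^{-\mathbf{i}j\theta}\,\mathrm{d}\theta\in\mathbb{C}^{a\times b}$ (component-wise integrals, $j\in\mathbb{Z}$), and for $n\in\mathbb{N}$ the matrix $T_n(\varphi):=[t_{i-k}]_{i,k=1}^{n}$ is the $an\times bn$ block Toeplitz matrix generated by $\varphi$. Singular value distribution for rectangular matrices: let $a\neq b$ be positive integers, let $\varphi:[\alpha,\beta]\to\mathbb{C}^{a\times b}$ be measurable, and let $\{A_n\}_n$ be a sequence of matrices with $A_n$ of size $a m_1\times b m_2$, where $m_1=m_1(n)$, $m_2=m_2(n)$, $m_1\sim m_2$ and $m_1,m_2\to\infty$ as $n\to\infty$ (here the case $m_1=m_2=n$ is relevant).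 Write $x\land y:=\min\{x,y\}$, and let $\sigma_j(\cdot)$ denote the singular values of a matrix. One writes $\{A_n\}_n\sim_\sigma(\varphi,[\alpha,\beta])$ if $$\lim_{n\to\infty}\frac{1}{am_1\land bm_2}\sum_{j=1}^{am_1\land bm_2}F(\sigma_j(A_n))=\frac{1}{\beta-\alpha}\int_\alpha^\beta\frac{\sum_{i=1}^{a\land b}F(\sigma_i(\varphi(t)))}{a\land b}\,\mathrm{d}t$$ for every continuous function $F$ with compact support. *)

theory Defs
  imports
    "HOL-Analysis.Analysis"
    "HOL-Library.Landau_Symbols"
    "Jordan_Normal_Form.Char_Poly"
    "Jordan_Normal_Form.Schur_Decomposition"
begin

hide_const (open) Finite_Cartesian_Product.mat Finite_Cartesian_Product.vec

definition mat_valued_on :: "real set \<Rightarrow> nat \<Rightarrow> nat \<Rightarrow> (real \<Rightarrow> complex Matrix.mat) \<Rightarrow> bool" where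
  "mat_valued_on S a b \<phi> \<longleftrightarrow> (\<forall>t\<in>S. \<phi> t \<in> carrier_mat a b)"

definition mat_measurable_on :: "real set \<Rightarrow> nat \<Rightarrow> nat \<Rightarrow> (real \<Rightarrow> complex Matrix.mat) \<Rightarrow> bool" where
  "mat_measurable_on S a b \<phi> \<longleftrightarrow> mat_valued_on S a b \<phi> \<and>
     (\<forall>i<a. \<forall>j<b. (\<lambda>t. \<phi> t $$ (i, j)) \<in> borel_measurable (lebesgue_on S))"

definition mat_L1_on :: "real set \<Rightarrow> nat \<Rightarrow> nat \<Rightarrow> (real \<Rightarrow> complex Matrix.mat) \<Rightarrow> bool" where
  "mat_L1_on S a b \<phi> \<longleftrightarrow> mat_valued_on S a b \<phi> \<and>
     (\<forall>i<a. \<forall>j<b. integrable (lebesgue_on S) (\<lambda>t. \<phi> t $$ (i, j)))"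

definition fourier_coeff_mat :: "nat \<Rightarrow> nat \<Rightarrow> (real \<Rightarrow> complex Matrix.mat) \<Rightarrow> int \<Rightarrow> complex Matrix.mat" where
  "fourier_coeff_mat a b \<phi> k = Matrix.mat a b (\<lambda>(i, j).
     1 / (2 * of_real pi) *
       (LINT \<theta>|lebesgue_on {-pi..pi}. \<phi> \<theta> $$ (i, j) * exp (- (\<i> * of_int k * of_real \<theta>))))"

text \<open>Entry \<open>(i, j)\<close> lies in block \<open>(i div a, j div b)\<close> at position \<open>(i mod a, j mod b)\<close>.
  Shifting both block indices from \<open>{1..n}\<close> to \<open>{0..<n}\<close> leaves their difference unchanged.\<close>
definition block_toeplitz :: "nat \<Rightarrow> nat \<Rightarrow> nat \<Rightarrow> (real \<Rightarrow> complex Matrix.mat) \<Rightarrow> complex Matrix.mat" where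
  "block_toeplitz a b n \<phi> = Matrix.mat (a * n) (b * n) (\<lambda>(i, j).
     fourier_coeff_mat a b \<phi> (int (i div a) - int (j div b)) $$ (i mod a, j mod b))"

text \<open>The \<open>min (dim_row A) (dim_col A)\<close> singular values in decreasing order: square roots of the
  largest eigenvalues of \<open>A\<^sup>* A\<close>, counted with multiplicity.  These eigenvalues are real and
  nonnegative, so \<open>Re\<close> is harmless; if \<open>dim_row A < dim_col A\<close>, the eigenvalues dropped by
  \<open>take\<close> are zero.\<close>
definition singular_values :: "complex Matrix.mat \<Rightarrow> real list" where
  "singular_values A = take (min (dim_row A) (dim_col A))
     (rev (sorted_list_of_multiset
       (image_mset (\<lambda>z. sqrt (Re z)) (proots (char_poly (mat_adjoint A * A))))))"

text \<open>The conjuncts before the limit are the conditions under which the relation is defined; they are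
  made part of it.  Singular values are indexed from \<open>0\<close>.\<close>
definition sv_distributed ::
    "nat \<Rightarrow> nat \<Rightarrow> (nat \<Rightarrow> nat) \<Rightarrow> (nat \<Rightarrow> nat) \<Rightarrow> (nat \<Rightarrow> complex Matrix.mat) \<Rightarrow>
     (real \<Rightarrow> complex Matrix.mat) \<Rightarrow> real \<Rightarrow> real \<Rightarrow> bool" where
  "sv_distributed a b m1 m2 A \<phi> \<alpha> \<beta> \<longleftrightarrow>
     0 < a \<and> 0 < b \<and> \<alpha> < \<beta> \<and>
     filterlim m1 at_top sequentially \<and> filterlim m2 at_top sequentially \<and>
     asymp_equiv (\<lambda>n. real (m1 n)) sequentially (\<lambda>n. real (m2 n)) \<and>
     (\<forall>n\<ge>1. A n \<in> carrier_mat (a * m1 n) (b * m2 n)) \<and>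
     mat_measurable_on {\<alpha>..\<beta>} a b \<phi> \<and>
     (\<forall>F :: real \<Rightarrow> complex. continuous_on UNIV F \<longrightarrow> compact (closure {x. F x \<noteq> 0}) \<longrightarrow>
        (\<lambda>n. 1 / of_nat (min (a * m1 n) (b * m2 n)) *
           (\<Sum>j<min (a * m1 n) (b * m2 n). F (singular_values (A n) ! j)))
        \<longlonglongrightarrow>
        1 / of_real (\<beta> - \<alpha>) *
          (LINT t|lebesgue_on {\<alpha>..\<beta>}. (\<Sum>i<min a b. F (singular_values (\<phi> t) ! i)) / of_nat (min a b)))"

end

theory Submission
  imports Defs
begin

text \<open>Both halves of the theorem are the case \<open>c = s\<close> of one statement about symbols \<open>f\<close> of size
\<open>a \<times> c\<close> and \<open>g\<close> of size \<open>c \<times> b\<close>, proved in \<open>sv_distributed_toeplitz_product\<close>. The idea is to compare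
\<open>T\<^sub>n(f) T\<^sub>n(g)\<close> with a product of block circulants, which the discrete Fourier transform diagonalises and
whose singular value sums are therefore Riemann sums of the limit integral.

The comparison has to survive a product of two unbounded factors, so norms alone do not suffice: the
trace norm of \<open>T\<^sub>n(f)\<close> is controlled by the \<open>L\<^sup>1\<close> norm of \<open>f\<close>, but the product of two matrices
of size \<open>O(n)\<close> in trace norm is not. What is stable is a bound outside a subspace of small
codimension: \<open>small I J A r t\<close> says that \<open>|A v| \<le> t |v|\<close> for all \<open>v\<close> annihilated by at most
\<open>r\<close> linear forms. The parameters add under sums of matrices; under products the ranks add and the bounds
multiply. By the min-max principle such a perturbation shifts singular values by at most \<open>t\<close>
up to moving at most \<open>r\<close> places in the ordering (\<open>weyl_counting\<close>), so a sum
\<open>\<Sum>\<^sub>j \<psi>(\<sigma>\<^sub>j)\<close> with \<open>\<psi>\<close> decreasing, Lipschitz and valued in \<open>[0, 1]\<close> changes by at most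
\<open>r\<close> plus a multiple of \<open>t\<close> times the number of columns (\<open>weyl_test_sum\<close>).

Toeplitz matrices enter through positivity. If \<open>\<phi> \<ge> 0\<close>, then \<open>T\<^sub>n(\<phi>)\<close> is positive semidefinite with trace
at most \<open>n\<close> times the integral of \<open>\<phi>\<close>, so at most \<open>n |\<phi>|\<^sub>1 / t\<close> of its eigenvalues exceed \<open>t\<close>;
splitting into real and imaginary, positive and negative parts gives the same bound up to constants for every
integrable \<open>\<phi>\<close> (\<open>small_toeplitz\<close>). The bound is used at both ends. With a large \<open>t\<close> it makes \<open>T\<^sub>n(g)\<close> bounded
outside a subspace of small relative codimension; with a small \<open>t\<close> it makes \<open>T\<^sub>n(f - p)\<close> negligible when the
trigonometric polynomial \<open>p\<close> is close to \<open>f\<close> in \<open>L\<^sup>1\<close>. For such \<open>p\<close>, \<open>T\<^sub>n(p)\<close> and the circulant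
of \<open>p\<close> differ in a fixed number of columns only. Together these facts bound the difference of the two products
(\<open>small_toeplitz_minus_circulant_product\<close>).

Letting \<open>n\<close> tend to infinity and then \<open>p\<close> tend to \<open>f\<close>, almost everywhere along a subsequence, gives the limit for
the test functions \<open>\<psi>\<close>, together with the measurability of the integrand (\<open>limit_for_test_functions\<close>). The
functions \<open>1 / (1 + x) ^ k\<close> are of this kind, and by the Weierstrass theorem in the variable \<open>1 / (1 + x)\<close> their
combinations approximate every continuous function of compact support uniformly on \<open>[0, \<infinity>)\<close>.\<close>

section \<open>Matrices that are bounded outside a subspace of small codimension\<close>

text \<open>Vectors are functions and matrices are functions of two arguments, read on explicit finite index sets.
Row and column indices may then be pairs, so that block matrices need no index arithmetic, and the dimension may vary
with \<open>n\<close>.\<close>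

definition l2_norm :: "'i set \<Rightarrow> ('i \<Rightarrow> complex) \<Rightarrow> real" where
  "l2_norm I v = L2_set (\<lambda>i. cmod (v i)) I"

definition mat_vec :: "'j set \<Rightarrow> ('i \<Rightarrow> 'j \<Rightarrow> complex) \<Rightarrow> ('j \<Rightarrow> complex) \<Rightarrow> 'i \<Rightarrow> complex" where
  "mat_vec J A v = (\<lambda>i. \<Sum>j\<in>J. A i j * v j)"

definition mat_prod :: "'k set \<Rightarrow> ('i \<Rightarrow> 'k \<Rightarrow> complex) \<Rightarrow> ('k \<Rightarrow> 'j \<Rightarrow> complex) \<Rightarrow> 'i \<Rightarrow> 'j \<Rightarrow> complex" where
  "mat_prod K A B = (\<lambda>i j. \<Sum>k\<in>K. A i k * B k j)"

text \<open>This is the relation "\<open>A\<close> is the sum of a matrix of rank at most \<open>r\<close> and one of norm at most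
\<open>t\<close>", stated through the linear forms \<open>w \<in> W\<close> that cut out a subspace on which \<open>A\<close> has norm at most
\<open>t\<close>. In this form sums and products are handled by collecting linear forms, with no decomposition of \<open>A\<close>.\<close>

definition small :: "'i set \<Rightarrow> 'j set \<Rightarrow> ('i \<Rightarrow> 'j \<Rightarrow> complex) \<Rightarrow> real \<Rightarrow> real \<Rightarrow> bool" where
  "small I J A r t \<longleftrightarrow> (\<exists>W. finite W \<and> real (card W) \<le> r \<and>
     (\<forall>v. (\<forall>w\<in>W. (\<Sum>j\<in>J. w j * v j) = 0) \<longrightarrow> l2_norm I (mat_vec J A v) \<le> t * l2_norm J v))"

lemma l2_norm_nonneg [simp]: "0 \<le> l2_norm I v"
  by (simp add: l2_norm_def)

lemma l2_norm_sq: "(l2_norm I v)\<^sup>2 = (\<Sum>i\<in>I. (cmod (v i))\<^sup>2)"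
  by (simp add: l2_norm_def L2_set_def sum_nonneg)

lemma l2_norm_add: "l2_norm I (\<lambda>i. u i + v i) \<le> l2_norm I u + l2_norm I v"
proof -
  have "l2_norm I (\<lambda>i. u i + v i) \<le> L2_set (\<lambda>i. cmod (u i) + cmod (v i)) I"
    unfolding l2_norm_def by (rule L2_set_mono) (auto intro: norm_triangle_ineq)
  also have "\<dots> \<le> l2_norm I u + l2_norm I v"
    unfolding l2_norm_def by (rule L2_set_triangle_ineq)
  finally show ?thesis .
qed

lemma l2_norm_scale: "l2_norm I (\<lambda>i. c * v i) = cmod c * l2_norm I v"
  unfolding l2_norm_def by (simp add: norm_mult L2_set_left_distrib L2_set_right_distrib)

lemma l2_norm_cong: "(\<And>i. i \<in> I \<Longrightarrow> u i = v i) \<Longrightarrow> l2_norm I u = l2_norm I v"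
  by (simp add: l2_norm_def cong: L2_set_cong)

lemma mat_vec_mat_prod: "finite J \<Longrightarrow> finite K \<Longrightarrow> mat_vec J (mat_prod K A B) v = mat_vec K A (mat_vec J B v)"
  unfolding mat_vec_def mat_prod_def
  by (rule ext) (simp add: sum_distrib_left sum_distrib_right mult.assoc sum.swap[of _ J K])

lemma small_mono: "small I J A r t \<Longrightarrow> r \<le> r' \<Longrightarrow> t \<le> t' \<Longrightarrow> small I J A r' t'"
  unfolding small_def by (meson mult_right_mono l2_norm_nonneg order_trans)

lemma small_cong:
  assumes "\<And>i j. i \<in> I \<Longrightarrow> j \<in> J \<Longrightarrow> A i j = B i j" "small I J A r t"
  shows "small I J B r t"
proof -
  have "l2_norm I (mat_vec J A v) = l2_norm I (mat_vec J B v)" for v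
    unfolding mat_vec_def by (intro l2_norm_cong sum.cong) (auto simp: assms)
  with assms(2) show ?thesis by (simp add: small_def)
qed

lemma small_add:
  assumes "small I J A r t" "small I J B r' t'"
  shows "small I J (\<lambda>i j. A i j + B i j) (r + r') (t + t')"
proof -
  obtain W where W: "finite W" "real (card W) \<le> r"
    "\<And>v. (\<forall>w\<in>W. (\<Sum>j\<in>J. w j * v j) = 0) \<Longrightarrow> l2_norm I (mat_vec J A v) \<le> t * l2_norm J v"
    using assms(1) unfolding small_def by blast
  obtain W' where W': "finite W'" "real (card W') \<le> r'"
    "\<And>v. (\<forall>w\<in>W'. (\<Sum>j\<in>J. w j * v j) = 0) \<Longrightarrow> l2_norm I (mat_vec J B v) \<le> t' * l2_norm J v"
    using assms(2) unfolding small_def by blast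
  have "l2_norm I (mat_vec J (\<lambda>i j. A i j + B i j) v) \<le> (t + t') * l2_norm J v"
    if "\<forall>w\<in>W \<union> W'. (\<Sum>j\<in>J. w j * v j) = 0" for v
  proof -
    have "l2_norm I (mat_vec J (\<lambda>i j. A i j + B i j) v) = l2_norm I (\<lambda>i. mat_vec J A v i + mat_vec J B v i)"
      by (simp add: mat_vec_def distrib_right sum.distrib)
    also have "\<dots> \<le> l2_norm I (mat_vec J A v) + l2_norm I (mat_vec J B v)" by (rule l2_norm_add)
    also have "\<dots> \<le> t * l2_norm J v + t' * l2_norm J v"
      using W(3)[of v] W'(3)[of v] that by (intro add_mono) auto
    finally show ?thesis by (simp add: distrib_right)
  qed
  moreover have "real (card (W \<union> W')) \<le> r + r'"
    using card_Un_le[of W W'] W(2) W'(2) by linarith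
  ultimately show ?thesis
    unfolding small_def using W(1) W'(1) by (intro exI[of _ "W \<union> W'"]) auto
qed

lemma small_scale:
  assumes "small I J A r t"
  shows "small I J (\<lambda>i j. c * A i j) r (cmod c * t)"
proof -
  have "l2_norm I (mat_vec J (\<lambda>i j. c * A i j) v) = cmod c * l2_norm I (mat_vec J A v)" for v
    by (simp add: mat_vec_def mult.assoc flip: sum_distrib_left l2_norm_scale)
  then show ?thesis
    using assms unfolding small_def by (simp add: mult.assoc) (meson mult_left_mono norm_ge_zero)
qed

lemma small_zero: "small I J (\<lambda>i j. 0) 0 0"
  unfolding small_def by (intro exI[of _ "{}"]) (auto simp: mat_vec_def l2_norm_def L2_set_def)

lemma small_sum:
  assumes "finite S" "\<And>x. x \<in> S \<Longrightarrow> small I J (A x) r t"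
  shows "small I J (\<lambda>i j. \<Sum>x\<in>S. A x i j) (real (card S) * r) (real (card S) * t)"
  using assms
proof (induction S rule: finite_induct)
  case empty
  then show ?case by (simp add: small_zero)
next
  case (insert x S)
  then have "small I J (\<lambda>i j. A x i j + (\<Sum>x\<in>S. A x i j)) (r + real (card S) * r) (t + real (card S) * t)"
    by (intro small_add) auto
  then show ?case using insert by (simp add: distrib_right)
qed

text \<open>For \<open>A B v\<close> to be bounded it suffices that \<open>v\<close> is annihilated by the forms of \<open>B\<close> and
\<open>B v\<close> by those of \<open>A\<close>; the latter condition is given by the forms of \<open>A\<close> composed with \<open>B\<close>.\<close>

lemma small_mat_prod:
  assumes "small I K A r t" "small K J B r' t'" "0 \<le> t" "finite J" "finite K"
  shows "small I J (mat_prod K A B) (r + r') (t * t')"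
proof -
  obtain W where W: "finite W" "real (card W) \<le> r"
    "\<And>v. (\<forall>w\<in>W. (\<Sum>j\<in>K. w j * v j) = 0) \<Longrightarrow> l2_norm I (mat_vec K A v) \<le> t * l2_norm K v"
    using assms(1) unfolding small_def by blast
  obtain W' where W': "finite W'" "real (card W') \<le> r'"
    "\<And>v. (\<forall>w\<in>W'. (\<Sum>j\<in>J. w j * v j) = 0) \<Longrightarrow> l2_norm K (mat_vec J B v) \<le> t' * l2_norm J v"
    using assms(2) unfolding small_def by blast
  define V where "V = (\<lambda>w j. \<Sum>k\<in>K. w k * B k j) ` W"
  have "l2_norm I (mat_vec J (mat_prod K A B) v) \<le> (t * t') * l2_norm J v"
    if v: "\<forall>w\<in>V \<union> W'. (\<Sum>j\<in>J. w j * v j) = 0" for v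
  proof -
    have 1: "(\<Sum>k\<in>K. w k * mat_vec J B v k) = 0" if "w \<in> W" for w
    proof -
      have "(\<Sum>k\<in>K. w k * mat_vec J B v k) = (\<Sum>j\<in>J. (\<Sum>k\<in>K. w k * B k j) * v j)"
        by (simp add: mat_vec_def sum_distrib_left sum_distrib_right mult.assoc sum.swap[of _ J K])
      also have "\<dots> = 0" using v that by (auto simp: V_def)
      finally show ?thesis .
    qed
    have "l2_norm I (mat_vec J (mat_prod K A B) v) = l2_norm I (mat_vec K A (mat_vec J B v))"
      using assms by (simp add: mat_vec_mat_prod)
    also have "\<dots> \<le> t * l2_norm K (mat_vec J B v)" using 1 W(3) by auto
    also have "\<dots> \<le> t * (t' * l2_norm J v)" using W'(3)[of v] v assms by (intro mult_left_mono) auto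
    finally show ?thesis by (simp add: mult.assoc)
  qed
  moreover have "real (card (V \<union> W')) \<le> r + r'"
    using card_Un_le[of V W'] W(2) W'(2) card_image_le[OF W(1), of "\<lambda>w j. \<Sum>k\<in>K. w k * B k j"]
    unfolding V_def by linarith
  ultimately show ?thesis
    unfolding small_def using W(1) W'(1)
    by (intro exI[of _ "V \<union> W'"]) (auto simp: V_def)
qed

lemma small_entries:
  assumes "finite I" "finite J"
  shows "small I J A 0 (\<Sum>i\<in>I. \<Sum>j\<in>J. cmod (A i j))"
proof -
  have "l2_norm I (mat_vec J A v) \<le> (\<Sum>i\<in>I. \<Sum>j\<in>J. cmod (A i j)) * l2_norm J v" for v
  proof -
    have "l2_norm I (mat_vec J A v) \<le> (\<Sum>i\<in>I. cmod (mat_vec J A v i))"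
      unfolding l2_norm_def by (rule L2_set_le_sum) auto
    also have "\<dots> \<le> (\<Sum>i\<in>I. \<Sum>j\<in>J. cmod (A i j) * cmod (v j))"
      unfolding mat_vec_def by (intro sum_mono order_trans[OF norm_sum]) (simp add: norm_mult)
    also have "\<dots> \<le> (\<Sum>i\<in>I. \<Sum>j\<in>J. cmod (A i j) * l2_norm J v)"
      unfolding l2_norm_def by (intro sum_mono mult_left_mono member_le_L2_set assms) auto
    finally show ?thesis by (simp add: sum_distrib_right)
  qed
  then show ?thesis unfolding small_def by (intro exI[of _ "{}"]) auto
qed

lemma small_supported_columns:
  fixes A :: "'i \<Rightarrow> 'j \<Rightarrow> complex"
  assumes "finite C" "finite J" "\<And>i j. i \<in> I \<Longrightarrow> j \<in> J \<Longrightarrow> j \<notin> C \<Longrightarrow> A i j = 0"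
  shows "small I J A (real (card C)) 0"
proof -
  define W :: "('j \<Rightarrow> complex) set" where "W = (\<lambda>c j. if j = c then 1 else 0) ` C"
  have "l2_norm I (mat_vec J A v) \<le> 0 * l2_norm J v" if "\<forall>w\<in>W. (\<Sum>j\<in>J. w j * v j) = 0" for v
  proof -
    have v0: "v c = 0" if "c \<in> C" "c \<in> J" for c
    proof -
      have "(\<Sum>j\<in>J. (if j = c then 1 else 0) * v j) = 0"
        using \<open>\<forall>w\<in>W. _\<close> that(1) by (auto simp: W_def)
      moreover have "(\<Sum>j\<in>J. (if j = c then 1 else 0) * v j) = v c"
        using that assms by (subst sum.remove[of _ c]) auto
      ultimately show ?thesis by simp
    qed
    have "mat_vec J A v i = 0" if "i \<in> I" for i
      unfolding mat_vec_def using assms(3)[OF that] v0 by (intro sum.neutral) auto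
    then have "l2_norm I (mat_vec J A v) = l2_norm I (\<lambda>i. 0)" by (intro l2_norm_cong)
    also have "\<dots> = 0" by (simp add: l2_norm_def L2_set_def)
    finally show ?thesis by simp
  qed
  moreover have "card W \<le> card C" unfolding W_def by (rule card_image_le[OF assms(1)])
  ultimately show ?thesis
    unfolding small_def using assms(1) by (intro exI[of _ W]) (auto simp: W_def)
qed

text \<open>The rows themselves serve as linear forms. This is what makes the singular values beyond the number of
rows vanish.\<close>

lemma small_rows:
  assumes "finite I"
  shows "small I J A (real (card I)) 0"
proof -
  have "l2_norm I (mat_vec J A v) \<le> 0 * l2_norm J v" if "\<forall>w\<in>A ` I. (\<Sum>j\<in>J. w j * v j) = 0" for v
  proof -
    have "l2_norm I (mat_vec J A v) = l2_norm I (\<lambda>i. 0)" using that by (intro l2_norm_cong) (simp add: mat_vec_def)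
    also have "\<dots> = 0" by (simp add: l2_norm_def L2_set_def)
    finally show ?thesis by simp
  qed
  then show ?thesis
    unfolding small_def using assms card_image_le[OF assms, of A]
    by (intro exI[of _ "A ` I"]) auto
qed

text \<open>A scalar matrix placed at position \<open>(p0, q0)\<close> of every block acts on the \<open>q0\<close>-th components of the
blocks of \<open>v\<close> only, so its linear forms are those of the scalar matrix read on these components.\<close>

lemma small_block:
  fixes M :: "nat \<Rightarrow> nat \<Rightarrow> complex" and n a b p0 q0 :: nat
  assumes "small {..<n} {..<n} M r t" "0 \<le> t" "p0 < a" "q0 < b"
  shows "small ({..<n} \<times> {..<a}) ({..<n} \<times> {..<b})
           (\<lambda>(i, p) (k, q). if p = p0 \<and> q = q0 then M i k else 0) r t"
    (is "small ?I ?J ?A r t")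
proof -
  obtain W where W: "finite W" "real (card W) \<le> r"
    "\<And>v. (\<forall>w\<in>W. (\<Sum>j<n. w j * v j) = 0) \<Longrightarrow> l2_norm {..<n} (mat_vec {..<n} M v) \<le> t * l2_norm {..<n} v"
    using assms(1) unfolding small_def by blast
  define V :: "(nat \<times> nat \<Rightarrow> complex) set" where "V = (\<lambda>w. \<lambda>(k, q). if q = q0 then w k else 0) ` W"
  have row: "(\<Sum>j\<in>?J. (case j of (k, q) \<Rightarrow> if q = q0 then w k else 0) * v j) = (\<Sum>k<n. w k * v (k, q0))"
    for w :: "nat \<Rightarrow> complex" and v
  proof -
    have "(\<Sum>j\<in>?J. (case j of (k, q) \<Rightarrow> if q = q0 then w k else 0) * v j)
        = (\<Sum>k<n. \<Sum>q<b. (if q = q0 then w k else 0) * v (k, q))"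
      by (simp add: sum.cartesian_product case_prod_unfold)
    then show ?thesis using assms(4) by (simp add: if_distrib[of "\<lambda>x. x * _"] cong: if_cong)
  qed
  have "l2_norm ?I (mat_vec ?J ?A v) \<le> t * l2_norm ?J v" if "\<forall>w\<in>V. (\<Sum>j\<in>?J. w j * v j) = 0" for v
  proof -
    define u where "u = (\<lambda>k. v (k, q0))"
    have "(\<Sum>k<n. w k * u k) = 0" if "w \<in> W" for w
      using \<open>\<forall>w\<in>V. _\<close> that row[of w v] unfolding V_def u_def by auto
    then have le: "l2_norm {..<n} (mat_vec {..<n} M u) \<le> t * l2_norm {..<n} u" by (intro W(3)) auto
    have mat_vec: "mat_vec ?J ?A v (i, p) = (if p = p0 then mat_vec {..<n} M u i else 0)" for i p
      using row[of "M i" v] by (auto simp: mat_vec_def u_def case_prod_unfold intro!: sum.neutral cong: if_cong)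
    have "(l2_norm ?I (mat_vec ?J ?A v))\<^sup>2 = (\<Sum>i<n. \<Sum>p<a. (cmod (mat_vec ?J ?A v (i, p)))\<^sup>2)"
      by (simp add: l2_norm_sq sum.cartesian_product)
    also have "\<dots> = (\<Sum>i<n. \<Sum>p<a. if p = p0 then (cmod (mat_vec {..<n} M u i))\<^sup>2 else 0)"
      by (intro sum.cong) (auto simp: mat_vec)
    also have "\<dots> = (l2_norm {..<n} (mat_vec {..<n} M u))\<^sup>2"
      using assms(3) by (simp add: l2_norm_sq)
    finally have 1: "l2_norm ?I (mat_vec ?J ?A v) = l2_norm {..<n} (mat_vec {..<n} M u)" by simp
    have "(l2_norm {..<n} u)\<^sup>2 \<le> (\<Sum>k<n. \<Sum>q<b. (cmod (v (k, q)))\<^sup>2)"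
      unfolding l2_norm_sq u_def using assms(4) by (intro sum_mono member_le_sum) auto
    also have "\<dots> = (l2_norm ?J v)\<^sup>2" by (simp add: l2_norm_sq sum.cartesian_product)
    finally have "l2_norm {..<n} u \<le> l2_norm ?J v" by (rule power2_le_imp_le) simp
    with le 1 assms(2) show ?thesis by (metis mult_left_mono order_trans)
  qed
  moreover have "card V \<le> card W" unfolding V_def by (rule card_image_le[OF W(1)])
  ultimately show ?thesis
    unfolding small_def using W(1,2) by (intro exI[of _ V]) (auto simp: V_def)
qed

lemma small_blocks:
  fixes M :: "nat \<Rightarrow> nat \<Rightarrow> nat \<Rightarrow> nat \<Rightarrow> complex" and n a b :: nat
  assumes "\<And>p q. p < a \<Longrightarrow> q < b \<Longrightarrow> small {..<n} {..<n} (M p q) r t" "0 \<le> t"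
  shows "small ({..<n} \<times> {..<a}) ({..<n} \<times> {..<b}) (\<lambda>(i, p) (k, q). M p q i k)
           (real (a * b) * r) (real (a * b) * t)"
proof -
  have "small ({..<n} \<times> {..<a}) ({..<n} \<times> {..<b})
     (\<lambda>i j. \<Sum>x\<in>{..<a} \<times> {..<b}. (\<lambda>(p0, q0) (i, p) (k, q). if p = p0 \<and> q = q0 then M p0 q0 i k else 0) x i j)
     (real (card ({..<a} \<times> {..<b})) * r) (real (card ({..<a} \<times> {..<b})) * t)"
    using assms by (intro small_sum) (auto intro!: small_block)
  then have "small ({..<n} \<times> {..<a}) ({..<n} \<times> {..<b})
     (\<lambda>i j. \<Sum>x\<in>{..<a} \<times> {..<b}. (\<lambda>(p0, q0) (i, p) (k, q). if p = p0 \<and> q = q0 then M p0 q0 i k else 0) x i j)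
     (real (a * b) * r) (real (a * b) * t)" by simp
  then show ?thesis
  proof (rule small_cong[rotated])
    fix x y assume "x \<in> {..<n} \<times> {..<a}" "y \<in> {..<n} \<times> {..<b}"
    then obtain i p k q where "x = (i, p)" "y = (k, q)" "p < a" "q < b" by auto
    then show "(\<Sum>x'\<in>{..<a} \<times> {..<b}. (\<lambda>(p0, q0) (i, p) (k, q). if p = p0 \<and> q = q0 then M p0 q0 i k else 0) x' x y)
        = (case x of (i, p) \<Rightarrow> \<lambda>(k, q). M p q i k) y"
      by (subst sum.remove[of _ "(p, q)"]) (auto intro!: sum.neutral split: if_splits)
  qed
qed

section \<open>Singular systems and the min-max principle\<close>

text \<open>Gaussian elimination: an equation with a nonzero coefficient expresses one unknown through the others
and disappears together with it.\<close>

lemma homogeneous_system: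
  fixes W :: "nat \<Rightarrow> 'k \<Rightarrow> complex"
  assumes "finite S" "r < card S"
  shows "\<exists>c. (\<exists>k\<in>S. c k \<noteq> 0) \<and> (\<forall>i<r. (\<Sum>k\<in>S. W i k * c k) = 0)"
  using assms
proof (induction r arbitrary: S W)
  case 0
  then have "S \<noteq> {}" by auto
  then show ?case by (intro exI[of _ "\<lambda>_. 1"]) auto
next
  case (Suc r)
  show ?case
  proof (cases "\<exists>k0\<in>S. W r k0 \<noteq> 0")
    case False
    have "r < card S" using Suc.prems by simp
    from Suc.IH[OF Suc.prems(1) this, of W] obtain c where
      c: "\<exists>k\<in>S. c k \<noteq> 0" "\<forall>i<r. (\<Sum>k\<in>S. W i k * c k) = 0" by blast
    moreover have "(\<Sum>k\<in>S. W r k * c k) = 0" using False by (intro sum.neutral) auto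
    ultimately show ?thesis by (intro exI[of _ c]) (auto simp: less_Suc_eq)
  next
    case True
    then obtain k0 where k0: "k0 \<in> S" "W r k0 \<noteq> 0" by blast
    \<comment> \<open>Eliminating the unknown with index \<open>k0\<close> by the equation with index \<open>r\<close>.\<close>
    define W' where "W' = (\<lambda>i k. W i k - W i k0 * W r k / W r k0)"
    have card: "r < card (S - {k0})" using Suc.prems k0 by simp
    from Suc.IH[OF _ card, of W'] Suc.prems obtain c where
      c: "\<exists>k\<in>S - {k0}. c k \<noteq> 0" "\<forall>i<r. (\<Sum>k\<in>S - {k0}. W' i k * c k) = 0" by auto
    \<comment> \<open>The eliminated unknown is recovered from the equation with index \<open>r\<close>.\<close>
    define d where "d = c(k0 := - (\<Sum>k\<in>S - {k0}. W r k * c k) / W r k0)"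
    have sum: "(\<Sum>k\<in>S. W i k * d k) = (\<Sum>k\<in>S - {k0}. W' i k * c k)" for i
    proof -
      have "(\<Sum>k\<in>S. W i k * d k) = W i k0 * d k0 + (\<Sum>k\<in>S - {k0}. W i k * d k)"
        using k0 Suc.prems by (simp add: sum.remove)
      also have "(\<Sum>k\<in>S - {k0}. W i k * d k) = (\<Sum>k\<in>S - {k0}. W i k * c k)"
        by (intro sum.cong) (auto simp: d_def)
      also have "W i k0 * d k0 = - (\<Sum>k\<in>S - {k0}. W i k0 * W r k / W r k0 * c k)"
        by (simp add: d_def sum_distrib_left sum_divide_distrib mult.assoc)
      finally show ?thesis
        by (simp add: W'_def left_diff_distrib sum_subtractf)
    qed
    have "(\<Sum>k\<in>S. W i k * d k) = 0" if "i < Suc r" for i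
    proof (cases "i = r")
      case True
      then show ?thesis using k0 by (simp add: sum W'_def)
    next
      case False
      then show ?thesis using that c by (simp add: sum)
    qed
    moreover have "\<exists>k\<in>S. d k \<noteq> 0" using c(1) by (auto simp: d_def)
    ultimately show ?thesis by blast
  qed
qed

text \<open>The right singular vectors \<open>v k\<close> form an orthonormal basis whose images are orthogonal with lengths
\<open>\<sigma> k\<close>. Completeness of the basis is part of the definition because the constructions below obtain it
directly. The index set \<open>K\<close> is arbitrary and \<open>\<sigma>\<close> is not sorted, so that the singular values of a block
circulant can be listed frequency by frequency.\<close>

definition sv_system :: "'i set \<Rightarrow> 'j set \<Rightarrow> ('i \<Rightarrow> 'j \<Rightarrow> complex) \<Rightarrow> 'k set \<Rightarrow>
    ('k \<Rightarrow> 'j \<Rightarrow> complex) \<Rightarrow> ('k \<Rightarrow> real) \<Rightarrow> bool" where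
  "sv_system I J A K v \<sigma> \<longleftrightarrow> finite K \<and> (\<forall>k\<in>K. 0 \<le> \<sigma> k) \<and>
     (\<forall>k\<in>K. \<forall>l\<in>K. (\<Sum>j\<in>J. v k j * cnj (v l j)) = (if k = l then 1 else 0)) \<and>
     (\<forall>i\<in>J. \<forall>j\<in>J. (\<Sum>k\<in>K. v k i * cnj (v k j)) = (if i = j then 1 else 0)) \<and>
     (\<forall>k\<in>K. \<forall>l\<in>K. (\<Sum>i\<in>I. mat_vec J A (v k) i * cnj (mat_vec J A (v l) i)) = (if k = l then of_real ((\<sigma> k)\<^sup>2) else 0))"

lemma pythagoras:
  assumes "finite K" "finite I"
    and "\<And>k l. k \<in> K \<Longrightarrow> l \<in> K \<Longrightarrow> (\<Sum>i\<in>I. u k i * cnj (u l i)) = (if k = l then of_real (s k) else 0)"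
  shows "(l2_norm I (\<lambda>i. \<Sum>k\<in>K. c k * u k i))\<^sup>2 = (\<Sum>k\<in>K. (cmod (c k))\<^sup>2 * s k)"
proof -
  have "of_real ((l2_norm I (\<lambda>i. \<Sum>k\<in>K. c k * u k i))\<^sup>2)
      = (\<Sum>i\<in>I. (\<Sum>k\<in>K. c k * u k i) * cnj (\<Sum>l\<in>K. c l * u l i))"
    by (simp only: l2_norm_sq of_real_sum complex_norm_square)
  also have "\<dots> = (\<Sum>i\<in>I. \<Sum>k\<in>K. \<Sum>l\<in>K. c k * cnj (c l) * (u k i * cnj (u l i)))"
    by (simp add: sum_product mult_ac)
  also have "\<dots> = (\<Sum>k\<in>K. \<Sum>i\<in>I. \<Sum>l\<in>K. c k * cnj (c l) * (u k i * cnj (u l i)))"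
    by (rule sum.swap)
  also have "\<dots> = (\<Sum>k\<in>K. \<Sum>l\<in>K. \<Sum>i\<in>I. c k * cnj (c l) * (u k i * cnj (u l i)))"
    by (intro sum.cong refl sum.swap)
  also have "\<dots> = (\<Sum>k\<in>K. \<Sum>l\<in>K. if k = l then c k * cnj (c l) * of_real (s k) else 0)"
    by (intro sum.cong refl) (simp add: assms flip: sum_distrib_left)
  also have "\<dots> = of_real (\<Sum>k\<in>K. (cmod (c k))\<^sup>2 * s k)"
    using assms(1) by (simp only: of_real_sum of_real_mult complex_norm_square sum.delta' if_True cong: sum.cong)
  finally show ?thesis by (simp only: of_real_eq_iff)
qed

lemma mat_vec_sum: "mat_vec J A (\<lambda>j. \<Sum>k\<in>K. c k * v k j) = (\<lambda>i. \<Sum>k\<in>K. c k * mat_vec J A (v k) i)"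
proof
  fix i
  have "mat_vec J A (\<lambda>j. \<Sum>k\<in>K. c k * v k j) i = (\<Sum>j\<in>J. \<Sum>k\<in>K. c k * (A i j * v k j))"
    by (simp add: mat_vec_def sum_distrib_left mult_ac)
  also have "\<dots> = (\<Sum>k\<in>K. c k * mat_vec J A (v k) i)"
    by (subst sum.swap) (simp add: mat_vec_def sum_distrib_left)
  finally show "mat_vec J A (\<lambda>j. \<Sum>k\<in>K. c k * v k j) i = (\<Sum>k\<in>K. c k * mat_vec J A (v k) i)" .
qed

lemma mat_vec_cong: "(\<And>j. j \<in> J \<Longrightarrow> v j = w j) \<Longrightarrow> mat_vec J A v = mat_vec J A w"
  unfolding mat_vec_def by (intro ext sum.cong) auto

text \<open>If more than \<open>r\<close> singular values exceeded \<open>y\<close>, some nonzero combination of the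
corresponding vectors would be annihilated by all the linear forms, yet be stretched by more than \<open>y\<close>.\<close>

lemma small_imp_few_singular_values:
  assumes S: "sv_system I J A K v \<sigma>" and "finite I" "finite J" and "small I J A r y" "0 \<le> y"
  shows "real (card {k\<in>K. y < \<sigma> k}) \<le> r"
proof (rule ccontr)
  define S where "S = {k\<in>K. y < \<sigma> k}"
  assume "\<not> ?thesis"
  then have big: "r < card S" by (simp add: S_def)
  obtain W where W: "finite W" "real (card W) \<le> r"
    "\<And>v. (\<forall>w\<in>W. (\<Sum>j\<in>J. w j * v j) = 0) \<Longrightarrow> l2_norm I (mat_vec J A v) \<le> y * l2_norm J v"
    using assms(4) unfolding small_def by blast
  have fin: "finite K" "finite S" using S by (auto simp: sv_system_def S_def)
  obtain w where w: "bij_betw w {..<card W} W" using ex_bij_betw_nat_finite[OF W(1)] lessThan_atLeast0 by metis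
  have "card W < card S" using big W(2) by linarith
  from homogeneous_system[OF fin(2) this, of "\<lambda>i k. \<Sum>j\<in>J. w i j * v k j"]
  obtain c where c: "\<exists>k\<in>S. c k \<noteq> 0"
    "\<forall>i<card W. (\<Sum>k\<in>S. (\<Sum>j\<in>J. w i j * v k j) * c k) = 0" by blast
  define x where "x = (\<lambda>j. \<Sum>k\<in>S. c k * v k j)"
  have "(\<Sum>j\<in>J. u j * x j) = 0" if uW: "u \<in> W" for u
  proof -
    obtain i where i: "i < card W" "u = w i" using w uW unfolding bij_betw_def by blast
    have "(\<Sum>j\<in>J. u j * x j) = (\<Sum>k\<in>S. (\<Sum>j\<in>J. w i j * v k j) * c k)"
      by (simp add: x_def i sum_distrib_left sum_distrib_right mult_ac sum.swap[of _ J S])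
    with c(2) i show ?thesis by simp
  qed
  then have "l2_norm I (mat_vec J A x) \<le> y * l2_norm J x" by (intro W(3)) auto
  then have le: "(l2_norm I (mat_vec J A x))\<^sup>2 \<le> (y * l2_norm J x)\<^sup>2" by (intro power_mono) auto
  have 1: "(l2_norm J x)\<^sup>2 = (\<Sum>k\<in>S. (cmod (c k))\<^sup>2 * 1)"
    unfolding x_def using S fin assms by (intro pythagoras) (auto simp: sv_system_def S_def)
  have 2: "(l2_norm I (mat_vec J A x))\<^sup>2 = (\<Sum>k\<in>S. (cmod (c k))\<^sup>2 * (\<sigma> k)\<^sup>2)"
    unfolding x_def mat_vec_sum using S fin assms
    by (intro pythagoras) (auto simp: sv_system_def S_def)
  obtain k where k: "k \<in> S" "c k \<noteq> 0" using c(1) by blast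
  have sq: "y\<^sup>2 < (\<sigma> l)\<^sup>2" if "l \<in> S" for l
    using that assms(5) by (intro power_strict_mono) (auto simp: S_def)
  have "(\<Sum>k\<in>S. (cmod (c k))\<^sup>2 * y\<^sup>2) < (\<Sum>k\<in>S. (cmod (c k))\<^sup>2 * (\<sigma> k)\<^sup>2)"
  proof (rule sum_strict_mono_ex1[OF fin(2)])
    show "\<forall>l\<in>S. (cmod (c l))\<^sup>2 * y\<^sup>2 \<le> (cmod (c l))\<^sup>2 * (\<sigma> l)\<^sup>2"
      using sq by (intro ballI mult_left_mono) (auto intro: less_imp_le)
    show "\<exists>l\<in>S. (cmod (c l))\<^sup>2 * y\<^sup>2 < (cmod (c l))\<^sup>2 * (\<sigma> l)\<^sup>2"
      using k sq by (intro bexI[OF _ k(1)] mult_strict_left_mono) auto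
  qed
  then show False using le 1 2 by (simp add: power_mult_distrib sum_distrib_left mult.commute)
qed

text \<open>The linear forms are the coordinates with respect to the singular vectors with
\<open>\<sigma> k > x\<close>: a vector for which these coordinates vanish is stretched by at most \<open>x\<close>.\<close>

lemma few_singular_values_imp_small:
  assumes S: "sv_system I J A K v \<sigma>" and "finite I" "finite J" "0 \<le> x"
  shows "small I J A (real (card {k\<in>K. x < \<sigma> k})) x"
proof -
  define S where "S = {k\<in>K. x < \<sigma> k}"
  have fin: "finite K" "finite S" using S by (auto simp: sv_system_def S_def)
  define W where "W = (\<lambda>k j. cnj (v k j)) ` S"
  have "l2_norm I (mat_vec J A u) \<le> x * l2_norm J u" if u: "\<forall>w\<in>W. (\<Sum>j\<in>J. w j * u j) = 0" for u
  proof -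
    define c where "c = (\<lambda>k. \<Sum>j\<in>J. cnj (v k j) * u j)"
    have exp: "u i = (\<Sum>k\<in>K. c k * v k i)" if "i \<in> J" for i
    proof -
      have "(\<Sum>k\<in>K. c k * v k i) = (\<Sum>j\<in>J. (\<Sum>k\<in>K. v k i * cnj (v k j)) * u j)"
        by (simp add: c_def sum_distrib_left sum_distrib_right mult_ac sum.swap[of _ J K])
      also have "\<dots> = (\<Sum>j\<in>J. if i = j then u j else 0)"
        using S that by (intro sum.cong) (auto simp: sv_system_def)
      finally show ?thesis using that assms by simp
    qed
    have c0: "c k = 0" if "k \<in> S" for k using u that by (auto simp: W_def c_def)
    have "(l2_norm J u)\<^sup>2 = (l2_norm J (\<lambda>i. \<Sum>k\<in>K. c k * v k i))\<^sup>2"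
      using l2_norm_cong[of J u, OF exp] by simp
    also have "\<dots> = (\<Sum>k\<in>K. (cmod (c k))\<^sup>2 * 1)"
      using S fin assms by (intro pythagoras) (auto simp: sv_system_def)
    finally have 1: "(l2_norm J u)\<^sup>2 = (\<Sum>k\<in>K. (cmod (c k))\<^sup>2)" by simp
    have "mat_vec J A u = (\<lambda>i. \<Sum>k\<in>K. c k * mat_vec J A (v k) i)"
      using mat_vec_cong[of J u, OF exp] by (simp add: mat_vec_sum)
    then have "(l2_norm I (mat_vec J A u))\<^sup>2 = (\<Sum>k\<in>K. (cmod (c k))\<^sup>2 * (\<sigma> k)\<^sup>2)"
      using S fin assms by (simp only:, intro pythagoras) (auto simp: sv_system_def)
    also have "\<dots> \<le> (\<Sum>k\<in>K. (cmod (c k))\<^sup>2 * x\<^sup>2)"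
    proof (intro sum_mono)
      fix k assume k: "k \<in> K"
      show "(cmod (c k))\<^sup>2 * (\<sigma> k)\<^sup>2 \<le> (cmod (c k))\<^sup>2 * x\<^sup>2"
      proof (cases "k \<in> S")
        case False
        then have "\<sigma> k \<le> x" "0 \<le> \<sigma> k" using k S by (auto simp: S_def sv_system_def)
        then show ?thesis by (intro mult_left_mono power_mono) auto
      qed (simp add: c0)
    qed
    also have "\<dots> = (x * l2_norm J u)\<^sup>2" by (simp add: 1 power_mult_distrib sum_distrib_left mult.commute)
    finally show ?thesis by (rule power2_le_imp_le) (simp add: assms)
  qed
  moreover have "card W \<le> card S" unfolding W_def by (rule card_image_le[OF fin(2)])
  ultimately show ?thesis
    unfolding small_def S_def[symmetric] using fin by (intro exI[of _ W]) (auto simp: W_def)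
qed

text \<open>Weyl's inequality between singular values, as an inequality between counting functions: \<open>A\<close> is \<open>B\<close> plus
a small perturbation, and smallness of a matrix is the same as a bound on the number of its large singular values.\<close>

lemma weyl_counting:
  assumes "sv_system I J A K v \<sigma>" "sv_system I J B L w \<tau>" "finite I" "finite J"
    and "small I J (\<lambda>i j. A i j - B i j) r t" "0 \<le> t" "0 \<le> x"
  shows "real (card {k\<in>K. x + t < \<sigma> k}) \<le> real (card {l\<in>L. x < \<tau> l}) + r"
proof -
  have "small I J (\<lambda>i j. B i j + (A i j - B i j)) (real (card {l\<in>L. x < \<tau> l}) + r) (x + t)"
    using assms by (intro small_add few_singular_values_imp_small) auto
  then show ?thesis using assms by (intro small_imp_few_singular_values[of I J A K v]) auto
qed

text \<open>Monotonicity turns an inequality between sorted singular values into one between sums, boundedness pays for the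
\<open>r\<close> values lost by a rank \<open>r\<close> perturbation, and the Lipschitz constant pays for the shift by \<open>t\<close>.\<close>

definition test_fun :: "real \<Rightarrow> (real \<Rightarrow> real) \<Rightarrow> bool" where
  "test_fun L \<psi> \<longleftrightarrow> 0 \<le> L \<and> (\<forall>x\<ge>0. 0 \<le> \<psi> x \<and> \<psi> x \<le> 1) \<and> (\<forall>x\<ge>0. \<forall>y\<ge>x. \<psi> y \<le> \<psi> x \<and> \<psi> x - \<psi> y \<le> L * (y - x))"

lemma sorted_enumeration:
  fixes \<sigma> :: "'k \<Rightarrow> 'a :: linorder"
  assumes "finite K"
  obtains xs where "sorted xs" "length xs = card K"
    "\<And>P. card {k\<in>K. P (\<sigma> k)} = card {i. i < card K \<and> P (xs ! i)}"
    "\<And>\<psi>. (\<Sum>k\<in>K. \<psi> (\<sigma> k) :: real) = (\<Sum>i<card K. \<psi> (xs ! i))"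
    "set xs = \<sigma> ` K"
proof -
  define xs where "xs = sorted_list_of_multiset (image_mset \<sigma> (mset_set K))"
  have ms: "mset xs = image_mset \<sigma> (mset_set K)" by (simp add: xs_def)
  have len: "length xs = card K" using ms by (metis size_image_mset size_mset size_mset_set)
  have f1: "card {k\<in>K. P (\<sigma> k)} = card {i. i < card K \<and> P (xs ! i)}" for P
  proof -
    have "card {i. i < card K \<and> P (xs ! i)} = length (filter P xs)" by (simp add: length_filter_conv_card flip: len)
    also have "\<dots> = size (filter_mset P (mset xs))" by (metis mset_filter size_mset)
    also have "\<dots> = card {k\<in>K. P (\<sigma> k)}"
      using assms by (simp add: ms filter_mset_image_mset filter_mset_mset_set)
    finally show ?thesis by simp
  qed
  have f2: "(\<Sum>k\<in>K. \<psi> (\<sigma> k) :: real) = (\<Sum>i<card K. \<psi> (xs ! i))" for \<psi>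
  proof -
    have "(\<Sum>i<card K. \<psi> (xs ! i)) = sum_list (map \<psi> xs)"
      by (simp add: sum_list_sum_nth lessThan_atLeast0 len)
    also have "\<dots> = sum_mset (image_mset \<psi> (mset xs))" by (simp add: sum_mset_sum_list flip: mset_map)
    also have "\<dots> = (\<Sum>k\<in>K. \<psi> (\<sigma> k))" by (simp add: ms image_mset.compositionality comp_def sum_unfold_sum_mset)
    finally show ?thesis by simp
  qed
  have f3: "set xs = \<sigma> ` K" using assms ms by (metis finite_set_mset_mset_set set_image_mset set_mset_mset)
  have f4: "sorted xs" by (simp add: xs_def)
  show ?thesis by (rule that[OF f4 len f1 f2 f3])
qed

text \<open>In ascending order \<open>xs\<close> of \<open>\<sigma>\<close> and \<open>ys\<close> of \<open>\<tau>\<close>, the counting inequality says that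
\<open>xs ! j \<le> ys ! (j + R) + t\<close>, where \<open>R\<close> is the integer part of \<open>r\<close>.\<close>

lemma test_fun_sum_le:
  assumes \<psi>: "test_fun L \<psi>" and "finite K" "finite K'" "card K = N" "card K' = N"
    and nn: "\<And>k. k \<in> K \<Longrightarrow> 0 \<le> \<sigma> k" "\<And>k. k \<in> K' \<Longrightarrow> 0 \<le> \<tau> k" and "0 \<le> t" "0 \<le> r"
    and cnt: "\<And>x. 0 \<le> x \<Longrightarrow> real (card {k\<in>K. x + t < \<sigma> k}) \<le> real (card {l\<in>K'. x < \<tau> l}) + r"
  shows "(\<Sum>k\<in>K'. \<psi> (\<tau> k)) \<le> (\<Sum>k\<in>K. \<psi> (\<sigma> k)) + r + real N * L * t"
proof -
  obtain xs where xs': "sorted xs" "length xs = card K"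
    "\<And>P. card {k\<in>K. P (\<sigma> k)} = card {i. i < card K \<and> P (xs ! i)}"
    "\<And>\<psi>. (\<Sum>k\<in>K. \<psi> (\<sigma> k) :: real) = (\<Sum>i<card K. \<psi> (xs ! i))" "set xs = \<sigma> ` K"
    by (rule sorted_enumeration[OF assms(2), of \<sigma>]) (rule that)
  note xs = xs'[unfolded assms(4)]
  obtain ys where ys': "sorted ys" "length ys = card K'"
    "\<And>P. card {k\<in>K'. P (\<tau> k)} = card {i. i < card K' \<and> P (ys ! i)}"
    "\<And>\<psi>. (\<Sum>k\<in>K'. \<psi> (\<tau> k) :: real) = (\<Sum>i<card K'. \<psi> (ys ! i))" "set ys = \<tau> ` K'"
    by (rule sorted_enumeration[OF assms(3), of \<tau>]) (rule that)
  note ys = ys'[unfolded assms(5)]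
  have L: "0 \<le> L" and \<psi>01: "\<And>x. 0 \<le> x \<Longrightarrow> 0 \<le> \<psi> x \<and> \<psi> x \<le> 1"
    and \<psi>m: "\<And>x y. 0 \<le> x \<Longrightarrow> x \<le> y \<Longrightarrow> \<psi> y \<le> \<psi> x \<and> \<psi> x - \<psi> y \<le> L * (y - x)"
    using \<psi> by (auto simp: test_fun_def)
  have xs0: "0 \<le> xs ! i" if "i < N" for i using that nn xs(2,5) by (metis imageE nth_mem)
  have ys0: "0 \<le> ys ! i" if "i < N" for i using that nn ys(2,5) by (metis imageE nth_mem)
  define R where "R = nat \<lfloor>r\<rfloor>"
  have R: "real R \<le> r" "r < real R + 1" using assms(9) by (auto simp: R_def)
  have shift: "xs ! j \<le> ys ! (j + R) + t" if "j + R < N" for j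
  proof (rule ccontr)
    assume neg: "\<not> ?thesis"
    define x where "x = ys ! (j + R)"
    \<comment> \<open>Otherwise at least \<open>N - j\<close> of the \<open>\<sigma>\<close> exceed \<open>x + t\<close>, but at most \<open>N - (j + R) - 1\<close> of the \<open>\<tau>\<close> exceed \<open>x\<close>.\<close>
    have "{i. j \<le> i \<and> i < N} \<subseteq> {i. i < N \<and> x + t < xs ! i}"
      using neg xs(1,2) by (auto simp: x_def) (metis less_le_trans not_le sorted_nth_mono)
    then have "card {i. j \<le> i \<and> i < N} \<le> card {i. i < N \<and> x + t < xs ! i}"
      by (intro card_mono) auto
    moreover have "{i. j \<le> i \<and> i < N} = {j..<N}" by auto
    ultimately have 1: "N - j \<le> card {k\<in>K. x + t < \<sigma> k}" by (simp add: xs(3))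
    have "{i. i < N \<and> x < ys ! i} \<subseteq> {j + R<..<N}"
      using ys(1,2) that by (auto simp: x_def) (metis leI not_le sorted_nth_mono)
    then have "card {i. i < N \<and> x < ys ! i} \<le> card {j + R<..<N}" by (intro card_mono) auto
    then have 2: "card {l\<in>K'. x < \<tau> l} \<le> N - (j + R) - 1" by (simp add: ys(3))
    have "real (card {k\<in>K. x + t < \<sigma> k}) \<le> real (card {l\<in>K'. x < \<tau> l}) + r"
      using cnt ys0[OF that] by (simp add: x_def)
    then have "card {k\<in>K. x + t < \<sigma> k} < card {l\<in>K'. x < \<tau> l} + R + 1" using R by linarith
    with 1 2 that show False by linarith
  qed
  have psi_ys: "\<psi> (ys ! i) \<le> (if i < R then 1 else \<psi> (xs ! (i - R)) + L * t)" if "i < N" for i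
  proof (cases "i < R")
    case False
    have 1: "xs ! (i - R) \<le> ys ! i + t" using shift[of "i - R"] False that by simp
    have "\<psi> (ys ! i) \<le> \<psi> (ys ! i + t) + L * t"
      using \<psi>m[of "ys ! i" "ys ! i + t"] ys0[OF that] assms(8) by simp
    also have "\<psi> (ys ! i + t) \<le> \<psi> (xs ! (i - R))"
      using \<psi>m[OF _ 1] xs0[of "i - R"] that by simp
    finally show ?thesis using False by simp
  qed (use \<psi>01 ys0 that in auto)
  have "(\<Sum>i<N. \<psi> (ys ! i)) \<le> (\<Sum>i<N. (if i < R then 1 else \<psi> (xs ! (i - R)) + L * t))"
    by (intro sum_mono psi_ys) auto
  also have "\<dots> \<le> (\<Sum>i<N. (if i < R then 1 else 0) + (if i < R then 0 else \<psi> (xs ! (i - R))) + L * t)"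
    using L assms(8) by (intro sum_mono) auto
  also have "\<dots> = (\<Sum>i<N. if i < R then 1 else 0) + (\<Sum>i<N. if i < R then 0 else \<psi> (xs ! (i - R))) + real N * L * t"
    by (simp add: sum.distrib)
  also have "(\<Sum>i<N. if i < R then 1 else 0) = real (card ({..<N} \<inter> {..<R}))"
    by (simp add: sum.If_cases Collect_conj_eq lessThan_def)
  also have "card ({..<N} \<inter> {..<R}) \<le> card {..<R}" by (intro card_mono) auto
  also have "(\<Sum>i<N. if i < R then 0 else \<psi> (xs ! (i - R))) = (\<Sum>i\<in>{R..<N}. \<psi> (xs ! (i - R)))"
    by (intro sum.mono_neutral_cong_right) auto
  also have "\<dots> = (\<Sum>i<N - R. \<psi> (xs ! i))"
    by (intro sum.reindex_bij_witness[of _ "\<lambda>i. i + R" "\<lambda>i. i - R"]) auto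
  also have "\<dots> \<le> (\<Sum>i<N. \<psi> (xs ! i))"
    using \<psi>01 xs0 by (intro sum_mono2) auto
  finally show ?thesis using R by (simp add: xs(4) ys(4))
qed

lemma sv_system_card:
  assumes "sv_system I J A K v \<sigma>" "finite J"
  shows "card K = card J"
proof -
  have fin: "finite K" using assms by (simp add: sv_system_def)
  have "of_nat (card K) = (\<Sum>k\<in>K. \<Sum>j\<in>J. v k j * cnj (v k j))"
    using assms by (simp add: sv_system_def)
  also have "\<dots> = (\<Sum>j\<in>J. \<Sum>k\<in>K. v k j * cnj (v k j))" by (rule sum.swap)
  also have "\<dots> = of_nat (card J)" using assms by (simp add: sv_system_def)
  finally show ?thesis by (simp only: of_nat_eq_iff)
qed

lemma small_uminus: "small I J A r t \<Longrightarrow> small I J (\<lambda>i j. - A i j) r t"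
  using small_scale[of I J A r t "-1"] by simp

lemma small_nonneg_rank: "small I J A r t \<Longrightarrow> 0 \<le> r"
  unfolding small_def by (meson of_nat_0_le_iff order_trans)

text \<open>For \<open>A = B\<close> and \<open>r = t = 0\<close> this also shows that the sum does not depend on the choice of the singular
system.\<close>

lemma weyl_test_sum:
  assumes "sv_system I J A K v \<sigma>" "sv_system I J B K' w \<tau>" "finite I" "finite J"
    and sm: "small I J (\<lambda>i j. A i j - B i j) r t" and "0 \<le> t" and \<psi>: "test_fun L \<psi>"
  shows "\<bar>(\<Sum>k\<in>K. \<psi> (\<sigma> k)) - (\<Sum>k\<in>K'. \<psi> (\<tau> k))\<bar> \<le> r + real (card J) * L * t"
proof -
  have sm': "small I J (\<lambda>i j. B i j - A i j) r t"
    using small_uminus[OF sm] by simp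
  note r = small_nonneg_rank[OF sm]
  note c = sv_system_card[OF assms(1,4)] sv_system_card[OF assms(2,4)]
  have "(\<Sum>k\<in>K'. \<psi> (\<tau> k)) \<le> (\<Sum>k\<in>K. \<psi> (\<sigma> k)) + r + real (card J) * L * t"
    using weyl_counting[OF assms(1,2,3,4) sm assms(6)] assms c r
    by (intro test_fun_sum_le[OF \<psi>]) (auto simp: sv_system_def)
  moreover have "(\<Sum>k\<in>K. \<psi> (\<sigma> k)) \<le> (\<Sum>k\<in>K'. \<psi> (\<tau> k)) + r + real (card J) * L * t"
    using weyl_counting[OF assms(2,1,3,4) sm' assms(6)] assms c r
    by (intro test_fun_sum_le[OF \<psi>]) (auto simp: sv_system_def)
  ultimately show ?thesis by linarith
qed

section \<open>The spectral theorem for Hermitian matrices\<close>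

definition inner_prod :: "'j set \<Rightarrow> ('j \<Rightarrow> complex) \<Rightarrow> ('j \<Rightarrow> complex) \<Rightarrow> complex" where
  "inner_prod J u v = (\<Sum>j\<in>J. u j * cnj (v j))"

text \<open>The vector \<open>p(H) w\<close>.\<close>

definition poly_apply :: "'j set \<Rightarrow> ('j \<Rightarrow> 'j \<Rightarrow> complex) \<Rightarrow> complex poly \<Rightarrow> ('j \<Rightarrow> complex) \<Rightarrow> 'j \<Rightarrow> complex" where
  "poly_apply J H p w = (\<lambda>j. \<Sum>i\<le>degree p. coeff p i * (mat_vec J H ^^ i) w j)"

lemma inner_prod_cnj: "inner_prod J v u = cnj (inner_prod J u v)"
  by (simp add: inner_prod_def mult.commute)

lemma inner_prod_mat_vec_hermitian:
  assumes "finite J" "\<And>i j. i \<in> J \<Longrightarrow> j \<in> J \<Longrightarrow> H j i = cnj (H i j)"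
  shows "inner_prod J (mat_vec J H u) v = inner_prod J u (mat_vec J H v)"
proof -
  have "inner_prod J (mat_vec J H u) v = (\<Sum>i\<in>J. \<Sum>j\<in>J. H i j * u j * cnj (v i))"
    by (simp add: inner_prod_def mat_vec_def sum_distrib_right)
  also have "\<dots> = (\<Sum>j\<in>J. \<Sum>i\<in>J. H i j * u j * cnj (v i))" by (rule sum.swap)
  also have "\<dots> = (\<Sum>j\<in>J. \<Sum>i\<in>J. u j * cnj (H j i * v i))"
  proof (intro sum.cong refl)
    fix i j assume "j \<in> J" "i \<in> J"
    then have "cnj (H j i) = H i j" using assms(2)[of i j] by simp
    then show "H i j * u j * cnj (v i) = u j * cnj (H j i * v i)" by (simp add: mult_ac)
  qed
  also have "\<dots> = inner_prod J u (mat_vec J H v)"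
    by (simp add: inner_prod_def mat_vec_def sum_distrib_left)
  finally show ?thesis .
qed

lemma poly_apply_degree_le:
  assumes "degree p \<le> n"
  shows "poly_apply J H p w j = (\<Sum>i\<le>n. coeff p i * (mat_vec J H ^^ i) w j)"
  unfolding poly_apply_def using assms
  by (intro sum.mono_neutral_left) (auto simp: coeff_eq_0)

lemma poly_apply_linear_factor:
  "poly_apply J H ([:- r, 1:] * q) w j = mat_vec J H (poly_apply J H q w) j - r * poly_apply J H q w j"
proof -
  define T where "T = (\<lambda>i. (mat_vec J H ^^ i) w)"
  define n where "n = degree q"
  have "degree ([:- r, 1:] * q) \<le> Suc n"
    using degree_mult_le[of "[:- r, 1:]" q] by (simp add: n_def)
  then have "poly_apply J H ([:- r, 1:] * q) w j = (\<Sum>i\<le>Suc n. coeff ([:- r, 1:] * q) i * T i j)"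
    unfolding T_def by (rule poly_apply_degree_le)
  also have "\<dots> = (\<Sum>i\<le>Suc n. coeff (pCons 0 q) i * T i j) - r * (\<Sum>i\<le>Suc n. coeff q i * T i j)"
    by (simp add: algebra_simps sum.distrib sum_subtractf sum_distrib_left del: sum.atMost_Suc)
  also have "(\<Sum>i\<le>Suc n. coeff (pCons 0 q) i * T i j) = (\<Sum>i\<le>n. coeff q i * T (Suc i) j)"
    by (subst sum.atMost_Suc_shift) simp
  also have "\<dots> = mat_vec J H (poly_apply J H q w) j"
    unfolding poly_apply_def T_def n_def mat_vec_sum by simp
  also have "(\<Sum>i\<le>Suc n. coeff q i * T i j) = poly_apply J H q w j"
    unfolding T_def by (rule poly_apply_degree_le[symmetric]) (simp add: n_def)
  finally show ?thesis .
qed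

text \<open>The vectors \<open>w, H w, H\<^sup>2 w, \<dots>\<close> are linearly dependent, so some nonzero polynomial in \<open>H\<close>
annihilates \<open>w\<close>. Removing one linear factor after another, there is a last nonzero vector \<open>q(H) w\<close> that a further
factor \<open>H - r\<close> annihilates. It inherits from \<open>w\<close> every property \<open>P\<close> of an invariant subspace; below, \<open>P\<close> is
orthogonality to the eigenvectors already found.\<close>

lemma eigenvector_exists:
  assumes J: "finite J" and w: "P w" "\<exists>j\<in>J. w j \<noteq> 0"
    and closed: "\<And>u. P u \<Longrightarrow> P (mat_vec J H u)" "\<And>n c us. (\<And>i::nat. P (us i)) \<Longrightarrow> P (\<lambda>j. \<Sum>i\<le>n. c i * us i j)"
  shows "\<exists>u \<mu>. P u \<and> (\<exists>j\<in>J. u j \<noteq> 0) \<and> (\<forall>i\<in>J. mat_vec J H u i = \<mu> * u i)"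
proof -
  have PT: "P ((mat_vec J H ^^ i) w)" for i by (induction i) (auto intro: w closed)
  have Pp: "P (poly_apply J H q w)" for q unfolding poly_apply_def by (rule closed(2)) (rule PT)
  obtain e where e: "bij_betw e {..<card J} J"
    using ex_bij_betw_nat_finite[OF J] lessThan_atLeast0 by metis
  obtain c where c: "\<exists>k\<in>{..card J}. c k \<noteq> 0"
    "\<forall>i<card J. (\<Sum>k\<in>{..card J}. (mat_vec J H ^^ k) w (e i) * c k) = 0"
    using homogeneous_system[of "{..card J}" "card J" "\<lambda>i k. (mat_vec J H ^^ k) w (e i)"] by auto
  \<comment> \<open>The coefficients come from \<open>card J\<close> equations in \<open>card J + 1\<close> unknowns.\<close>
  define p where "p = (\<Sum>k\<le>card J. monom (c k) k)"
  have cp: "coeff p i = (if i \<le> card J then c i else 0)" for i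
    by (simp add: p_def coeff_sum)
  have p0: "p \<noteq> 0" using c(1) cp by (metis atMost_iff coeff_0)
  have dp: "degree p \<le> card J" by (rule degree_le) (simp add: cp)
  have pz: "poly_apply J H p w j = 0" if j: "j \<in> J" for j
  proof -
    obtain i where "i < card J" "j = e i" using e j unfolding bij_betw_def by blast
    then show ?thesis using c(2) by (simp add: poly_apply_degree_le[OF dp] cp mult.commute)
  qed
  have "\<exists>r q. (\<exists>j\<in>J. poly_apply J H q w j \<noteq> 0) \<and> (\<forall>j\<in>J. poly_apply J H ([:- r, 1:] * q) w j = 0)"
    using p0 pz
  proof (induction "degree p" arbitrary: p rule: less_induct)
    case (less p)
    show ?case
    proof (cases "degree p = 0")
      case True
      then obtain a where a: "p = [:a:]" by (metis degree_eq_zeroE)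
      with less.prems w(2) show ?thesis by (auto simp: poly_apply_def)
    next
      case False
      then have "\<not> constant (poly p)" by (simp add: constant_degree)
      then obtain r where "poly p r = 0"
        using fundamental_theorem_of_algebra by blast
      then obtain q where q: "p = [:- r, 1:] * q" by (metis dvdE poly_eq_0_iff_dvd)
      with less.prems have q0: "q \<noteq> 0" by auto
      have "degree p = Suc (degree q)" unfolding q using q0 by (subst degree_mult_eq) auto
      then show ?thesis using less.hyps[of q] q0 less.prems q by (metis lessI)
    qed
  qed
  then obtain r q where rq: "\<exists>j\<in>J. poly_apply J H q w j \<noteq> 0"
    "\<forall>j\<in>J. poly_apply J H ([:- r, 1:] * q) w j = 0" by blast
  then show ?thesis
    using Pp[of q] unfolding poly_apply_linear_factor by (intro exI[of _ "poly_apply J H q w"] exI[of _ r]) auto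
qed

lemma inner_prod_sum_left: "inner_prod J (\<lambda>j. \<Sum>i\<in>S. c i * us i j) v = (\<Sum>i\<in>S. c i * inner_prod J (us i) v)"
proof -
  have "inner_prod J (\<lambda>j. \<Sum>i\<in>S. c i * us i j) v = (\<Sum>j\<in>J. \<Sum>i\<in>S. c i * (us i j * cnj (v j)))"
    by (simp add: inner_prod_def sum_distrib_right mult.assoc)
  also have "\<dots> = (\<Sum>i\<in>S. \<Sum>j\<in>J. c i * (us i j * cnj (v j)))" by (rule sum.swap)
  finally show ?thesis by (simp add: inner_prod_def sum_distrib_left)
qed

lemma inner_prod_self: "inner_prod J u u = of_real ((l2_norm J u)\<^sup>2)"
  by (simp only: inner_prod_def l2_norm_sq of_real_sum complex_norm_square)

lemma orthonormal_eigenvectors: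
  fixes H :: "nat \<Rightarrow> nat \<Rightarrow> complex"
  assumes herm: "\<And>i j. i < N \<Longrightarrow> j < N \<Longrightarrow> H j i = cnj (H i j)" and "m \<le> N"
  shows "\<exists>v \<nu>. (\<forall>k<m. \<forall>l<m. inner_prod {..<N} (v k) (v l) = (if k = l then 1 else 0)) \<and>
    (\<forall>k<m. \<forall>i<N. mat_vec {..<N} H (v k) i = of_real (\<nu> k) * v k i)"
  using \<open>m \<le> N\<close>
proof (induction m)
  case 0
  then show ?case by simp
next
  case (Suc m)
  from Suc.IH[OF Suc_leD[OF Suc.prems]]
  obtain v \<nu> where on: "\<And>k l. k < m \<Longrightarrow> l < m \<Longrightarrow> inner_prod {..<N} (v k) (v l) = (if k = l then 1 else 0)"
    and ev: "\<And>k i. k < m \<Longrightarrow> i < N \<Longrightarrow> mat_vec {..<N} H (v k) i = of_real (\<nu> k) * v k i" by blast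
  let ?J = "{..<N}"
  let ?P = "\<lambda>u. \<forall>k<m. inner_prod ?J u (v k) = 0"
  obtain w where w: "\<exists>j\<in>?J. w j \<noteq> 0" "?P w"
    using homogeneous_system[of ?J m "\<lambda>k j. cnj (v k j)"] Suc.prems by (auto simp: inner_prod_def mult.commute)
  have "\<exists>u \<mu>. ?P u \<and> (\<exists>j\<in>?J. u j \<noteq> 0) \<and> (\<forall>i\<in>?J. mat_vec ?J H u i = \<mu> * u i)"
  proof (rule eigenvector_exists)
    fix u assume u: "?P u"
    have "inner_prod ?J (mat_vec ?J H u) (v k) = 0" if "k < m" for k
    proof -
      have "inner_prod ?J (mat_vec ?J H u) (v k) = inner_prod ?J u (mat_vec ?J H (v k))"
        by (rule inner_prod_mat_vec_hermitian) (auto intro: herm)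
      also have "\<dots> = (\<Sum>j<N. of_real (\<nu> k) * (u j * cnj (v k j)))"
        unfolding inner_prod_def using ev[OF that] by (intro sum.cong) auto
      also have "\<dots> = 0" using u that by (simp add: inner_prod_def flip: sum_distrib_left)
      finally show ?thesis .
    qed
    then show "?P (mat_vec ?J H u)" by blast
  qed (use w in \<open>auto simp: inner_prod_sum_left\<close>)
  then obtain u \<mu> where u: "?P u" "\<exists>j\<in>?J. u j \<noteq> 0" "\<And>i. i < N \<Longrightarrow> mat_vec ?J H u i = \<mu> * u i" by auto
  have npos: "0 < l2_norm ?J u"
  proof -
    obtain j where j: "j < N" "u j \<noteq> 0" using u(2) by auto
    have "0 < cmod (u j)" using j by simp
    also have "\<dots> \<le> l2_norm ?J u" unfolding l2_norm_def using j by (intro member_le_L2_set) auto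
    finally show ?thesis .
  qed
  \<comment> \<open>The eigenvalue is real because \<open>H\<close> is Hermitian.\<close>
  have "\<mu> * inner_prod ?J u u = inner_prod ?J (mat_vec ?J H u) u"
    using u(3) by (simp add: inner_prod_def sum_distrib_left mult.assoc)
  also have "\<dots> = inner_prod ?J u (mat_vec ?J H u)" by (rule inner_prod_mat_vec_hermitian) (auto intro: herm)
  also have "\<dots> = cnj \<mu> * inner_prod ?J u u" using u(3) by (simp add: inner_prod_def sum_distrib_left mult_ac)
  finally have "\<mu> = cnj \<mu>" using npos by (simp add: inner_prod_self)
  then have re: "\<mu> = of_real (Re \<mu>)" by (simp add: complex_eq_iff)
  define c where "c = complex_of_real (1 / l2_norm ?J u)"
  define u' where "u' = (\<lambda>j. c * u j)"
  have n1: "inner_prod ?J u' u' = 1"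
  proof -
    have "l2_norm ?J u' = 1" unfolding u'_def l2_norm_scale c_def using npos by (simp add: norm_divide)
    then show ?thesis by (simp add: inner_prod_self)
  qed
  have o1: "inner_prod ?J u' (v k) = 0" if "k < m" for k
    using u(1) that by (simp add: u'_def inner_prod_def mult.assoc flip: sum_distrib_left)
  then have o2: "inner_prod ?J (v k) u' = 0" if "k < m" for k using inner_prod_cnj[of ?J "v k" u'] that by simp
  have e1: "mat_vec ?J H u' i = of_real (Re \<mu>) * u' i" if "i < N" for i
  proof -
    have "mat_vec ?J H u' i = c * mat_vec ?J H u i" by (simp add: u'_def mat_vec_def sum_distrib_left mult_ac)
    then show ?thesis using u(3)[OF that] re by (simp add: u'_def mult_ac)
  qed
  have "inner_prod ?J ((v(m := u')) k) ((v(m := u')) l) = (if k = l then 1 else 0)" if kl: "k < Suc m" "l < Suc m" for k l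
  proof (cases "k = m")
    case True
    then show ?thesis using kl(2) o1[of l] n1 by (cases "l = m") simp_all
  next
    case False
    then show ?thesis using kl on[of k l] o2[of k] by (cases "l = m") simp_all
  qed
  moreover have "mat_vec ?J H ((v(m := u')) k) i = of_real ((\<nu>(m := Re \<mu>)) k) * (v(m := u')) k i"
    if "k < Suc m" "i < N" for k i
    using that ev[of k i] e1[of i] by (cases "k = m") simp_all
  ultimately show ?case
    by (intro exI[of _ "v(m := u')"] exI[of _ "\<nu>(m := Re \<mu>)"]) blast
qed

lemma mat_adjoint_carrier:
  assumes "A \<in> carrier_mat m N" shows "mat_adjoint A \<in> carrier_mat N m"
  apply (rule carrier_matI)
  using carrier_matD[OF assms]
  apply (simp_all only: mat_adjoint_def mat_of_rows_carrier length_map cols_length)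
  done
lemma mat_adjoint_index:
  assumes "A \<in> carrier_mat m N" "i < N" "j < m"
  shows "mat_adjoint A $$ (i, j) = cnj (A $$ (j, i))"
proof -
  note d = carrier_matD[OF assms(1)]
  have "mat_adjoint A $$ (i, j) = map conjugate (cols A) ! i $ j"
   unfolding mat_adjoint_def using d assms(2,3) by (subst mat_of_rows_index) (simp_all only: length_map cols_length)
  then show ?thesis
   using d assms(2,3) by (simp )
qed
lemma mat_mult_index:
  assumes "A \<in> carrier_mat m p" "B \<in> carrier_mat p N" "i < m" "j < N"
  shows "(A * B) $$ (i, j) = (\<Sum>k<p. A $$ (i, k) * B $$ (k, j))"
proof -
  have "(A * B) $$ (i, j) = (\<Sum>k = 0..<p. A $$ (i, k) * B $$ (k, j))"
    using assms by (simp add: scalar_prod_def)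
  then show ?thesis by (simp add: atLeast0LessThan)
qed

text \<open>The characteristic polynomial is included because the singular values of a matrix are defined through
its roots.\<close>

theorem hermitian_spectral:
  fixes A :: "complex Matrix.mat"
  assumes A: "A \<in> carrier_mat N N" and herm: "\<And>i j. i < N \<Longrightarrow> j < N \<Longrightarrow> A $$ (j, i) = cnj (A $$ (i, j))"
  shows "\<exists>v \<nu>. (\<forall>k<N. \<forall>l<N. inner_prod {..<N} (v k) (v l) = (if k = l then 1 else 0)) \<and>
    (\<forall>i<N. \<forall>j<N. (\<Sum>k<N. v k i * cnj (v k j)) = (if i = j then 1 else 0)) \<and>
    (\<forall>k<N. \<forall>i<N. mat_vec {..<N} (\<lambda>i j. A $$ (i, j)) (v k) i = of_real (\<nu> k) * v k i) \<and>
    char_poly A = (\<Prod>a\<leftarrow>map (\<lambda>k. of_real (\<nu> k)) [0..<N]. [:- a, 1:])"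
proof -
  have "\<exists>v \<nu>. (\<forall>k<N. \<forall>l<N. inner_prod {..<N} (v k) (v l) = (if k = l then 1 else 0)) \<and>
    (\<forall>k<N. \<forall>i<N. mat_vec {..<N} (\<lambda>i j. A $$ (i, j)) (v k) i = of_real (\<nu> k) * v k i)"
  proof (rule orthonormal_eigenvectors)
    fix i j assume "i < N" "j < N" then show "A $$ (j, i) = cnj (A $$ (i, j))" by (rule herm)
  qed simp
  then obtain v \<nu> where vn: "\<forall>k<N. \<forall>l<N. inner_prod {..<N} (v k) (v l) = (if k = l then 1 else 0)"
    "\<forall>k<N. \<forall>i<N. mat_vec {..<N} (\<lambda>i j. A $$ (i, j)) (v k) i = of_real (\<nu> k) * v k i"
    by (elim exE conjE)
  have on: "inner_prod {..<N} (v k) (v l) = (if k = l then 1 else 0)" if "k < N" "l < N" for k l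
    using vn(1) that by blast
  have ev: "mat_vec {..<N} (\<lambda>i j. A $$ (i, j)) (v k) i = of_real (\<nu> k) * v k i" if "k < N" "i < N" for k i
    using vn(2) that by blast
  define V where "V = Matrix.mat N N (\<lambda>(j, k). v k j)"
  define U where "U = Matrix.mat N N (\<lambda>(k, j). cnj (v k j))"
  define D where "D = Matrix.mat N N (\<lambda>(i, j). if i = j then complex_of_real (\<nu> i) else 0)"
  have c: "V \<in> carrier_mat N N" "U \<in> carrier_mat N N" "D \<in> carrier_mat N N"
    by (auto simp: V_def U_def D_def)
  have UV: "U * V = 1\<^sub>m N"
  proof (rule eq_matI)
    fix k l assume "k < dim_row (1\<^sub>m N :: complex Matrix.mat)" "l < dim_col (1\<^sub>m N :: complex Matrix.mat)"
    then have kl: "k < N" "l < N" by auto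
    have "(U * V) $$ (k, l) = (\<Sum>j<N. U $$ (k, j) * V $$ (j, l))" by (rule mat_mult_index) (use c kl in auto)
    also have "\<dots> = inner_prod {..<N} (v l) (v k)" using kl by (simp add: U_def V_def inner_prod_def mult.commute)
    finally show "(U * V) $$ (k, l) = 1\<^sub>m N $$ (k, l)" using on[of l k] kl by simp
  qed (use c in auto)
  \<comment> \<open>For square matrices orthonormality of the columns gives orthonormality of the rows, which is completeness.\<close>
  have VU: "V * U = 1\<^sub>m N" by (rule mat_mult_left_right_inverse[OF c(2,1) UV])
  have complete: "(\<Sum>k<N. v k i * cnj (v k j)) = (if i = j then 1 else 0)" if "i < N" "j < N" for i j
  proof -
    have "(V * U) $$ (i, j) = (\<Sum>k<N. V $$ (i, k) * U $$ (k, j))" by (rule mat_mult_index) (use c that in auto)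
    also have "\<dots> = (\<Sum>k<N. v k i * cnj (v k j))" using that by (simp add: U_def V_def)
    finally show ?thesis using that by (simp add: VU)
  qed
  have AV: "A * V = V * D"
  proof (rule eq_matI)
    fix i k assume "i < dim_row (V * D)" "k < dim_col (V * D)"
    then have ik: "i < N" "k < N" using c by auto
    have "(A * V) $$ (i, k) = (\<Sum>j<N. A $$ (i, j) * V $$ (j, k))" by (rule mat_mult_index) (use A c ik in auto)
    also have "\<dots> = of_real (\<nu> k) * v k i" using ik ev[of k i] by (simp add: V_def mat_vec_def)
    also have "\<dots> = (\<Sum>j<N. V $$ (i, j) * D $$ (j, k))"
      using ik by (simp add: V_def D_def if_distrib[of "\<lambda>x. _ * x"] mult.commute cong: if_cong)
    also have "\<dots> = (V * D) $$ (i, k)" by (rule mat_mult_index[symmetric]) (use c ik in auto)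
    finally show "(A * V) $$ (i, k) = (V * D) $$ (i, k)" .
  qed (use A c in auto)
  have "A = A * (V * U)" using A VU by simp
  also have "\<dots> = V * D * U" using A c AV by (metis assoc_mult_mat)
  finally have "similar_mat A D" using A c UV VU by (intro similar_matI[of _ _ V U N]) auto
  then have "char_poly A = char_poly D" by (rule char_poly_similar)
  also have "\<dots> = (\<Prod>a\<leftarrow>diag_mat D. [:- a, 1:])"
    by (rule char_poly_upper_triangular[OF c(3)]) (auto simp: D_def upper_triangular_def)
  also have "diag_mat D = map (\<lambda>k. of_real (\<nu> k)) [0..<N]"
    by (auto simp: diag_mat_def D_def intro!: map_cong)
  finally show ?thesis using on ev complete by (intro exI[of _ v] exI[of _ \<nu>]) auto
qed

section \<open>Singular values of matrices\<close>

text \<open>All \<open>dim_col A\<close> square roots of eigenvalues of \<open>A\<^sup>* A\<close>, including those that \<open>singular_values\<close> cuts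
off when \<open>A\<close> has fewer rows than columns.\<close>

definition sv_list :: "complex Matrix.mat \<Rightarrow> real list" where
  "sv_list A = rev (sorted_list_of_multiset
     (image_mset (\<lambda>z. sqrt (Re z)) (proots (char_poly (mat_adjoint A * A)))))"

lemma sv_list_system:
  assumes A: "A \<in> carrier_mat m N"
  shows "\<exists>v \<sigma>. sv_system {..<m} {..<N} (\<lambda>i j. A $$ (i, j)) {..<N} v \<sigma> \<and>
    mset (sv_list A) = image_mset \<sigma> (mset_set {..<N})"
proof -
  define H where "H = mat_adjoint A * A"
  have Hc: "H \<in> carrier_mat N N" using mat_adjoint_carrier[OF A] A by (auto simp: H_def)
  have Hi: "H $$ (i, j) = (\<Sum>k<m. cnj (A $$ (k, i)) * A $$ (k, j))" if "i < N" "j < N" for i j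
  proof -
    have "H $$ (i, j) = (\<Sum>k<m. mat_adjoint A $$ (i, k) * A $$ (k, j))"
      unfolding H_def using that A mat_adjoint_carrier[OF A] by (intro mat_mult_index) auto
    then show ?thesis using that A by (simp add: mat_adjoint_index)
  qed
  have herm: "H $$ (j, i) = cnj (H $$ (i, j))" if "i < N" "j < N" for i j
    using that by (simp add: Hi mult.commute)
  have "\<exists>v \<nu>. (\<forall>k<N. \<forall>l<N. inner_prod {..<N} (v k) (v l) = (if k = l then 1 else 0)) \<and>
    (\<forall>i<N. \<forall>j<N. (\<Sum>k<N. v k i * cnj (v k j)) = (if i = j then 1 else 0)) \<and>
    (\<forall>k<N. \<forall>i<N. mat_vec {..<N} (\<lambda>i j. H $$ (i, j)) (v k) i = of_real (\<nu> k) * v k i) \<and>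
    char_poly H = (\<Prod>a\<leftarrow>map (\<lambda>k. of_real (\<nu> k)) [0..<N]. [:- a, 1:])"
    by (rule hermitian_spectral[OF Hc]) (rule herm)
  then obtain v \<nu> where
    vn: "\<forall>k<N. \<forall>l<N. inner_prod {..<N} (v k) (v l) = (if k = l then 1 else 0)"
    "\<forall>i<N. \<forall>j<N. (\<Sum>k<N. v k i * cnj (v k j)) = (if i = j then 1 else 0)"
    "\<forall>k<N. \<forall>i<N. mat_vec {..<N} (\<lambda>i j. H $$ (i, j)) (v k) i = of_real (\<nu> k) * v k i"
    and cp: "char_poly H = (\<Prod>a\<leftarrow>map (\<lambda>k. of_real (\<nu> k)) [0..<N]. [:- a, 1:])"
    by (elim exE conjE)
  have on: "inner_prod {..<N} (v k) (v l) = (if k = l then 1 else 0)" if "k < N" "l < N" for k l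
    using vn(1) that by blast
  have complete: "(\<Sum>k<N. v k i * cnj (v k j)) = (if i = j then 1 else 0)" if "i < N" "j < N" for i j
    using vn(2) that by blast
  have ev: "mat_vec {..<N} (\<lambda>i j. H $$ (i, j)) (v k) i = of_real (\<nu> k) * v k i" if "k < N" "i < N" for k i
    using vn(3) that by blast
  let ?A = "\<lambda>i j. A $$ (i, j)"
  have gram: "inner_prod {..<m} (mat_vec {..<N} ?A (v k)) (mat_vec {..<N} ?A (v l)) = (if k = l then of_real (\<nu> k) else 0)"
    if "k < N" "l < N" for k l
  proof -
    have "inner_prod {..<m} (mat_vec {..<N} ?A (v k)) (mat_vec {..<N} ?A (v l))
        = (\<Sum>i<m. \<Sum>a<N. \<Sum>b<N. (?A i b * v k b) * cnj (?A i a * v l a))"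
      by (simp add: inner_prod_def mat_vec_def sum_product) (intro sum.cong refl sum.swap)
    also have "\<dots> = (\<Sum>a<N. \<Sum>i<m. \<Sum>b<N. (?A i b * v k b) * cnj (?A i a * v l a))"
      by (rule sum.swap)
    also have "\<dots> = (\<Sum>a<N. \<Sum>b<N. \<Sum>i<m. (?A i b * v k b) * cnj (?A i a * v l a))"
      by (intro sum.cong refl sum.swap)
    also have "\<dots> = (\<Sum>a<N. (\<Sum>b<N. (\<Sum>i<m. cnj (?A i a) * ?A i b) * v k b) * cnj (v l a))"
      by (simp add: sum_distrib_left sum_distrib_right mult_ac)
    also have "\<dots> = inner_prod {..<N} (mat_vec {..<N} (\<lambda>i j. H $$ (i, j)) (v k)) (v l)"
      unfolding inner_prod_def mat_vec_def by (intro sum.cong refl) (simp add: Hi)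
    also have "\<dots> = (\<Sum>a<N. of_real (\<nu> k) * (v k a * cnj (v l a)))"
      unfolding inner_prod_def using that ev by (intro sum.cong) auto
    also have "\<dots> = of_real (\<nu> k) * inner_prod {..<N} (v k) (v l)" by (simp add: inner_prod_def sum_distrib_left)
    finally show ?thesis using on that by simp
  qed
  have nn: "0 \<le> \<nu> k" if "k < N" for k
  proof -
    have "complex_of_real (\<nu> k) = of_real ((l2_norm {..<m} (mat_vec {..<N} ?A (v k)))\<^sup>2)"
      using gram[OF that that] by (simp add: inner_prod_self)
    then have "\<nu> k = (l2_norm {..<m} (mat_vec {..<N} ?A (v k)))\<^sup>2" by (simp only: of_real_eq_iff)
    then show ?thesis by simp
  qed
  have "sv_system {..<m} {..<N} ?A {..<N} v (\<lambda>k. sqrt (\<nu> k))"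
    using on complete gram nn unfolding sv_system_def inner_prod_def by auto
  moreover have "proots (char_poly H) = mset (map (\<lambda>k. complex_of_real (\<nu> k)) [0..<N])"
  proof -
    have "proots (\<Prod>a\<leftarrow>xs. [:- a, 1:]) = mset xs" for xs :: "complex list"
    proof (induction xs)
      case (Cons a xs)
      have "(\<Prod>a\<leftarrow>xs. [:- a, 1:]) \<noteq> (0 :: complex poly)" by (auto simp: prod_list_zero_iff)
      then show ?case using Cons.IH by (simp add: proots_mult del: mult_pCons_left)
    qed simp
    then show ?thesis by (simp only: cp)
  qed
  then have "mset (sv_list A) = image_mset (\<lambda>k. sqrt (\<nu> k)) (mset_set {..<N})"
    by (simp add: sv_list_def flip: H_def)
       (simp add: image_mset.compositionality comp_def lessThan_atLeast0 flip: mset_upt)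
  ultimately show ?thesis by blast
qed

lemma sv_list_sorted: "sorted (rev (sv_list A))"
  by (simp add: sv_list_def)

lemma length_sv_list:
  assumes "A \<in> carrier_mat m N"
  shows "length (sv_list A) = N"
  using sv_list_system[OF assms] by (metis card_lessThan size_image_mset size_mset size_mset_set)

lemma sv_list_nonneg:
  assumes "A \<in> carrier_mat m N" "x \<in> set (sv_list A)"
  shows "0 \<le> x"
proof -
  obtain v \<sigma> where S: "sv_system {..<m} {..<N} (\<lambda>i j. A $$ (i, j)) {..<N} v \<sigma>"
    and ms: "mset (sv_list A) = image_mset \<sigma> (mset_set {..<N})"
    using sv_list_system[OF assms(1)] by blast
  have "x \<in># image_mset \<sigma> (mset_set {..<N})" using assms(2) ms by (metis set_mset_mset)
  then show ?thesis using S by (auto simp: sv_system_def)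
qed

definition sv_sum :: "(real \<Rightarrow> 'a::comm_monoid_add) \<Rightarrow> complex Matrix.mat \<Rightarrow> 'a" where
  "sv_sum F A = (\<Sum>j<dim_col A. F (sv_list A ! j))"

lemma sv_sum_eq_system:
  fixes F :: "real \<Rightarrow> 'a::comm_monoid_add"
  assumes A: "A \<in> carrier_mat m N" and "mset (sv_list A) = image_mset \<sigma> (mset_set {..<N})"
  shows "sv_sum F A = (\<Sum>k<N. F (\<sigma> k))"
proof -
  have "sv_sum F A = sum_list (map F (sv_list A))"
    using A length_sv_list[OF A] by (simp add: sv_sum_def sum_list_sum_nth lessThan_atLeast0)
  also have "\<dots> = sum_mset (image_mset F (mset (sv_list A)))"
    by (simp add: sum_mset_sum_list flip: mset_map)
  also have "\<dots> = (\<Sum>k<N. F (\<sigma> k))"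
    by (simp add: assms image_mset.compositionality comp_def sum_unfold_sum_mset)
  finally show ?thesis .
qed

text \<open>By \<open>small_rows\<close>, at most \<open>m\<close> of the singular values of a matrix with \<open>m\<close> rows are
positive.\<close>

lemma sv_list_zero_beyond_rows:
  assumes A: "A \<in> carrier_mat m N" and "m \<le> j" "j < N"
  shows "sv_list A ! j = 0"
proof (rule ccontr)
  assume n0: "sv_list A ! j \<noteq> 0"
  obtain v \<sigma> where S: "sv_system {..<m} {..<N} (\<lambda>i j. A $$ (i, j)) {..<N} v \<sigma>"
    and ms: "mset (sv_list A) = image_mset \<sigma> (mset_set {..<N})"
    using sv_list_system[OF A] by blast
  note len = length_sv_list[OF A]
  have pos: "0 < sv_list A ! j"
    using n0 sv_list_nonneg[OF A, of "sv_list A ! j"] assms len by (simp add: less_le)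
  have dec: "sv_list A ! j \<le> sv_list A ! i" if "i \<le> j" for i
    using sv_list_sorted[of A] that assms len by (metis sorted_rev_nth_mono)
  have "{..j} \<subseteq> {i. i < N \<and> 0 < sv_list A ! i}"
    using assms(3) pos dec by (auto intro: less_le_trans)
  then have "card {..j} \<le> card {i. i < N \<and> 0 < sv_list A ! i}" by (intro card_mono) auto
  also have "\<dots> = length (filter (\<lambda>x. 0 < x) (sv_list A))" by (simp add: length_filter_conv_card len)
  also have "\<dots> = size (filter_mset (\<lambda>x. 0 < x) (mset (sv_list A)))" by (metis mset_filter size_mset)
  also have "\<dots> = card {k\<in>{..<N}. 0 < \<sigma> k}"
    by (simp add: ms filter_mset_image_mset filter_mset_mset_set)
  also have "\<dots> \<le> m"
    using small_imp_few_singular_values[OF S, of "real m" 0] small_rows[of "{..<m}" "{..<N}" "\<lambda>i j. A $$ (i, j)"]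
    by simp
  finally show False using assms by simp
qed

text \<open>The entries cut off in \<open>singular_values\<close> are zero, so passing to the full list adds a known multiple of
\<open>F 0\<close>, which contributes equally on both sides of the limit.\<close>

lemma singular_values_sum:
  fixes F :: "real \<Rightarrow> 'a::ring_1"
  assumes A: "A \<in> carrier_mat m N"
  shows "(\<Sum>j<min m N. F (singular_values A ! j)) = sv_sum F A - of_nat (N - min m N) * F 0"
proof -
  have "sv_sum F A = (\<Sum>j<min m N. F (sv_list A ! j)) + (\<Sum>j\<in>{min m N..<N}. F (sv_list A ! j))"
    unfolding sv_sum_def using A by (subst sum.union_disjoint[symmetric]) (auto intro!: sum.cong)
  also have "(\<Sum>j\<in>{min m N..<N}. F (sv_list A ! j)) = (\<Sum>j\<in>{min m N..<N}. F 0)"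
    using sv_list_zero_beyond_rows[OF A] by (intro sum.cong) auto
  also have "(\<Sum>j<min m N. F (sv_list A ! j)) = (\<Sum>j<min m N. F (singular_values A ! j))"
    using A by (intro sum.cong) (auto simp: singular_values_def sv_list_def)
  finally show ?thesis by simp
qed

text \<open>The bijections \<open>e\<close> and \<open>d\<close> let a matrix indexed by numbers be compared with one indexed by pairs (block,
position in the block).\<close>

lemma sv_sum_weyl:
  assumes A: "A \<in> carrier_mat m N" and e: "bij_betw e I {..<m}" and d: "bij_betw d J {..<N}"
    and S: "sv_system I J M K w \<tau>"
    and sm: "small I J (\<lambda>i j. A $$ (e i, d j) - M i j) r t" and "0 \<le> t" and \<psi>: "test_fun L \<psi>"
  shows "\<bar>sv_sum \<psi> A - (\<Sum>k\<in>K. \<psi> (\<tau> k))\<bar> \<le> r + real N * L * t"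
proof -
  obtain v \<sigma> where SA: "sv_system {..<m} {..<N} (\<lambda>i j. A $$ (i, j)) {..<N} v \<sigma>"
    and ms: "mset (sv_list A) = image_mset \<sigma> (mset_set {..<N})"
    using sv_list_system[OF A] by blast
  have mat_vec: "mat_vec J (\<lambda>i j. A $$ (e i, d j)) (\<lambda>j. v k (d j)) i = mat_vec {..<N} (\<lambda>i j. A $$ (i, j)) (v k) (e i)" for k i
    unfolding mat_vec_def by (rule sum.reindex_bij_betw[OF d])
  have "sv_system I J (\<lambda>i j. A $$ (e i, d j)) {..<N} (\<lambda>k j. v k (d j)) \<sigma>"
    unfolding sv_system_def
  proof (intro conjI ballI)
    fix k l assume kl: "k \<in> {..<N}" "l \<in> {..<N}"
    have "(\<Sum>j\<in>J. v k (d j) * cnj (v l (d j))) = (\<Sum>j<N. v k j * cnj (v l j))"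
      by (rule sum.reindex_bij_betw[OF d])
    with SA kl show "(\<Sum>j\<in>J. v k (d j) * cnj (v l (d j))) = (if k = l then 1 else 0)"
      unfolding sv_system_def by simp
    have "(\<Sum>i\<in>I. mat_vec J (\<lambda>i j. A $$ (e i, d j)) (\<lambda>j. v k (d j)) i * cnj (mat_vec J (\<lambda>i j. A $$ (e i, d j)) (\<lambda>j. v l (d j)) i))
      = (\<Sum>i<m. mat_vec {..<N} (\<lambda>i j. A $$ (i, j)) (v k) i * cnj (mat_vec {..<N} (\<lambda>i j. A $$ (i, j)) (v l) i))"
      unfolding mat_vec by (rule sum.reindex_bij_betw[OF e])
    with SA kl show "(\<Sum>i\<in>I. mat_vec J (\<lambda>i j. A $$ (e i, d j)) (\<lambda>j. v k (d j)) i * cnj (mat_vec J (\<lambda>i j. A $$ (e i, d j)) (\<lambda>j. v l (d j)) i))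
      = (if k = l then complex_of_real ((\<sigma> k)\<^sup>2) else 0)"
      unfolding sv_system_def by simp
  next
    fix i j assume ij: "i \<in> J" "j \<in> J"
    then have "d i < N" "d j < N" "d i = d j \<longleftrightarrow> i = j" using d by (auto simp: bij_betw_def inj_on_def)
    then show "(\<Sum>k<N. v k (d i) * cnj (v k (d j))) = (if i = j then 1 else 0)"
      using SA unfolding sv_system_def by simp
  qed (use SA in \<open>auto simp: sv_system_def\<close>)
  moreover have fin: "finite I" "finite J" using e d bij_betw_finite by blast+
  moreover have "card J = N" using d bij_betw_same_card by fastforce
  ultimately have "\<bar>(\<Sum>k<N. \<psi> (\<sigma> k)) - (\<Sum>k\<in>K. \<psi> (\<tau> k))\<bar> \<le> r + real N * L * t"
    using weyl_test_sum[OF _ S _ _ sm _ \<psi>] assms(6) by metis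
  then show ?thesis by (simp add: sv_sum_eq_system[OF A ms])
qed

lemma sv_sum_lipschitz:
  assumes "A \<in> carrier_mat m N" "B \<in> carrier_mat m N" "test_fun L \<psi>"
  shows "\<bar>sv_sum \<psi> A - sv_sum \<psi> B\<bar> \<le> real N * L * (\<Sum>i<m. \<Sum>j<N. cmod (A $$ (i, j) - B $$ (i, j)))"
proof -
  obtain v \<sigma> where SB: "sv_system {..<m} {..<N} (\<lambda>i j. B $$ (i, j)) {..<N} v \<sigma>"
    and ms: "mset (sv_list B) = image_mset \<sigma> (mset_set {..<N})"
    using sv_list_system[OF assms(2)] by blast
  have "\<bar>sv_sum \<psi> A - (\<Sum>k<N. \<psi> (\<sigma> k))\<bar>
      \<le> 0 + real N * L * (\<Sum>i<m. \<Sum>j<N. cmod (A $$ (i, j) - B $$ (i, j)))"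
    by (rule sv_sum_weyl[OF assms(1) _ _ SB _ _ assms(3), of "\<lambda>i. i" "\<lambda>j. j"])
       (auto intro!: small_entries sum_nonneg simp: bij_betw_def)
  then show ?thesis by (simp add: sv_sum_eq_system[OF assms(2) ms])
qed

section \<open>Toeplitz matrices of integrable functions\<close>

abbreviation circle_measure :: "real measure" where
  "circle_measure \<equiv> lebesgue_on {-pi..pi}"

text \<open>Multiplication by \<open>wave (-k)\<close> and integration yields the \<open>k\<close>-th Fourier coefficient, up to the
factor \<open>2 \<pi>\<close>.\<close>

definition wave :: "int \<Rightarrow> real \<Rightarrow> complex" where
  "wave k \<theta> = exp (\<i> * of_int k * of_real \<theta>)"

definition fourier_coeff :: "(real \<Rightarrow> complex) \<Rightarrow> int \<Rightarrow> complex" where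
  "fourier_coeff \<phi> k = 1 / (2 * of_real pi) * (LINT \<theta>|circle_measure. \<phi> \<theta> * wave (- k) \<theta>)"

definition toeplitz :: "(real \<Rightarrow> complex) \<Rightarrow> nat \<Rightarrow> nat \<Rightarrow> complex" where
  "toeplitz \<phi> i k = fourier_coeff \<phi> (int i - int k)"

lemma wave_add: "wave (j + k) \<theta> = wave j \<theta> * wave k \<theta>"
  by (simp add: wave_def distrib_left distrib_right exp_add)

lemma wave_minus: "wave (- k) \<theta> = cnj (wave k \<theta>)"
  by (simp add: wave_def exp_cnj)

lemma norm_wave [simp]: "cmod (wave k \<theta>) = 1"
  by (simp add: wave_def norm_exp_eq_Re)

lemma wave_0 [simp]: "wave 0 \<theta> = 1"
  by (simp add: wave_def)

lemma continuous_on_wave [continuous_intros]: "continuous_on S (wave k)"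
  unfolding wave_def by (intro continuous_intros)

lemma measurable_wave: "wave k \<in> borel_measurable circle_measure"
  by (intro continuous_imp_measurable_on_sets_lebesgue continuous_on_wave) simp

lemma integrable_times_wave:
  assumes "integrable circle_measure \<phi>"
  shows "integrable circle_measure (\<lambda>\<theta>. \<phi> \<theta> * wave k \<theta>)"
proof (rule Bochner_Integration.integrable_bound[OF assms])
  show "(\<lambda>\<theta>. \<phi> \<theta> * wave k \<theta>) \<in> borel_measurable circle_measure"
    using assms measurable_wave by (intro borel_measurable_times) auto
qed (simp add: norm_mult)

lemma fourier_coeff_add:
  assumes "integrable circle_measure \<phi>" "integrable circle_measure \<psi>"
  shows "fourier_coeff (\<lambda>\<theta>. \<phi> \<theta> + \<psi> \<theta>) k = fourier_coeff \<phi> k + fourier_coeff \<psi> k"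
  using assms by (simp add: fourier_coeff_def distrib_right integrable_times_wave add_divide_distrib)

lemma fourier_coeff_scale: "fourier_coeff (\<lambda>\<theta>. c * \<phi> \<theta>) k = c * fourier_coeff \<phi> k"
  by (simp add: fourier_coeff_def mult.assoc)

lemma fourier_coeff_diff:
  assumes "integrable circle_measure \<phi>" "integrable circle_measure \<psi>"
  shows "fourier_coeff (\<lambda>\<theta>. \<phi> \<theta> - \<psi> \<theta>) k = fourier_coeff \<phi> k - fourier_coeff \<psi> k"
  using assms by (simp add: fourier_coeff_def left_diff_distrib integrable_times_wave diff_divide_distrib)

text \<open>The entry \<open>(i, k)\<close> is the integral of \<open>\<phi>\<close> against a product of one wave depending on \<open>i\<close> and one
depending on \<open>k\<close>, so the double sum is the integral of \<open>\<phi>\<close> against a square. In particular a nonnegative \<open>\<phi>\<close> gives a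
positive semidefinite matrix.\<close>

lemma toeplitz_quadratic_form:
  fixes \<phi> :: "real \<Rightarrow> real"
  assumes int: "integrable circle_measure \<phi>"
  shows "inner_prod {..<n} (mat_vec {..<n} (toeplitz (\<lambda>\<theta>. of_real (\<phi> \<theta>))) v) v =
    of_real (1 / (2 * pi) * (LINT \<theta>|circle_measure. \<phi> \<theta> * (cmod (\<Sum>k<n. v k * wave (int k) \<theta>))\<^sup>2))"
proof -
  let ?\<phi> = "\<lambda>\<theta>. complex_of_real (\<phi> \<theta>)"
  have I: "integrable circle_measure ?\<phi>" using int by simp
  have "of_real (LINT \<theta>|circle_measure. \<phi> \<theta> * (cmod (\<Sum>k<n. v k * wave (int k) \<theta>))\<^sup>2)
      = (LINT \<theta>|circle_measure. complex_of_real (\<phi> \<theta> * (cmod (\<Sum>k<n. v k * wave (int k) \<theta>))\<^sup>2))"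
    by (rule integral_complex_of_real[symmetric])
  also have "\<dots> = (LINT \<theta>|circle_measure. (\<Sum>i<n. \<Sum>k<n. (v k * cnj (v i)) * (?\<phi> \<theta> * wave (- (int i - int k)) \<theta>)))"
  proof (rule arg_cong[of _ _ "integral\<^sup>L circle_measure"], rule ext)
    fix \<theta>
    have "complex_of_real ((cmod (\<Sum>k<n. v k * wave (int k) \<theta>))\<^sup>2)
        = (\<Sum>k<n. v k * wave (int k) \<theta>) * (\<Sum>i<n. cnj (v i) * wave (- int i) \<theta>)"
      by (simp only: complex_norm_square cnj_sum complex_cnj_mult wave_minus)
    also have "\<dots> = (\<Sum>i<n. \<Sum>k<n. (v k * cnj (v i)) * wave (int k + (- int i)) \<theta>)"
      unfolding sum_product wave_add by (subst sum.swap) (simp add: mult_ac)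
    finally show "complex_of_real (\<phi> \<theta> * (cmod (\<Sum>k<n. v k * wave (int k) \<theta>))\<^sup>2)
        = (\<Sum>i<n. \<Sum>k<n. (v k * cnj (v i)) * (?\<phi> \<theta> * wave (- (int i - int k)) \<theta>))"
      by (simp only: of_real_mult) (simp add: sum_distrib_left mult_ac)
  qed
  also have "\<dots> = (\<Sum>i<n. \<Sum>k<n. (v k * cnj (v i)) * (LINT \<theta>|circle_measure. ?\<phi> \<theta> * wave (- (int i - int k)) \<theta>))"
    by (subst Bochner_Integration.integral_sum | intro sum.cong refl Bochner_Integration.integrable_sum integrable_mult_right integrable_times_wave I | simp)+
  also have "\<dots> = 2 * of_real pi * inner_prod {..<n} (mat_vec {..<n} (toeplitz ?\<phi>) v) v"
    unfolding inner_prod_def mat_vec_def toeplitz_def fourier_coeff_def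
    by (simp add: sum_distrib_left sum_distrib_right mult_ac)
  finally show ?thesis by simp
qed

lemma fourier_coeff_real_cnj:
  "fourier_coeff (\<lambda>\<theta>. of_real (\<phi> \<theta>)) (- k) = cnj (fourier_coeff (\<lambda>\<theta>. of_real (\<phi> \<theta>)) k)"
  unfolding fourier_coeff_def complex_cnj_mult
  by (subst Bochner_Integration.integral_cnj[symmetric]) (simp add: wave_minus)

text \<open>The eigenvalues are nonnegative and add up to the trace, so at most trace divided by \<open>t\<close> of them
exceed \<open>t\<close>.\<close>

lemma small_positive_semidefinite:
  fixes T :: "nat \<Rightarrow> nat \<Rightarrow> complex"
  assumes herm: "\<And>i j. i < n \<Longrightarrow> j < n \<Longrightarrow> T j i = cnj (T i j)"
    and pos: "\<And>v. 0 \<le> Re (inner_prod {..<n} (mat_vec {..<n} T v) v)" and t: "0 < t"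
  shows "small {..<n} {..<n} T (Re (\<Sum>i<n. T i i) / t) t"
proof -
  define A where "A = Matrix.mat n n (\<lambda>(i, j). T i j)"
  have A: "A \<in> carrier_mat n n" by (simp add: A_def)
  have mvA: "mat_vec {..<n} (\<lambda>i j. A $$ (i, j)) v i = mat_vec {..<n} T v i" if "i < n" for v i
    using that by (simp add: mat_vec_def A_def)
  have "A $$ (j, i) = cnj (A $$ (i, j))" if "i < n" "j < n" for i j
    using herm[OF that] that by (simp add: A_def)
  then have "\<exists>v \<nu>. (\<forall>k<n. \<forall>l<n. inner_prod {..<n} (v k) (v l) = (if k = l then 1 else 0)) \<and>
    (\<forall>i<n. \<forall>j<n. (\<Sum>k<n. v k i * cnj (v k j)) = (if i = j then 1 else 0)) \<and>
    (\<forall>k<n. \<forall>i<n. mat_vec {..<n} (\<lambda>i j. A $$ (i, j)) (v k) i = of_real (\<nu> k) * v k i) \<and>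
    char_poly A = (\<Prod>a\<leftarrow>map (\<lambda>k. of_real (\<nu> k)) [0..<n]. [:- a, 1:])"
    by (rule hermitian_spectral[OF A])
  then obtain v \<nu> where
    on: "\<forall>k<n. \<forall>l<n. inner_prod {..<n} (v k) (v l) = (if k = l then 1 else 0)"
    and complete: "\<forall>i<n. \<forall>j<n. (\<Sum>k<n. v k i * cnj (v k j)) = (if i = j then 1 else 0)"
    and ev': "\<forall>k<n. \<forall>i<n. mat_vec {..<n} (\<lambda>i j. A $$ (i, j)) (v k) i = of_real (\<nu> k) * v k i"
    by (elim exE conjE)
  have ev: "mat_vec {..<n} T (v k) i = of_real (\<nu> k) * v k i" if "k < n" "i < n" for k i
    using ev' that mvA[of i "v k"] by simp
  have ipT: "inner_prod {..<n} (mat_vec {..<n} T (v k)) (v k) = of_real (\<nu> k)" if "k < n" for k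
  proof -
    have "inner_prod {..<n} (mat_vec {..<n} T (v k)) (v k) = (\<Sum>i<n. of_real (\<nu> k) * (v k i * cnj (v k i)))"
      unfolding inner_prod_def using that by (intro sum.cong) (auto simp: ev)
    also have "\<dots> = of_real (\<nu> k) * inner_prod {..<n} (v k) (v k)" by (simp add: inner_prod_def sum_distrib_left)
    finally show ?thesis using on that by simp
  qed
  have nn: "0 \<le> \<nu> k" if "k < n" for k using pos[of "v k"] ipT[OF that] by simp
  have "(\<Sum>k<n. of_real (\<nu> k)) = (\<Sum>k<n. \<Sum>i<n. \<Sum>j<n. T i j * (v k j * cnj (v k i)))"
    by (simp add: ipT[symmetric] inner_prod_def mat_vec_def sum_distrib_right mult.assoc)
  also have "\<dots> = (\<Sum>i<n. \<Sum>k<n. \<Sum>j<n. T i j * (v k j * cnj (v k i)))" by (rule sum.swap)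
  also have "\<dots> = (\<Sum>i<n. \<Sum>j<n. \<Sum>k<n. T i j * (v k j * cnj (v k i)))"
    by (intro sum.cong refl sum.swap)
  also have "\<dots> = (\<Sum>i<n. \<Sum>j<n. if j = i then T i j else 0)"
    using complete by (intro sum.cong refl) (simp flip: sum_distrib_left)
  also have "\<dots> = (\<Sum>i<n. T i i)" by simp
  finally have tr: "(\<Sum>k<n. \<nu> k) = Re (\<Sum>i<n. T i i)"
    by (metis Re_complex_of_real of_real_sum)
  have "sv_system {..<n} {..<n} T {..<n} v \<nu>"
    unfolding sv_system_def
  proof (intro conjI ballI)
    fix k l assume kl: "k \<in> {..<n}" "l \<in> {..<n}"
    have "(\<Sum>i<n. mat_vec {..<n} T (v k) i * cnj (mat_vec {..<n} T (v l) i))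
        = (\<Sum>i<n. of_real (\<nu> k * \<nu> l) * (v k i * cnj (v l i)))"
      using kl by (intro sum.cong) (auto simp: ev)
    also have "\<dots> = of_real (\<nu> k * \<nu> l) * inner_prod {..<n} (v k) (v l)" by (simp add: inner_prod_def sum_distrib_left)
    finally show "(\<Sum>i<n. mat_vec {..<n} T (v k) i * cnj (mat_vec {..<n} T (v l) i))
        = (if k = l then complex_of_real ((\<nu> k)\<^sup>2) else 0)"
      using on kl by (simp add: power2_eq_square)
  qed (use on complete nn in \<open>auto simp: inner_prod_def\<close>)
  then have sm: "small {..<n} {..<n} T (real (card {k\<in>{..<n}. t < \<nu> k})) t"
    using t by (intro few_singular_values_imp_small) auto
  have "real (card {k\<in>{..<n}. t < \<nu> k}) * t = (\<Sum>k\<in>{k\<in>{..<n}. t < \<nu> k}. t)" by simp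
  also have "\<dots> \<le> (\<Sum>k\<in>{k\<in>{..<n}. t < \<nu> k}. \<nu> k)" by (intro sum_mono) auto
  also have "\<dots> \<le> (\<Sum>k<n. \<nu> k)" by (intro sum_mono2) (auto intro: nn)
  finally have "real (card {k\<in>{..<n}. t < \<nu> k}) \<le> Re (\<Sum>i<n. T i i) / t"
    using t tr by (simp add: field_simps)
  with sm show ?thesis by (rule small_mono) simp
qed

lemma small_toeplitz_nonneg:
  fixes \<phi> :: "real \<Rightarrow> real"
  assumes int: "integrable circle_measure \<phi>" and nn: "\<And>\<theta>. 0 \<le> \<phi> \<theta>" and t: "0 < t"
  shows "small {..<n} {..<n} (toeplitz (\<lambda>\<theta>. of_real (\<phi> \<theta>))) (real n * (LINT \<theta>|circle_measure. \<phi> \<theta>) / t) t"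
proof -
  let ?T = "toeplitz (\<lambda>\<theta>. complex_of_real (\<phi> \<theta>))"
  have I0: "0 \<le> (LINT \<theta>|circle_measure. \<phi> \<theta>)" using nn by (intro Bochner_Integration.integral_nonneg) auto
  have "small {..<n} {..<n} ?T (Re (\<Sum>i<n. ?T i i) / t) t"
  proof (rule small_positive_semidefinite)
    fix i j show "?T j i = cnj (?T i j)"
      unfolding toeplitz_def using fourier_coeff_real_cnj[of \<phi> "int i - int j"] by simp
  next
    fix v
    have "0 \<le> (LINT \<theta>|circle_measure. \<phi> \<theta> * (cmod (\<Sum>k<n. v k * wave (int k) \<theta>))\<^sup>2)"
      using nn by (intro Bochner_Integration.integral_nonneg) auto
    then show "0 \<le> Re (inner_prod {..<n} (mat_vec {..<n} ?T v) v)"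
      unfolding toeplitz_quadratic_form[OF int] by simp
  qed (rule t)
  moreover have "Re (\<Sum>i<n. ?T i i) / t \<le> real n * (LINT \<theta>|circle_measure. \<phi> \<theta>) / t"
  proof (rule divide_right_mono)
    have "(LINT \<theta>|circle_measure. \<phi> \<theta>) / (2 * pi) \<le> (LINT \<theta>|circle_measure. \<phi> \<theta>)"
      using I0 pi_gt3 mult_left_mono[OF _ I0, of 1 "2 * pi"] by (simp add: divide_le_eq)
    then have "real n * ((LINT \<theta>|circle_measure. \<phi> \<theta>) / (2 * pi)) \<le> real n * (LINT \<theta>|circle_measure. \<phi> \<theta>)"
      by (rule mult_left_mono) simp
    then show "Re (\<Sum>i<n. ?T i i) \<le> real n * (LINT \<theta>|circle_measure. \<phi> \<theta>)"
      by (simp add: toeplitz_def fourier_coeff_def)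
  qed (use t in simp)
  ultimately show ?thesis by (rule small_mono) simp
qed

text \<open>A complex function is \<open>(\<phi>\<^sub>1 - \<phi>\<^sub>2) + \<i> (\<phi>\<^sub>3 - \<phi>\<^sub>4)\<close> with \<open>\<phi>\<^sub>j \<ge> 0\<close> and \<open>\<phi>\<^sub>j \<le> |\<phi>|\<close>; this is where the
two factors \<open>4\<close> come from.\<close>

lemma small_toeplitz:
  assumes int: "integrable circle_measure \<phi>" and t: "0 < t"
  shows "small {..<n} {..<n} (toeplitz \<phi>) (4 * (real n * (LINT \<theta>|circle_measure. cmod (\<phi> \<theta>)) / t)) (4 * t)"
proof -
  define L where "L = (LINT \<theta>|circle_measure. cmod (\<phi> \<theta>))"
  have piece: "integrable circle_measure (\<lambda>\<theta>. max 0 (u (\<phi> \<theta>)))"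
    "small {..<n} {..<n} (toeplitz (\<lambda>\<theta>. of_real (max 0 (u (\<phi> \<theta>))))) (real n * L / t) t"
    if u: "u \<in> borel_measurable borel" "\<And>z. \<bar>u z\<bar> \<le> cmod z" for u
  proof -
    show I: "integrable circle_measure (\<lambda>\<theta>. max 0 (u (\<phi> \<theta>)))"
    proof (rule Bochner_Integration.integrable_bound[OF int])
      show "(\<lambda>\<theta>. max 0 (u (\<phi> \<theta>))) \<in> borel_measurable circle_measure"
        using int u(1) by (intro borel_measurable_max) (auto intro: measurable_compose)
      show "AE \<theta> in circle_measure. norm (max 0 (u (\<phi> \<theta>))) \<le> norm (\<phi> \<theta>)"
        using u(2) by (intro always_eventually allI) (smt (verit) real_norm_def)
    qed
    have "(LINT \<theta>|circle_measure. max 0 (u (\<phi> \<theta>))) \<le> L"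
      unfolding L_def using I int u(2) by (intro integral_mono) (auto intro: order_trans[OF abs_ge_self])
    then have "real n * (LINT \<theta>|circle_measure. max 0 (u (\<phi> \<theta>))) / t \<le> real n * L / t"
      using t by (intro divide_right_mono mult_left_mono) auto
    then show "small {..<n} {..<n} (toeplitz (\<lambda>\<theta>. of_real (max 0 (u (\<phi> \<theta>))))) (real n * L / t) t"
      by (intro small_mono[OF small_toeplitz_nonneg[OF I _ t, of n]]) auto
  qed
  define P where "P = (\<lambda>u \<theta>. complex_of_real (max 0 (u (\<phi> \<theta>))))"
  have m: "Re \<in> borel_measurable borel" "Im \<in> borel_measurable borel"
    "(\<lambda>z. - Re z) \<in> borel_measurable borel" "(\<lambda>z. - Im z) \<in> borel_measurable borel" by measurable
  have b: "\<bar>Re z\<bar> \<le> cmod z" "\<bar>Im z\<bar> \<le> cmod z" "\<bar>- Re z\<bar> \<le> cmod z" "\<bar>- Im z\<bar> \<le> cmod z" for z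
    by (auto simp: abs_Re_le_cmod abs_Im_le_cmod)
  have I: "integrable circle_measure (P Re)" "integrable circle_measure (P Im)"
    "integrable circle_measure (P (\<lambda>z. - Re z))" "integrable circle_measure (P (\<lambda>z. - Im z))"
    unfolding P_def using piece(1)[OF m(1) b(1)] piece(1)[OF m(2) b(2)] piece(1)[OF m(3) b(3)] piece(1)[OF m(4) b(4)]
    by auto
  have "\<phi> = (\<lambda>\<theta>. (P Re \<theta> - P (\<lambda>z. - Re z) \<theta>) + \<i> * (P Im \<theta> - P (\<lambda>z. - Im z) \<theta>))"
    by (rule ext) (auto simp: P_def complex_eq_iff)
  then have "toeplitz \<phi> i k = (toeplitz (P Re) i k + (-1) * toeplitz (P (\<lambda>z. - Re z)) i k)
     + (\<i> * toeplitz (P Im) i k + (- \<i>) * toeplitz (P (\<lambda>z. - Im z)) i k)" for i k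
  proof -
    have "fourier_coeff (\<lambda>\<theta>. (P Re \<theta> - P (\<lambda>z. - Re z) \<theta>) + \<i> * (P Im \<theta> - P (\<lambda>z. - Im z) \<theta>)) j =
      (fourier_coeff (P Re) j - fourier_coeff (P (\<lambda>z. - Re z)) j) + \<i> * (fourier_coeff (P Im) j - fourier_coeff (P (\<lambda>z. - Im z)) j)" for j
      using I by (subst fourier_coeff_add) (auto simp: fourier_coeff_scale fourier_coeff_diff)
    then show ?thesis unfolding toeplitz_def
      by (subst \<open>\<phi> = _\<close>) (simp add: right_diff_distrib)
  qed
  moreover have "small {..<n} {..<n} (\<lambda>i k. (toeplitz (P Re) i k + (-1) * toeplitz (P (\<lambda>z. - Re z)) i k)
     + (\<i> * toeplitz (P Im) i k + (- \<i>) * toeplitz (P (\<lambda>z. - Im z)) i k))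
     ((real n * L / t + real n * L / t) + (real n * L / t + real n * L / t))
     ((t + cmod (-1) * t) + (cmod \<i> * t + cmod (- \<i>) * t))"
    unfolding P_def by (intro small_add small_scale piece(2) m b)
  ultimately have "small {..<n} {..<n} (toeplitz \<phi>)
     ((real n * L / t + real n * L / t) + (real n * L / t + real n * L / t))
     ((t + cmod (-1) * t) + (cmod \<i> * t + cmod (- \<i>) * t))" by presburger
  then show ?thesis unfolding L_def[symmetric] by (rule small_mono) (simp_all add: mult.commute)
qed

section \<open>Circulants of trigonometric polynomials\<close>

text \<open>The grid starts at \<open>-\<pi>\<close> so that it lies in the interval of integration. The shift multiplies each sum over the
nodes of a wave by a sign, which is harmless because only sums that vanish and the sum of \<open>wave 0\<close> occur.\<close>

definition node :: "nat \<Rightarrow> nat \<Rightarrow> real" where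
  "node n l = - pi + 2 * pi * real l / real n"

lemma wave_node_sum:
  assumes n: "0 < n" and k: "\<not> int n dvd k"
  shows "(\<Sum>l<n. wave k (node n l)) = 0"
proof -
  define z where "z = exp (2 * of_real pi * \<i> * of_int k / of_nat n)"
  have w: "wave k (node n l) = exp (- (\<i> * of_int k * of_real pi)) * z ^ l" for l
    using n by (simp add: wave_def node_def z_def exp_add[symmetric] exp_of_nat_mult[symmetric] field_simps)
  have z1: "z \<noteq> 1"
  proof
    assume "z = 1"
    then obtain m :: int where m: "2 * pi * real_of_int k / real n = of_int (2 * m) * pi"
      unfolding z_def exp_eq_1 by auto
    then have "real_of_int k = real_of_int (int n * m)" using n by (simp add: field_simps)
    then have "k = int n * m" by (simp only: of_int_eq_iff)
    with k show False by simp
  qed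
  have "z ^ n = exp (2 * of_real pi * \<i> * of_int k)"
    using n by (simp add: z_def exp_of_nat_mult[symmetric])
  also have "\<dots> = 1" unfolding exp_eq_1 by (auto simp: mult_ac intro: exI[of _ k])
  finally have zn: "z ^ n = 1" .
  have "(\<Sum>l<n. wave k (node n l)) = exp (- (\<i> * of_int k * of_real pi)) * (\<Sum>l<n. z ^ l)"
    by (simp add: w sum_distrib_left)
  also have "(\<Sum>l<n. z ^ l) = 0" using z1 zn by (simp add: geometric_sum)
  finally show ?thesis by simp
qed

lemma wave_node_orthogonal:
  assumes "i < n" "k < n"
  shows "(\<Sum>l<n. wave (int i - int k) (node n l)) = (if i = k then of_nat n else 0)"
proof (cases "i = k")
  case False
  have "\<not> int n dvd int i - int k"
  proof
    assume "int n dvd int i - int k"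
    then have "int i mod int n = int k mod int n" by (simp add: mod_eq_dvd_iff)
    with assms False show False by simp
  qed
  then show ?thesis using False assms by (simp add: wave_node_sum)
qed simp

text \<open>Orthogonality of the columns of the discrete Fourier transform; \<open>wave_node_orthogonal\<close> is that of
its rows.\<close>

lemma wave_index_orthogonal:
  assumes "l < n" "m < n"
  shows "(\<Sum>k<n. wave (int k) (node n l) * cnj (wave (int k) (node n m))) = (if l = m then of_nat n else 0)"
proof (cases "l = m")
  case True
  then show ?thesis by (simp add: complex_norm_square[symmetric])
next
  case False
  define D where "D = int l - int m"
  have nd: "of_real (node n l) - of_real (node n m) = 2 * of_real pi * of_int D / (of_nat n :: complex)"
    by (simp add: node_def D_def diff_divide_distrib right_diff_distrib)
  have eq: "wave (int k) (node n l) * cnj (wave (int k) (node n m)) = exp (2 * of_real pi * \<i> * of_int D / of_nat n) ^ k" for k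
  proof -
    have "wave (int k) (node n l) * cnj (wave (int k) (node n m)) = exp (\<i> * of_nat k * (of_real (node n l) - of_real (node n m)))"
      by (simp add: wave_minus[symmetric]) (simp add: wave_def exp_add[symmetric] algebra_simps)
    then show ?thesis unfolding nd by (simp add: exp_of_nat_mult[symmetric] mult_ac)
  qed
  define z where "z = exp (2 * of_real pi * \<i> * of_int D / of_nat n)"
  have z1: "z \<noteq> 1"
  proof
    assume "z = 1"
    then obtain j :: int where "2 * pi * real_of_int D / real n = of_int (2 * j) * pi"
      unfolding z_def exp_eq_1 by auto
    then have "real_of_int D = real_of_int (int n * j)" using assms by (simp add: field_simps)
    then have "int l - int m = int n * j" unfolding D_def[symmetric] by (simp only: of_int_eq_iff)
    then have "int l mod int n = int m mod int n" by (simp add: mod_eq_dvd_iff)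
    with assms False show False by simp
  qed
  have "z ^ n = exp (2 * of_real pi * \<i> * of_int D)"
    using assms by (simp add: z_def exp_of_nat_mult[symmetric])
  also have "\<dots> = 1" unfolding exp_eq_1 by (auto simp: algebra_simps intro: exI[of _ D])
  finally have "z ^ n = 1" .
  then have "(\<Sum>k<n. z ^ k) = 0" using z1 by (simp add: geometric_sum)
  then show ?thesis using False by (simp add: eq z_def)
qed

text \<open>The Fourier integral in the entries of the Toeplitz matrix is replaced by its Riemann sum over the nodes. The
vectors \<open>k \<mapsto> wave (-k) (node n l)\<close> are then eigenvectors, with eigenvalues \<open>\<phi> (node n l)\<close>. As the nodes start at
\<open>-\<pi>\<close>, the entries change sign on wrapping around when \<open>n\<close> is odd.\<close>

definition circulant :: "nat \<Rightarrow> (real \<Rightarrow> complex) \<Rightarrow> nat \<Rightarrow> nat \<Rightarrow> complex" where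
  "circulant n \<phi> i k = (\<Sum>l<n. \<phi> (node n l) * wave (- (int i - int k)) (node n l)) / of_nat n"

definition trig_poly :: "nat \<Rightarrow> (int \<Rightarrow> complex) \<Rightarrow> real \<Rightarrow> complex" where
  "trig_poly d c \<theta> = (\<Sum>j\<in>{- int d..int d}. c j * wave j \<theta>)"

lemma continuous_on_trig_poly: "continuous_on S (trig_poly d c)"
  unfolding trig_poly_def by (intro continuous_intros continuous_on_wave)

lemma integrable_continuous_circle:
  fixes f :: "real \<Rightarrow> 'a::euclidean_space"
  assumes "continuous_on {-pi..pi} f"
  shows "integrable circle_measure f"
proof -
  have "set_integrable lebesgue {-pi..pi} f"
    using assms by (intro absolutely_integrable_continuous_real)
  then show ?thesis by (simp add: integrable_restrict_space set_integrable_def)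
qed

lemma integral_circle_eq:
  fixes f :: "real \<Rightarrow> 'a::euclidean_space"
  assumes "integrable circle_measure f"
  shows "(LINT \<theta>|circle_measure. f \<theta>) = integral {-pi..pi} f"
  using assms by (intro lebesgue_integral_eq_integral) auto

lemma integral_wave: "(LINT \<theta>|circle_measure. wave k \<theta>) = (if k = 0 then 2 * of_real pi else 0)"
proof (cases "k = 0")
  case True
  have "(LINT \<theta>|circle_measure. (1 :: complex)) = of_real (measure circle_measure (space circle_measure))"
    by (simp add: scaleR_conv_of_real)
  then show ?thesis using True by (simp add: measure_restrict_space)
next
  case False
  define F where "F = (\<lambda>\<theta>. wave k \<theta> / (\<i> * of_int k))"
  have "(F has_vector_derivative wave k \<theta>) (at \<theta> within {-pi..pi})" for \<theta>
  proof -
    have "((\<lambda>z. exp (\<i> * of_int k * z) / (\<i> * of_int k)) has_field_derivative exp (\<i> * of_int k * of_real \<theta>)) (at (of_real \<theta>))"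
      using False by (auto intro!: derivative_eq_intros)
    then have "((\<lambda>\<theta>. exp (\<i> * of_int k * of_real \<theta>) / (\<i> * of_int k)) has_vector_derivative exp (\<i> * of_int k * of_real \<theta>)) (at \<theta> within {-pi..pi})"
      by (rule has_vector_derivative_real_field)
    then show ?thesis by (simp add: F_def wave_def[abs_def])
  qed
  then have "(wave k has_integral F pi - F (-pi)) {-pi..pi}"
    by (intro fundamental_theorem_of_calculus) auto
  moreover have "wave k pi = wave k (-pi)"
  proof -
    have "exp (2 * of_real pi * \<i> * of_int k) = 1" unfolding exp_eq_1 by (auto simp: mult_ac intro: exI[of _ k])
    moreover have "wave k pi = exp (2 * of_real pi * \<i> * of_int k + \<i> * of_int k * of_real (-pi))"
      by (simp add: wave_def algebra_simps)
    ultimately show ?thesis by (simp only: exp_add wave_def mult_1)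
  qed
  ultimately have "integral {-pi..pi} (wave k) = 0" by (simp add: F_def integral_unique)
  then show ?thesis
    using False by (simp add: integral_circle_eq integrable_continuous_circle continuous_on_wave)
qed

lemma fourier_coeff_trig_poly: "fourier_coeff (trig_poly d c) k = (if \<bar>k\<bar> \<le> int d then c k else 0)"
proof -
  have "(LINT \<theta>|circle_measure. trig_poly d c \<theta> * wave (- k) \<theta>)
      = (LINT \<theta>|circle_measure. (\<Sum>j\<in>{- int d..int d}. c j * wave (j - k) \<theta>))"
    unfolding trig_poly_def sum_distrib_right mult.assoc wave_add[symmetric] by simp
  also have "\<dots> = (\<Sum>j\<in>{- int d..int d}. c j * (LINT \<theta>|circle_measure. wave (j - k) \<theta>))"
    by (subst Bochner_Integration.integral_sum)
       (auto intro!: integrable_mult_right integrable_continuous_circle continuous_on_mult_left continuous_on_wave)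
  also have "\<dots> = (\<Sum>j\<in>{- int d..int d}. if j = k then 2 * of_real pi * c k else 0)"
    by (intro sum.cong) (auto simp: integral_wave)
  also have "\<dots> = (if \<bar>k\<bar> \<le> int d then 2 * of_real pi * c k else 0)" by (auto simp: abs_le_iff)
  finally show ?thesis by (simp add: fourier_coeff_def)
qed

text \<open>Summation over the nodes annihilates \<open>wave m\<close> unless \<open>n\<close> divides \<open>m\<close>. For column indices \<open>k\<close> at distance
at least \<open>d\<close> from both ends, \<open>j - (i - k)\<close> with \<open>|j| \<le> d\<close> is smaller than \<open>n\<close> in absolute value, so only
\<open>j = i - k\<close> survives.\<close>

lemma circulant_trig_poly:
  assumes "i < n" "k < n" "d \<le> k" "k + d < n"
  shows "circulant n (trig_poly d c) i k = toeplitz (trig_poly d c) i k"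
proof -
  define m where "m = int i - int k"
  have "(\<Sum>l<n. trig_poly d c (node n l) * wave (- m) (node n l))
      = (\<Sum>l<n. \<Sum>j\<in>{- int d..int d}. c j * wave (j - m) (node n l))"
    unfolding trig_poly_def sum_distrib_right mult.assoc wave_add[symmetric] by simp
  also have "\<dots> = (\<Sum>j\<in>{- int d..int d}. c j * (\<Sum>l<n. wave (j - m) (node n l)))"
    by (subst sum.swap) (simp add: sum_distrib_left)
  also have "\<dots> = (\<Sum>j\<in>{- int d..int d}. if j = m then of_nat n * c m else 0)"
  proof (intro sum.cong refl)
    fix j assume j: "j \<in> {- int d..int d}"
    show "c j * (\<Sum>l<n. wave (j - m) (node n l)) = (if j = m then of_nat n * c m else 0)"
    proof (cases "j = m")
      case False
      have "\<bar>j - m\<bar> < int n" using j assms unfolding m_def by auto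
      then have "\<not> int n dvd j - m" using False zdvd_imp_le[of "int n" "\<bar>j - m\<bar>"] by auto
      then show ?thesis using False assms by (simp add: wave_node_sum)
    qed simp
  qed
  also have "\<dots> = of_nat n * (if \<bar>m\<bar> \<le> int d then c m else 0)" by (auto simp: abs_le_iff)
  finally show ?thesis
    using assms by (simp add: circulant_def toeplitz_def fourier_coeff_trig_poly flip: m_def)
qed

lemma small_toeplitz_minus_circulant:
  "small {..<n} {..<n} (\<lambda>i k. toeplitz (trig_poly d c) i k - circulant n (trig_poly d c) i k) (2 * real d) 0"
proof -
  define C where "C = {..<d} \<union> {n - d..<n}"
  have "small {..<n} {..<n} (\<lambda>i k. toeplitz (trig_poly d c) i k - circulant n (trig_poly d c) i k) (real (card C)) 0"
    by (rule small_supported_columns) (auto simp: C_def circulant_trig_poly)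
  moreover have "card C \<le> 2 * d"
    unfolding C_def using card_Un_le[of "{..<d}" "{n - d..<n}"] by simp
  ultimately show ?thesis by (elim small_mono) auto
qed

text \<open>\<open>T\<^sub>n(\<phi>)\<close> minus the circulant of \<open>p\<close> is \<open>T\<^sub>n(\<phi> - p)\<close>, small because \<open>\<phi> - p\<close> is small in \<open>L\<^sup>1\<close>,
plus a matrix supported on at most \<open>2 d\<close> columns.\<close>

lemma small_toeplitz_approx:
  assumes int: "integrable circle_measure \<phi>" and t: "0 < t"
    and le: "(LINT \<theta>|circle_measure. cmod (\<phi> \<theta> - trig_poly d c \<theta>)) \<le> \<epsilon>"
  shows "small {..<n} {..<n} (\<lambda>i k. toeplitz \<phi> i k - circulant n (trig_poly d c) i k)
           (4 * (real n * \<epsilon> / t) + 2 * real d) (4 * t)"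
proof -
  have I: "integrable circle_measure (trig_poly d c)"
    by (intro integrable_continuous_circle continuous_on_trig_poly)
  have "small {..<n} {..<n} (toeplitz (\<lambda>\<theta>. \<phi> \<theta> - trig_poly d c \<theta>)) (4 * (real n * \<epsilon> / t)) (4 * t)"
    by (rule small_mono[OF small_toeplitz[OF _ t]])
       (use int I le t in \<open>auto intro!: divide_right_mono mult_left_mono\<close>)
  from small_add[OF this small_toeplitz_minus_circulant[of n d c]]
  show ?thesis unfolding toeplitz_def using int I by (simp add: fourier_coeff_diff)
qed

text \<open>The entry \<open>(p, q)\<close> of the block at \<open>(i, k)\<close> is the entry \<open>(i, k)\<close> of a scalar matrix \<open>M p q\<close>. A block Toeplitz
matrix is thus a family of scalar Toeplitz matrices, one for each entry of its symbol.\<close>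

definition block :: "(nat \<Rightarrow> nat \<Rightarrow> nat \<Rightarrow> nat \<Rightarrow> complex) \<Rightarrow> nat \<times> nat \<Rightarrow> nat \<times> nat \<Rightarrow> complex" where
  "block M = (\<lambda>(i, p) (k, q). M p q i k)"

text \<open>The unit column of the discrete Fourier transform at frequency \<open>l\<close>, tensored with \<open>w\<close>.\<close>

definition plane_wave :: "nat \<Rightarrow> nat \<Rightarrow> (nat \<Rightarrow> complex) \<Rightarrow> nat \<times> nat \<Rightarrow> complex" where
  "plane_wave n l w = (\<lambda>(k, q). cnj (wave (int k) (node n l)) * w q / of_real (sqrt (real n)))"

text \<open>A block circulant multiplies the amplitude of a plane wave of frequency \<open>l\<close> by the value of its symbol at
the \<open>l\<close>-th node. Hence a product of block circulants acts on plane waves through the product of the symbols.\<close>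

lemma block_circulant_plane_wave:
  assumes l: "l < n"
  shows "mat_vec ({..<n} \<times> {..<b}) (block (\<lambda>p q. circulant n (\<lambda>\<theta>. f \<theta> p q))) (plane_wave n l w)
       = plane_wave n l (mat_vec {..<b} (f (node n l)) w)"
proof
  fix x :: "nat \<times> nat"
  obtain i p where x: "x = (i, p)" by (cases x)
  let ?W = "\<lambda>k m. wave (int k) (node n m)"
  let ?s = "complex_of_real (sqrt (real n))"
  have "mat_vec ({..<n} \<times> {..<b}) (block (\<lambda>p q. circulant n (\<lambda>\<theta>. f \<theta> p q))) (plane_wave n l w) x
     = (\<Sum>k<n. \<Sum>q<b. circulant n (\<lambda>\<theta>. f \<theta> p q) i k * (cnj (?W k l) * w q / ?s))"
    by (simp add: mat_vec_def block_def plane_wave_def x sum.cartesian_product case_prod_unfold)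
  also have "\<dots> = (\<Sum>q<b. \<Sum>k<n. circulant n (\<lambda>\<theta>. f \<theta> p q) i k * (cnj (?W k l) * w q / ?s))"
    by (rule sum.swap)
  also have "\<dots> = (\<Sum>q<b. (\<Sum>k<n. circulant n (\<lambda>\<theta>. f \<theta> p q) i k * cnj (?W k l)) * w q / ?s)"
    by (simp add: sum_distrib_right sum_divide_distrib mult.assoc)
  also have "\<dots> = (\<Sum>q<b. f (node n l) p q * cnj (?W i l) * w q / ?s)"
  proof (intro sum.cong refl)
    fix q
    have circ: "circulant n (\<lambda>\<theta>. f \<theta> p q) i k = (\<Sum>m<n. f (node n m) p q * cnj (?W i m) * ?W k m) / of_nat n" for k
      by (simp add: circulant_def wave_add[of "- int i" "int k", simplified] wave_minus mult.assoc)
    have "(\<Sum>k<n. circulant n (\<lambda>\<theta>. f \<theta> p q) i k * cnj (?W k l))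
       = (\<Sum>k<n. \<Sum>m<n. f (node n m) p q * cnj (?W i m) * (?W k m * cnj (?W k l)) / of_nat n)"
      by (simp add: circ sum_distrib_right sum_divide_distrib mult.assoc)
    also have "\<dots> = (\<Sum>m<n. \<Sum>k<n. f (node n m) p q * cnj (?W i m) * (?W k m * cnj (?W k l)) / of_nat n)"
      by (rule sum.swap)
    also have "\<dots> = (\<Sum>m<n. f (node n m) p q * cnj (?W i m) * (\<Sum>k<n. ?W k m * cnj (?W k l)) / of_nat n)"
      by (simp add: sum_distrib_left sum_divide_distrib)
    also have "\<dots> = (\<Sum>m<n. if m = l then f (node n l) p q * cnj (?W i l) else 0)"
      using l by (intro sum.cong) (auto simp: wave_index_orthogonal)
    also have "\<dots> = f (node n l) p q * cnj (?W i l)" using l by simp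
    finally show "(\<Sum>k<n. circulant n (\<lambda>\<theta>. f \<theta> p q) i k * cnj (?W k l)) * w q / ?s
      = f (node n l) p q * cnj (?W i l) * w q / ?s" by simp
  qed
  also have "\<dots> = plane_wave n l (mat_vec {..<b} (f (node n l)) w) x"
    by (simp add: plane_wave_def x mat_vec_def sum_distrib_left sum_divide_distrib mult_ac)
  finally show "mat_vec ({..<n} \<times> {..<b}) (block (\<lambda>p q. circulant n (\<lambda>\<theta>. f \<theta> p q))) (plane_wave n l w) x
     = plane_wave n l (mat_vec {..<b} (f (node n l)) w) x" .
qed

lemma inner_prod_plane_wave:
  assumes "l < n" "m < n"
  shows "inner_prod ({..<n} \<times> {..<b}) (plane_wave n l u) (plane_wave n m w) = (if l = m then inner_prod {..<b} u w else 0)"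
proof -
  let ?W = "\<lambda>k m. wave (int k) (node n m)"
  have s: "complex_of_real (sqrt (real n)) * complex_of_real (sqrt (real n)) = of_nat n"
    by (simp flip: of_real_mult)
  have "inner_prod ({..<n} \<times> {..<b}) (plane_wave n l u) (plane_wave n m w)
     = (\<Sum>k<n. \<Sum>q<b. (?W k m * cnj (?W k l)) * (u q * cnj (w q)) / of_nat n)"
    by (simp add: inner_prod_def plane_wave_def sum.cartesian_product case_prod_unfold s mult_ac)
  also have "\<dots> = (\<Sum>k<n. ?W k m * cnj (?W k l)) * inner_prod {..<b} u w / of_nat n"
    by (simp add: inner_prod_def sum_divide_distrib sum_product)
  finally show ?thesis using assms by (auto simp: wave_index_orthogonal)
qed

text \<open>Singular vectors of the symbol at the \<open>l\<close>-th node are the amplitudes of singular vectors of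
frequency \<open>l\<close>.\<close>

lemma block_circulant_product_system:
  assumes n: "0 < n"
    and S: "\<And>l. l < n \<Longrightarrow> sv_system {..<a} {..<b} (mat_prod {..<c} (f (node n l)) (g (node n l))) {..<b} (v l) (\<sigma> l)"
  shows "sv_system ({..<n} \<times> {..<a}) ({..<n} \<times> {..<b})
    (mat_prod ({..<n} \<times> {..<c}) (block (\<lambda>p q. circulant n (\<lambda>\<theta>. f \<theta> p q))) (block (\<lambda>p q. circulant n (\<lambda>\<theta>. g \<theta> p q))))
    ({..<n} \<times> {..<b}) (\<lambda>(l, r). plane_wave n l (v l r)) (\<lambda>(l, r). \<sigma> l r)"
proof -
  let ?A = "mat_prod ({..<n} \<times> {..<c}) (block (\<lambda>p q. circulant n (\<lambda>\<theta>. f \<theta> p q))) (block (\<lambda>p q. circulant n (\<lambda>\<theta>. g \<theta> p q)))"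
  let ?J = "{..<n} \<times> {..<b}"
  let ?W = "\<lambda>k m. wave (int k) (node n m)"
  have mat_vec: "mat_vec ?J ?A (plane_wave n l w) = plane_wave n l (mat_vec {..<b} (mat_prod {..<c} (f (node n l)) (g (node n l))) w)"
    if "l < n" for l w
    using that by (simp add: mat_vec_mat_prod block_circulant_plane_wave)
  have s: "complex_of_real (sqrt (real n)) * complex_of_real (sqrt (real n)) = of_nat n"
    by (simp flip: of_real_mult)
  show ?thesis
    unfolding sv_system_def
  proof (intro conjI ballI)
    fix x y assume "x \<in> ?J" "y \<in> ?J"
    then obtain l r m t where xy: "x = (l, r)" "y = (m, t)" "l < n" "m < n" "r < b" "t < b" by auto
    have "inner_prod ?J (case x of (l, r) \<Rightarrow> plane_wave n l (v l r)) (case y of (l, r) \<Rightarrow> plane_wave n l (v l r)) = (if x = y then 1 else 0)"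
      using xy S[of l] by (auto simp: inner_prod_plane_wave sv_system_def simp flip: inner_prod_def)
    then show "(\<Sum>z\<in>?J. (case x of (l, r) \<Rightarrow> plane_wave n l (v l r)) z * cnj ((case y of (l, r) \<Rightarrow> plane_wave n l (v l r)) z)) = (if x = y then 1 else 0)"
      by (simp only: inner_prod_def)
    have "inner_prod ({..<n} \<times> {..<a}) (mat_vec ?J ?A (case x of (l, r) \<Rightarrow> plane_wave n l (v l r))) (mat_vec ?J ?A (case y of (l, r) \<Rightarrow> plane_wave n l (v l r)))
        = (if x = y then complex_of_real ((case x of (l, r) \<Rightarrow> \<sigma> l r)\<^sup>2) else 0)"
      using xy S[of l] by (auto simp: mat_vec inner_prod_plane_wave sv_system_def simp flip: inner_prod_def)
    then show "(\<Sum>i\<in>{..<n} \<times> {..<a}. mat_vec ?J ?A (case x of (l, r) \<Rightarrow> plane_wave n l (v l r)) i * cnj (mat_vec ?J ?A (case y of (l, r) \<Rightarrow> plane_wave n l (v l r)) i))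
        = (if x = y then complex_of_real ((case x of (l, r) \<Rightarrow> \<sigma> l r)\<^sup>2) else 0)"
      by (simp only: inner_prod_def)
    have "(\<Sum>z\<in>?J. (case z of (l, r) \<Rightarrow> plane_wave n l (v l r)) x * cnj ((case z of (l, r) \<Rightarrow> plane_wave n l (v l r)) y))
       = (\<Sum>j<n. \<Sum>u<b. plane_wave n j (v j u) x * cnj (plane_wave n j (v j u) y))"
      by (simp add: sum.cartesian_product case_prod_unfold)
    also have "\<dots> = (\<Sum>j<n. \<Sum>u<b. (cnj (?W l j) * ?W m j) * (v j u r * cnj (v j u t)) / of_nat n)"
      by (simp add: plane_wave_def xy s mult_ac)
    also have "\<dots> = (\<Sum>j<n. (cnj (?W l j) * ?W m j) * (\<Sum>u<b. v j u r * cnj (v j u t)) / of_nat n)"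
      by (simp add: sum_distrib_left sum_divide_distrib)
    also have "\<dots> = (\<Sum>j<n. (cnj (?W l j) * ?W m j) * (if r = t then 1 else 0) / of_nat n)"
      using S xy by (intro sum.cong refl) (simp add: sv_system_def)
    also have "\<dots> = (\<Sum>j<n. wave (int m - int l) (node n j)) * (if r = t then 1 else 0) / of_nat n"
      using wave_add[of "int m" "- int l"]
      by (simp add: wave_minus sum_distrib_right sum_divide_distrib mult_ac)
    also have "\<dots> = (if x = y then 1 else 0)" using xy n by (auto simp: wave_node_orthogonal)
    finally show "(\<Sum>z\<in>?J. (case z of (l, r) \<Rightarrow> plane_wave n l (v l r)) x * cnj ((case z of (l, r) \<Rightarrow> plane_wave n l (v l r)) y))
       = (if x = y then 1 else 0)" .
  qed (use S in \<open>auto simp: sv_system_def\<close>)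
qed

section \<open>Density of trigonometric polynomials\<close>

definition is_trig :: "(real \<Rightarrow> complex) \<Rightarrow> bool" where
  "is_trig g \<longleftrightarrow> (\<exists>d c. g = trig_poly d c)"

lemma trig_poly_extend:
  assumes "d \<le> d'"
  shows "trig_poly d c = trig_poly d' (\<lambda>j. if \<bar>j\<bar> \<le> int d then c j else 0)"
  unfolding trig_poly_def using assms
  by (intro ext sum.mono_neutral_cong_left) auto

lemma is_trig_add:
  assumes "is_trig g" "is_trig h"
  shows "is_trig (\<lambda>\<theta>. g \<theta> + h \<theta>)"
proof -
  obtain d c d' c' where "g = trig_poly d c" "h = trig_poly d' c'"
    using assms unfolding is_trig_def by blast
  then obtain b b' where "g = trig_poly (max d d') b" "h = trig_poly (max d d') b'"
    using trig_poly_extend[of d "max d d'" c] trig_poly_extend[of d' "max d d'" c'] by simp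
  then have "(\<lambda>\<theta>. g \<theta> + h \<theta>) = trig_poly (max d d') (\<lambda>j. b j + b' j)"
    by (simp add: trig_poly_def distrib_right sum.distrib fun_eq_iff)
  then show ?thesis unfolding is_trig_def by blast
qed

lemma is_trig_wave: "is_trig (\<lambda>\<theta>. a * wave j \<theta>)"
proof -
  have "(\<Sum>i\<in>{- int (nat \<bar>j\<bar>)..int (nat \<bar>j\<bar>)}. (if i = j then a else 0) * wave i \<theta>) = a * wave j \<theta>" for \<theta>
    by (subst sum.remove[of _ j]) (auto intro!: sum.neutral)
  then have "(\<lambda>\<theta>. a * wave j \<theta>) = trig_poly (nat \<bar>j\<bar>) (\<lambda>i. if i = j then a else 0)"
    by (simp only: trig_poly_def fun_eq_iff) simp
  then show ?thesis unfolding is_trig_def by blast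
qed

lemma is_trig_const: "is_trig (\<lambda>\<theta>. a)"
  using is_trig_wave[of a 0] by simp

lemma is_trig_sum:
  assumes "finite S" "\<And>x. x \<in> S \<Longrightarrow> is_trig (g x)"
  shows "is_trig (\<lambda>\<theta>. \<Sum>x\<in>S. g x \<theta>)"
  using assms by (induction S rule: finite_induct) (auto intro: is_trig_const is_trig_add)

lemma is_trig_mult:
  assumes "is_trig g" "is_trig h"
  shows "is_trig (\<lambda>\<theta>. g \<theta> * h \<theta>)"
proof -
  obtain d c d' c' where gh: "g = trig_poly d c" "h = trig_poly d' c'"
    using assms unfolding is_trig_def by blast
  have "(\<lambda>\<theta>. g \<theta> * h \<theta>) = (\<lambda>\<theta>. \<Sum>j\<in>{- int d..int d}. \<Sum>k\<in>{- int d'..int d'}. (c j * c' k) * wave (j + k) \<theta>)"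
    unfolding gh trig_poly_def sum_product wave_add by (intro ext sum.cong refl) (simp add: mult_ac)
  then show ?thesis by (simp only:) (intro is_trig_sum is_trig_wave finite_atLeastAtMost_int)
qed

text \<open>On the unit circle the coordinates are \<open>cos\<close> and \<open>sin\<close>, which are combinations of \<open>wave 1\<close> and
\<open>wave (-1)\<close>.\<close>

lemma is_trig_real_polynomial:
  fixes p :: "complex \<Rightarrow> real"
  assumes "real_polynomial_function p"
  shows "is_trig (\<lambda>\<theta>. of_real (p (cis \<theta>)))"
  using assms
proof (induction p rule: real_polynomial_function.induct)
  case (linear f)
  have c: "complex_of_real (cos \<theta>) = (1/2) * wave 1 \<theta> + (1/2) * wave (-1) \<theta>" for \<theta>
    by (simp add: wave_def cos_exp_eq flip: cos_of_real)
  have s: "complex_of_real (sin \<theta>) = (- \<i>/2) * wave 1 \<theta> + (\<i>/2) * wave (-1) \<theta>" for \<theta>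
    by (simp add: wave_def sin_exp_eq field_simps flip: sin_of_real)
  have "f (cis \<theta>) = f 1 * cos \<theta> + f \<i> * sin \<theta>" for \<theta>
  proof -
    have "cis \<theta> = cos \<theta> *\<^sub>R 1 + sin \<theta> *\<^sub>R \<i>" by (simp add: complex_eq_iff)
    then have "f (cis \<theta>) = f (cos \<theta> *\<^sub>R 1) + f (sin \<theta> *\<^sub>R \<i>)"
      using linear by (simp only: linear_simps)
    then show ?thesis using linear by (simp add: linear_simps mult.commute)
  qed
  then have "(\<lambda>\<theta>. complex_of_real (f (cis \<theta>))) = (\<lambda>\<theta>. of_real (f 1) * ((1/2) * wave 1 \<theta> + (1/2) * wave (-1) \<theta>)
      + of_real (f \<i>) * ((- \<i>/2) * wave 1 \<theta> + (\<i>/2) * wave (-1) \<theta>))"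
    by (simp only: of_real_add of_real_mult c s)
  then show ?case
    by (simp only:) (intro is_trig_add is_trig_mult is_trig_const is_trig_wave)
next
  case (const c)
  then show ?case by (simp add: is_trig_const)
next
  case (add f g)
  then show ?case by (simp add: is_trig_add)
next
  case (mult f g)
  then show ?case by (simp add: is_trig_mult)
qed

text \<open>Because \<open>h\<close> vanishes near \<open>\<plusminus>\<pi>\<close>, the function \<open>h \<circ> Arg\<close> is continuous on the unit circle in spite of
the jump of \<open>Arg\<close> at \<open>-1\<close>, and the Stone-Weierstrass theorem on the circle applies to it.\<close>

lemma trig_approx_uniform:
  fixes h :: "real \<Rightarrow> real"
  assumes cont: "continuous_on UNIV h" and \<delta>: "0 < \<delta>" "\<delta> < pi"
    and zero: "\<And>\<theta>. pi - \<delta> \<le> \<bar>\<theta>\<bar> \<Longrightarrow> h \<theta> = 0" and e: "0 < e"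
  shows "\<exists>g. is_trig g \<and> (\<forall>\<theta>\<in>{-pi..pi}. cmod (of_real (h \<theta>) - g \<theta>) < e)"
proof -
  define H where "H = (\<lambda>z. h (Arg z))"
  have "continuous_on (sphere 0 1) H"
    unfolding continuous_on_eq_continuous_within
  proof
    fix z :: complex assume z: "z \<in> sphere 0 1"
    show "continuous (at z within sphere 0 1) H"
    proof (cases "z \<in> \<real>\<^sub>\<le>\<^sub>0")
      case False
      have "isCont h (Arg z)" using cont by (simp add: continuous_on_eq_continuous_at)
      then have "isCont H z" unfolding H_def
        by (intro isCont_o2[OF continuous_at_Arg[OF False]])
      then show ?thesis by (rule continuous_at_imp_continuous_at_within)
    next
      case True
      then have "Re z \<le> 0" "Im z = 0" by (auto simp: complex_nonpos_Reals_iff)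
      with z have "Re z = - 1" by (simp add: cmod_def)
      \<comment> \<open>Since \<open>Re w = cos (Arg w)\<close> on the circle, points with \<open>Re w < - cos \<delta>\<close> have an argument in the region where \<open>h\<close> vanishes.\<close>
      have vanish: "H w = 0" if "w \<in> sphere 0 1" "Re w < - cos \<delta>" for w
      proof (rule ccontr)
        assume "H w \<noteq> 0"
        then have "\<bar>Arg w\<bar> < pi - \<delta>" using zero[of "Arg w"] unfolding H_def by (meson not_le)
        then have "cos (pi - \<delta>) < cos \<bar>Arg w\<bar>" using \<delta> by (intro cos_monotone_0_pi) auto
        moreover have "cos (Arg w) = Re w" using that(1) by (cases "w = 0") (auto simp: cos_Arg)
        ultimately show False using that(2) by simp
      qed
      have "cos \<delta> < 1" using \<delta> cos_monotone_0_pi[of 0 \<delta>] by simp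
      then have "eventually (\<lambda>w. Re w < - cos \<delta>) (at z within sphere 0 1)"
        using \<open>Re z = -1\<close>
        by (intro order_tendstoD(2)[where y = "Re z"] tendsto_Re tendsto_ident_at) auto
      then have "eventually (\<lambda>w. 0 = H w) (at z within sphere 0 1)"
        using vanish by (auto simp: eventually_at_filter elim!: eventually_mono)
      then have "(H \<longlongrightarrow> 0) (at z within sphere 0 1)"
        by (rule Lim_transform_eventually[OF tendsto_const])
      moreover have "H z = 0" using vanish[OF z] \<open>Re z = -1\<close> \<open>cos \<delta> < 1\<close> by simp
      ultimately show ?thesis by (simp add: continuous_within)
    qed
  qed
  then obtain p where p: "real_polynomial_function p" "\<And>z. z \<in> sphere 0 1 \<Longrightarrow> \<bar>H z - p z\<bar> < e"
    using Stone_Weierstrass_real_polynomial_function[of "sphere 0 1" H e] e by (metis compact_sphere)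
  have "cmod (of_real (h \<theta>) - of_real (p (cis \<theta>))) < e" if "\<theta> \<in> {-pi..pi}" for \<theta>
  proof -
    have "h \<theta> = H (cis \<theta>)"
    proof (cases "\<theta> = - pi")
      case True
      have "Arg (cis \<theta>) = pi" using True by (intro cis_Arg_unique) (auto simp: sgn_eq complex_eq_iff)
      then show ?thesis using True zero[of \<theta>] zero[of pi] \<delta> unfolding H_def by simp
    next
      case False
      then have "Arg (cis \<theta>) = \<theta>" using that by (intro cis_Arg_unique) (auto simp: sgn_eq)
      then show ?thesis by (simp add: H_def)
    qed
    moreover have "\<bar>H (cis \<theta>) - p (cis \<theta>)\<bar> < e" by (rule p(2)) simp
    ultimately show ?thesis by (simp flip: of_real_diff)
  qed
  then show ?thesis using is_trig_real_polynomial[OF p(1)] by blast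
qed

lemma is_trig_integrable: "is_trig g \<Longrightarrow> integrable circle_measure g"
  unfolding is_trig_def by (auto intro: integrable_continuous_circle continuous_on_trig_poly)

lemma finite_measure_circle: "finite_measure circle_measure"
  by (rule finite_measureI) (simp add: emeasure_restrict_space)

lemma measure_circle: "measure circle_measure (space circle_measure) = 2 * pi"
  by (simp add: measure_restrict_space)

lemma AE_circle_negligible:
  assumes "negligible N"
  shows "AE x in circle_measure. x \<notin> N"
proof -
  have "AE x in lebesgue. x \<notin> N" using assms by (intro AE_not_in) (simp add: negligible_iff_null_sets)
  then have "AE x in lebesgue. x \<in> {-pi..pi} \<longrightarrow> x \<notin> N" by eventually_elim auto
  then show ?thesis by (subst AE_restrict_space_iff) auto
qed

text \<open>The function is first clipped to \<open>[-M, M]\<close>; continuous functions \<open>G n\<close> that converge to it almost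
everywhere are clipped as well and multiplied by a cutoff that vanishes near \<open>\<plusminus>\<pi>\<close>. Both steps are small in
\<open>L\<^sup>1\<close> by dominated convergence, and what remains is approximated uniformly.\<close>

lemma trig_dense_real:
  fixes \<phi> :: "real \<Rightarrow> real"
  assumes int: "integrable circle_measure \<phi>" and e: "0 < e"
  shows "\<exists>g. is_trig g \<and> (LINT \<theta>|circle_measure. cmod (of_real (\<phi> \<theta>) - g \<theta>)) < e"
proof -
  interpret finite_measure circle_measure by (rule finite_measure_circle)
  define clip where "clip = (\<lambda>M x :: real. max (- M) (min M x))"
  have clip_meas: "(\<lambda>\<theta>. clip M (u \<theta>)) \<in> borel_measurable circle_measure"
    if "u \<in> borel_measurable circle_measure" for M u
    unfolding clip_def using that by measurable
  have \<phi>m: "\<phi> \<in> borel_measurable circle_measure" using int by auto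
  have "(\<lambda>n. LINT \<theta>|circle_measure. \<bar>\<phi> \<theta> - clip (real n) (\<phi> \<theta>)\<bar>) \<longlonglongrightarrow> (LINT \<theta>|circle_measure. (0::real))"
  proof (rule integral_dominated_convergence[where w = "\<lambda>\<theta>. \<bar>\<phi> \<theta>\<bar>"])
    have "(\<lambda>n. \<bar>\<phi> \<theta> - clip (real n) (\<phi> \<theta>)\<bar>) \<longlonglongrightarrow> 0" for \<theta>
    proof (rule tendsto_eventually)
      obtain n0 where "\<bar>\<phi> \<theta>\<bar> \<le> real n0" using real_arch_simple by blast
      then show "\<forall>\<^sub>F n in sequentially. \<bar>\<phi> \<theta> - clip (real n) (\<phi> \<theta>)\<bar> = 0"
        by (intro eventually_sequentiallyI[of n0]) (auto simp: clip_def)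
    qed
    then show "AE \<theta> in circle_measure. (\<lambda>n. \<bar>\<phi> \<theta> - clip (real n) (\<phi> \<theta>)\<bar>) \<longlonglongrightarrow> 0" by simp
    show "AE \<theta> in circle_measure. norm \<bar>\<phi> \<theta> - clip (real n) (\<phi> \<theta>)\<bar> \<le> \<bar>\<phi> \<theta>\<bar>" for n
      by (auto simp: clip_def)
  qed (use int \<phi>m clip_meas in auto)
  then have "eventually (\<lambda>n. (LINT \<theta>|circle_measure. \<bar>\<phi> \<theta> - clip (real n) (\<phi> \<theta>)\<bar>) < e / 3) sequentially"
    using e by (intro order_tendstoD(2)) auto
  then obtain M where M: "(LINT \<theta>|circle_measure. \<bar>\<phi> \<theta> - clip (real M) (\<phi> \<theta>)\<bar>) < e / 3"
    by (auto simp: eventually_sequentially)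
  have "\<phi> measurable_on {-pi..pi}" using \<phi>m by (subst measurable_on_iff_borel_measurable) auto
  then obtain N G where N: "negligible N" and G: "\<And>n::nat. continuous_on UNIV (G n)"
    and lim: "\<And>x. x \<notin> N \<Longrightarrow> (\<lambda>n. G n x) \<longlonglongrightarrow> (if x \<in> {-pi..pi} then \<phi> x else 0)"
    unfolding measurable_on_def by blast
  \<comment> \<open>It vanishes within distance \<open>1 / n\<close> of \<open>\<plusminus>\<pi>\<close> and equals \<open>1\<close> beyond distance \<open>2 / n\<close>.\<close>
  define cutoff where "cutoff = (\<lambda>(n::nat) \<theta>. max 0 (min 1 (real n * (pi - \<bar>\<theta>\<bar>) - 1)))"
  define h where "h = (\<lambda>n \<theta>. clip (real M) (G n \<theta>) * cutoff n \<theta>)"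
  have hc: "continuous_on UNIV (h n)" for n
    unfolding h_def cutoff_def clip_def by (intro continuous_intros G)
  have hm: "h n \<in> borel_measurable circle_measure" for n
    by (intro continuous_imp_measurable_on_sets_lebesgue continuous_on_subset[OF hc]) auto
  have hb: "\<bar>h n \<theta>\<bar> \<le> real M" for n \<theta>
  proof -
    have "\<bar>clip (real M) (G n \<theta>)\<bar> \<le> real M" by (auto simp: clip_def)
    moreover have "0 \<le> cutoff n \<theta>" "cutoff n \<theta> \<le> 1" by (auto simp: cutoff_def)
    ultimately show ?thesis unfolding h_def abs_mult
      by (metis abs_ge_zero abs_of_nonneg mult_left_le order_trans)
  qed
  have "(\<lambda>n. LINT \<theta>|circle_measure. \<bar>clip (real M) (\<phi> \<theta>) - h n \<theta>\<bar>) \<longlonglongrightarrow> (LINT \<theta>|circle_measure. (0::real))"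
  proof (rule integral_dominated_convergence[where w = "\<lambda>\<theta>. 2 * real M"])
    have "AE \<theta> in circle_measure. \<theta> \<notin> N \<union> {-pi, pi}"
      using N by (intro AE_circle_negligible negligible_Un) auto
    moreover have "AE \<theta> in circle_measure. \<theta> \<in> {-pi..pi}"
      using AE_space[of circle_measure] by simp
    ultimately show "AE \<theta> in circle_measure. (\<lambda>n. \<bar>clip (real M) (\<phi> \<theta>) - h n \<theta>\<bar>) \<longlonglongrightarrow> 0"
    proof eventually_elim
      case (elim \<theta>)
      then have th: "\<bar>\<theta>\<bar> < pi" by (auto simp: abs_less_iff)
      have G': "(\<lambda>n. G n \<theta>) \<longlonglongrightarrow> \<phi> \<theta>" using lim[of \<theta>] elim by simp
      have "eventually (\<lambda>n. 2 / (pi - \<bar>\<theta>\<bar>) \<le> real n) sequentially"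
        using filterlim_real_sequentially by (simp add: filterlim_at_top)
      then have "eventually (\<lambda>n. cutoff n \<theta> = 1) sequentially"
        by eventually_elim (use th in \<open>auto simp: cutoff_def field_simps\<close>)
      then have "(\<lambda>n. cutoff n \<theta>) \<longlonglongrightarrow> 1" by (rule tendsto_eventually)
      then have "(\<lambda>n. h n \<theta>) \<longlonglongrightarrow> clip (real M) (\<phi> \<theta>) * 1"
        unfolding h_def clip_def by (intro tendsto_intros G')
      then have "(\<lambda>n. \<bar>clip (real M) (\<phi> \<theta>) - h n \<theta>\<bar>) \<longlonglongrightarrow> \<bar>clip (real M) (\<phi> \<theta>) - clip (real M) (\<phi> \<theta>) * 1\<bar>"
        by (intro tendsto_intros)
      then show ?case by simp
    qed
    show "AE \<theta> in circle_measure. norm \<bar>clip (real M) (\<phi> \<theta>) - h n \<theta>\<bar> \<le> 2 * real M" for n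
    proof (intro AE_I2)
      fix \<theta>
      have "\<bar>clip (real M) (\<phi> \<theta>)\<bar> \<le> real M" by (auto simp: clip_def)
      then show "norm \<bar>clip (real M) (\<phi> \<theta>) - h n \<theta>\<bar> \<le> 2 * real M" using hb[of n \<theta>] by simp
    qed
  qed (use \<phi>m clip_meas hm in auto)
  then have "eventually (\<lambda>n. (LINT \<theta>|circle_measure. \<bar>clip (real M) (\<phi> \<theta>) - h n \<theta>\<bar>) < e / 3) sequentially"
    using e by (intro order_tendstoD(2)) auto
  moreover have "eventually (\<lambda>n. 1 \<le> n) sequentially" by (rule eventually_ge_at_top)
  ultimately have "eventually (\<lambda>n. 1 \<le> n \<and> (LINT \<theta>|circle_measure. \<bar>clip (real M) (\<phi> \<theta>) - h n \<theta>\<bar>) < e / 3) sequentially"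
    by eventually_elim auto
  then obtain n where n: "1 \<le> n" "(LINT \<theta>|circle_measure. \<bar>clip (real M) (\<phi> \<theta>) - h n \<theta>\<bar>) < e / 3"
    by (auto simp: eventually_sequentially)
  have hz: "h n \<theta> = 0" if "pi - 1 / real n \<le> \<bar>\<theta>\<bar>" for \<theta>
  proof -
    have "real n * (pi - \<bar>\<theta>\<bar>) \<le> 1" using that n by (simp add: field_simps)
    then show ?thesis by (simp add: h_def cutoff_def)
  qed
  have "1 / real n < pi" using n pi_gt3 by (smt (verit) divide_le_eq_1 of_nat_1 of_nat_mono)
  \<comment> \<open>The interval has length \<open>2 \<pi> < 8\<close>, so a uniform error \<open>e / 24\<close> contributes less than \<open>e / 3\<close>.\<close>
  then obtain g where g: "is_trig g" "\<And>\<theta>. \<theta> \<in> {-pi..pi} \<Longrightarrow> cmod (of_real (h n \<theta>) - g \<theta>) < e / 24"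
    using trig_approx_uniform[OF hc _ _ hz, of "1 / real n" "e / 24"] n e by auto
  have gm: "g \<in> borel_measurable circle_measure" using is_trig_integrable[OF g(1)] by auto
  have i1: "integrable circle_measure (\<lambda>\<theta>. \<bar>\<phi> \<theta> - clip (real M) (\<phi> \<theta>)\<bar>)"
    by (rule Bochner_Integration.integrable_bound[OF int]) (use \<phi>m clip_meas in \<open>auto simp: clip_def\<close>)
  have ic: "integrable circle_measure (\<lambda>\<theta>. clip (real M) (\<phi> \<theta>))"
    by (rule Bochner_Integration.integrable_bound[OF int]) (use \<phi>m clip_meas in \<open>auto simp: clip_def\<close>)
  have ih: "integrable circle_measure (h n)"
    by (rule integrable_continuous_circle[OF continuous_on_subset[OF hc]]) simp
  have "(LINT \<theta>|circle_measure. cmod (of_real (\<phi> \<theta>) - g \<theta>))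
      \<le> (LINT \<theta>|circle_measure. \<bar>\<phi> \<theta> - clip (real M) (\<phi> \<theta>)\<bar> + \<bar>clip (real M) (\<phi> \<theta>) - h n \<theta>\<bar> + e / 24)"
  proof (rule integral_mono)
    show "integrable circle_measure (\<lambda>\<theta>. cmod (of_real (\<phi> \<theta>) - g \<theta>))"
      using int is_trig_integrable[OF g(1)] by auto
    show "integrable circle_measure (\<lambda>\<theta>. \<bar>\<phi> \<theta> - clip (real M) (\<phi> \<theta>)\<bar> + \<bar>clip (real M) (\<phi> \<theta>) - h n \<theta>\<bar> + e / 24)"
      using i1 ic ih by auto
    fix \<theta> assume "\<theta> \<in> space circle_measure"
    then have "cmod (of_real (h n \<theta>) - g \<theta>) < e / 24" using g(2) by simp
    moreover have "cmod (of_real (\<phi> \<theta>) - g \<theta>) \<le> cmod (of_real (\<phi> \<theta>) - of_real (h n \<theta>)) + cmod (of_real (h n \<theta>) - g \<theta>)"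
      using norm_triangle_ineq[of "of_real (\<phi> \<theta>) - of_real (h n \<theta>)" "of_real (h n \<theta>) - g \<theta>"] by simp
    moreover have "cmod (of_real (\<phi> \<theta>) - of_real (h n \<theta>)) = \<bar>\<phi> \<theta> - h n \<theta>\<bar>"
      by (simp flip: of_real_diff)
    ultimately show "cmod (of_real (\<phi> \<theta>) - g \<theta>) \<le> \<bar>\<phi> \<theta> - clip (real M) (\<phi> \<theta>)\<bar> + \<bar>clip (real M) (\<phi> \<theta>) - h n \<theta>\<bar> + e / 24"
      by linarith
  qed
  also have "\<dots> = (LINT \<theta>|circle_measure. \<bar>\<phi> \<theta> - clip (real M) (\<phi> \<theta>)\<bar>) + (LINT \<theta>|circle_measure. \<bar>clip (real M) (\<phi> \<theta>) - h n \<theta>\<bar>) + 2 * pi * (e / 24)"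
    using i1 ic ih measure_circle by simp
  also have "\<dots> < e / 3 + e / 3 + e / 3"
    using M n(2) pi_less_4 e by (intro add_strict_mono) (auto simp: field_simps)
  finally show ?thesis using g(1) by auto
qed

theorem trig_poly_dense:
  assumes int: "integrable circle_measure \<phi>" and e: "0 < e"
  shows "\<exists>d c. (LINT \<theta>|circle_measure. cmod (\<phi> \<theta> - trig_poly d c \<theta>)) < e"
proof -
  have iR: "integrable circle_measure (\<lambda>\<theta>. Re (\<phi> \<theta>))" and iI: "integrable circle_measure (\<lambda>\<theta>. Im (\<phi> \<theta>))"
    using int by auto
  obtain g where g: "is_trig g" "(LINT \<theta>|circle_measure. cmod (of_real (Re (\<phi> \<theta>)) - g \<theta>)) < e / 2"
    using trig_dense_real[OF iR, of "e / 2"] e by auto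
  obtain h where h: "is_trig h" "(LINT \<theta>|circle_measure. cmod (of_real (Im (\<phi> \<theta>)) - h \<theta>)) < e / 2"
    using trig_dense_real[OF iI, of "e / 2"] e by auto
  have ig: "integrable circle_measure g" "integrable circle_measure h"
    using g h by (auto intro: is_trig_integrable)
  have "is_trig (\<lambda>\<theta>. g \<theta> + \<i> * h \<theta>)" by (intro is_trig_add is_trig_mult is_trig_const g h)
  then obtain d c where dc: "(\<lambda>\<theta>. g \<theta> + \<i> * h \<theta>) = trig_poly d c" unfolding is_trig_def by blast
  have "(LINT \<theta>|circle_measure. cmod (\<phi> \<theta> - (g \<theta> + \<i> * h \<theta>)))
      \<le> (LINT \<theta>|circle_measure. cmod (of_real (Re (\<phi> \<theta>)) - g \<theta>) + cmod (of_real (Im (\<phi> \<theta>)) - h \<theta>))"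
  proof (rule integral_mono)
    fix \<theta>
    have eq: "\<phi> \<theta> - (g \<theta> + \<i> * h \<theta>) = (of_real (Re (\<phi> \<theta>)) - g \<theta>) + \<i> * (of_real (Im (\<phi> \<theta>)) - h \<theta>)"
      by (subst complex_eq[of "\<phi> \<theta>"]) (simp add: algebra_simps)
    show "cmod (\<phi> \<theta> - (g \<theta> + \<i> * h \<theta>)) \<le> cmod (of_real (Re (\<phi> \<theta>)) - g \<theta>) + cmod (of_real (Im (\<phi> \<theta>)) - h \<theta>)"
      unfolding eq by (rule order_trans[OF norm_triangle_ineq]) (simp add: norm_mult)
  qed (use int ig iR iI in auto)
  also have "\<dots> = (LINT \<theta>|circle_measure. cmod (of_real (Re (\<phi> \<theta>)) - g \<theta>)) + (LINT \<theta>|circle_measure. cmod (of_real (Im (\<phi> \<theta>)) - h \<theta>))"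
    using ig iR iI by (intro Bochner_Integration.integral_add) auto
  also have "\<dots> < e" using g h by simp
  finally show ?thesis using dc by (metis (no_types, lifting) ext)
qed

section \<open>Riemann sums\<close>

lemma riemann_sum_tendsto:
  fixes h :: "real \<Rightarrow> real"
  assumes cont: "continuous_on {-pi..pi} h"
  shows "(\<lambda>n. (\<Sum>l<n. h (node n l)) / real n) \<longlonglongrightarrow> (LINT \<theta>|circle_measure. h \<theta>) / (2 * pi)"
proof (rule LIMSEQ_I)
  fix e :: real assume e: "0 < e"
  have "uniformly_continuous_on {-pi..pi} h" using cont by (simp add: compact_uniformly_continuous)
  then obtain \<delta> where \<delta>: "0 < \<delta>"
    "\<And>x y. x \<in> {-pi..pi} \<Longrightarrow> y \<in> {-pi..pi} \<Longrightarrow> dist y x < \<delta> \<Longrightarrow> dist (h y) (h x) < e / 2"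
    using e unfolding uniformly_continuous_on_def by (metis half_gt_zero)
  obtain n0 where n0: "2 * pi / \<delta> < real n0" using reals_Archimedean2 by blast
  show "\<exists>no. \<forall>n\<ge>no. norm ((\<Sum>l<n. h (node n l)) / real n - (LINT \<theta>|circle_measure. h \<theta>) / (2 * pi)) < e"
  proof (intro exI allI impI)
    fix n assume n: "Suc n0 \<le> n"
    then have npos: "0 < n" by simp
    have step: "node n (Suc l) = node n l + 2 * pi / real n" for l
      by (simp add: node_def add_divide_distrib distrib_left)
    have "2 * pi / \<delta> < real n" using n n0 by simp
    then have small: "2 * pi / real n < \<delta>" using \<delta>(1) npos by (simp add: field_simps)
    have range: "-pi \<le> node n l" "node n l \<le> pi" if "l \<le> n" for l
    proof -
      have "real l / real n \<le> 1" using that npos by simp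
      then have "2 * pi * (real l / real n) \<le> 2 * pi * 1" by (intro mult_left_mono) auto
      then show "node n l \<le> pi" by (simp add: node_def)
      show "-pi \<le> node n l" by (simp add: node_def)
    qed
    have hi: "h integrable_on {x..y}" if "-pi \<le> x" "y \<le> pi" for x y
      using that by (intro integrable_continuous_interval continuous_on_subset[OF cont]) auto
    have sum: "integral {-pi..node n m} h = (\<Sum>l<m. integral {node n l..node n (Suc l)} h)" if "m \<le> n" for m
      using that
    proof (induction m)
      case 0
      then show ?case by (simp add: node_def)
    next
      case (Suc m)
      have le: "node n m \<le> node n (Suc m)" using npos by (simp add: step)
      have "integral {-pi..node n (Suc m)} h = integral {-pi..node n m} h + integral {node n m..node n (Suc m)} h"
        using Suc.prems le range[of m] range[of "Suc m"]
        by (intro Henstock_Kurzweil_Integration.integral_combine[symmetric] hi) auto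
      then show ?case using Suc by simp
    qed
    have "node n n = pi" using npos by (simp add: node_def)
    then have total: "(LINT \<theta>|circle_measure. h \<theta>) = (\<Sum>l<n. integral {node n l..node n (Suc l)} h)"
      using sum[of n] by (simp add: integral_circle_eq integrable_continuous_circle cont)
    have piece: "\<bar>integral {node n l..node n (Suc l)} h - 2 * pi / real n * h (node n l)\<bar> \<le> e / 2 * (2 * pi / real n)"
      if l: "l < n" for l
    proof -
      have le: "node n l \<le> node n (Suc l)" using npos by (simp add: step)
      have r: "-pi \<le> node n l" "node n (Suc l) \<le> pi" using range[of l] range[of "Suc l"] l by auto
      have "norm (integral {node n l..node n (Suc l)} (\<lambda>\<theta>. h \<theta> - h (node n l))) \<le> e / 2 * (node n (Suc l) - node n l)"
      proof (rule integral_bound[OF le])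
        show "continuous_on {node n l..node n (Suc l)} (\<lambda>\<theta>. h \<theta> - h (node n l))"
          using r by (intro continuous_intros continuous_on_subset[OF cont]) auto
        fix \<theta> assume "\<theta> \<in> {node n l..node n (Suc l)}"
        then show "norm (h \<theta> - h (node n l)) \<le> e / 2"
          using \<delta>(2)[of "node n l" \<theta>] r small le by (auto simp: dist_real_def step intro!: less_imp_le)
      qed
      moreover have "integral {node n l..node n (Suc l)} (\<lambda>\<theta>. h \<theta> - h (node n l))
          = integral {node n l..node n (Suc l)} h - 2 * pi / real n * h (node n l)"
        using r le by (subst Henstock_Kurzweil_Integration.integral_diff) (auto intro: hi simp: step)
      ultimately show ?thesis by (simp add: step)
    qed
    have "\<bar>(\<Sum>l<n. h (node n l)) / real n - (LINT \<theta>|circle_measure. h \<theta>) / (2 * pi)\<bar>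
        = \<bar>\<Sum>l<n. integral {node n l..node n (Suc l)} h - 2 * pi / real n * h (node n l)\<bar> / (2 * pi)"
    proof -
      have "(\<Sum>l<n. h (node n l)) / real n - (LINT \<theta>|circle_measure. h \<theta>) / (2 * pi)
        = - (\<Sum>l<n. integral {node n l..node n (Suc l)} h - 2 * pi / real n * h (node n l)) / (2 * pi)"
        unfolding total sum_subtractf sum_distrib_left[symmetric] by (simp add: field_simps)
      then show ?thesis by (simp only: abs_divide abs_minus_cancel) simp
    qed
    also have "\<dots> \<le> (\<Sum>l<n. e / 2 * (2 * pi / real n)) / (2 * pi)"
      by (intro divide_right_mono order_trans[OF sum_abs] sum_mono piece) auto
    also have "\<dots> < e" using npos e by simp
    finally show "norm ((\<Sum>l<n. h (node n l)) / real n - (LINT \<theta>|circle_measure. h \<theta>) / (2 * pi)) < e" by simp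
  qed
qed

section \<open>Products of block Toeplitz matrices\<close>

lemma pair_index_less:
  fixes a n :: nat
  assumes "i < n" "p < a" shows "a * i + p < a * n"
proof -
  have "a * i + p < a * Suc i" using assms by simp
  also have "\<dots> \<le> a * n" using assms by (intro mult_left_mono) auto
  finally show ?thesis .
qed

lemma pair_index_bij:
  fixes a n :: nat
  assumes "0 < a"
  shows "bij_betw (\<lambda>(i, p). a * i + p) ({..<n} \<times> {..<a}) {..<a * n}"
proof (rule bij_betwI[where g = "\<lambda>x. (x div a, x mod a)"])
  show "(\<lambda>(i, p). a * i + p) \<in> {..<n} \<times> {..<a} \<rightarrow> {..<a * n}"
    using pair_index_less by auto
  show "(\<lambda>x. (x div a, x mod a)) \<in> {..<a * n} \<rightarrow> {..<n} \<times> {..<a}"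
    using assms by (auto simp: less_mult_imp_div_less mult.commute)
  fix x assume "x \<in> {..<n} \<times> {..<a}"
  then show "((case x of (i, p) \<Rightarrow> a * i + p) div a, (case x of (i, p) \<Rightarrow> a * i + p) mod a) = x"
    by auto
qed simp

lemma fourier_coeff_eq: "fourier_coeff \<phi> k = 1 / (2 * of_real pi) * (LINT \<theta>|circle_measure. \<phi> \<theta> * exp (- (\<i> * of_int k * of_real \<theta>)))"
  by (simp add: fourier_coeff_def wave_def)

lemma block_toeplitz_entry:
  assumes "i < n" "p < a" "k < n" "q < b"
  shows "block_toeplitz a b n \<phi> $$ (a * i + p, b * k + q) = toeplitz (\<lambda>\<theta>. \<phi> \<theta> $$ (p, q)) i k"
  using assms pair_index_less[of i n p a] pair_index_less[of k n q b]
  by (simp add: block_toeplitz_def fourier_coeff_mat_def toeplitz_def fourier_coeff_eq)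

lemma block_toeplitz_carrier: "block_toeplitz a b n \<phi> \<in> carrier_mat (a * n) (b * n)"
  by (simp add: block_toeplitz_def)

abbreviation toeplitz_blocks :: "(real \<Rightarrow> nat \<Rightarrow> nat \<Rightarrow> complex) \<Rightarrow> nat \<times> nat \<Rightarrow> nat \<times> nat \<Rightarrow> complex" where
  "toeplitz_blocks f \<equiv> block (\<lambda>p q. toeplitz (\<lambda>\<theta>. f \<theta> p q))"

abbreviation circulant_blocks :: "nat \<Rightarrow> (real \<Rightarrow> nat \<Rightarrow> nat \<Rightarrow> complex) \<Rightarrow> nat \<times> nat \<Rightarrow> nat \<times> nat \<Rightarrow> complex" where
  "circulant_blocks n f \<equiv> block (\<lambda>p q. circulant n (\<lambda>\<theta>. f \<theta> p q))"

lemma block_toeplitz_product_entry: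
  assumes c: "0 < c" and ipkq: "i < n" "p < a" "k < n" "q < b"
  shows "(block_toeplitz a c n f * block_toeplitz c b n g) $$ (a * i + p, b * k + q) =
    mat_prod ({..<n} \<times> {..<c}) (toeplitz_blocks (\<lambda>\<theta> p q. f \<theta> $$ (p, q))) (toeplitz_blocks (\<lambda>\<theta> p q. g \<theta> $$ (p, q))) (i, p) (k, q)"
proof -
  let ?F = "block_toeplitz a c n f" and ?G = "block_toeplitz c b n g"
  have "(?F * ?G) $$ (a * i + p, b * k + q) = (\<Sum>x<c * n. ?F $$ (a * i + p, x) * ?G $$ (x, b * k + q))"
    by (rule mat_mult_index[OF block_toeplitz_carrier block_toeplitz_carrier]) (simp_all add: ipkq pair_index_less)
  also have "\<dots> = (\<Sum>z\<in>{..<n} \<times> {..<c}. ?F $$ (a * i + p, (\<lambda>(j, r). c * j + r) z) * ?G $$ ((\<lambda>(j, r). c * j + r) z, b * k + q))"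
    by (rule sum.reindex_bij_betw[OF pair_index_bij[OF c], symmetric])
  also have "\<dots> = mat_prod ({..<n} \<times> {..<c}) (toeplitz_blocks (\<lambda>\<theta> p q. f \<theta> $$ (p, q))) (toeplitz_blocks (\<lambda>\<theta> p q. g \<theta> $$ (p, q))) (i, p) (k, q)"
    unfolding mat_prod_def by (intro sum.cong refl) (auto simp: block_toeplitz_entry ipkq block_def)
  finally show ?thesis .
qed

text \<open>From \<open>F G - F' G' = (F - F') G + F (G - G') - (F - F') (G - G')\<close>. Only the unprimed factors occur undifferenced, and
their bounds do not depend on the quality of the approximation; the bounds of \<open>F'\<close> and \<open>G'\<close> would.\<close>

lemma small_product_difference:
  assumes "small I K F r1 t1" "small K J G r2 t2"
    and "small I K (\<lambda>i k. F i k - F' i k) r3 t3" "small K J (\<lambda>k j. G k j - G' k j) r4 t4"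
    and "0 \<le> t1" "0 \<le> t3" and fin: "finite J" "finite K"
  shows "small I J (\<lambda>i j. mat_prod K F G i j - mat_prod K F' G' i j)
    ((r3 + r2) + (r1 + r4) + (r3 + r4)) (t3 * t2 + t1 * t4 + t3 * t4)"
proof -
  let ?D = "\<lambda>i k. F i k - F' i k" and ?E = "\<lambda>k j. G k j - G' k j"
  have "small I J (\<lambda>i j. mat_prod K ?D G i j + mat_prod K F ?E i j + - mat_prod K ?D ?E i j)
    ((r3 + r2) + (r1 + r4) + (r3 + r4)) (t3 * t2 + t1 * t4 + t3 * t4)"
    using assms by (intro small_add small_uminus small_mat_prod)
  moreover have "mat_prod K ?D G i j + mat_prod K F ?E i j + - mat_prod K ?D ?E i j = mat_prod K F G i j - mat_prod K F' G' i j" for i j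
    unfolding mat_prod_def sum.distrib[symmetric] sum_negf[symmetric] sum_subtractf[symmetric]
    by (intro sum.cong refl) (simp add: algebra_simps)
  ultimately show ?thesis by simp
qed

lemma sv_system_cong:
  assumes "\<And>i j. i \<in> I \<Longrightarrow> j \<in> J \<Longrightarrow> A i j = B i j" "sv_system I J A K v \<sigma>"
  shows "sv_system I J B K v \<sigma>"
proof -
  have "mat_vec J A (v k) i = mat_vec J B (v k) i" if "i \<in> I" for k i
    unfolding mat_vec_def using assms(1) that by (intro sum.cong) auto
  then have "(\<Sum>i\<in>I. mat_vec J A (v k) i * cnj (mat_vec J A (v l) i)) = (\<Sum>i\<in>I. mat_vec J B (v k) i * cnj (mat_vec J B (v l) i))" for k l
    by (intro sum.cong) auto
  with assms(2) show ?thesis unfolding sv_system_def by simp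
qed

text \<open>Working with this matrix rather than with the product of two given matrices makes its dimensions hold
at every point.\<close>

definition symbol_product :: "nat \<Rightarrow> nat \<Rightarrow> nat \<Rightarrow> (real \<Rightarrow> nat \<Rightarrow> nat \<Rightarrow> complex) \<Rightarrow> (real \<Rightarrow> nat \<Rightarrow> nat \<Rightarrow> complex) \<Rightarrow> real \<Rightarrow> complex Matrix.mat" where
  "symbol_product a b c f g \<theta> = Matrix.mat a b (\<lambda>(i, j). mat_prod {..<c} (f \<theta>) (g \<theta>) i j)"

lemma symbol_product_carrier: "symbol_product a b c f g \<theta> \<in> carrier_mat a b"
  by (simp add: symbol_product_def)

text \<open>The sum for the block circulants splits into one sum for each node, because each node contributes the
singular values of the product of the symbols there.\<close>

lemma sv_sum_near_circulants:
  assumes n: "0 < n" and ab: "0 < a" "0 < b" and A: "A \<in> carrier_mat (a * n) (b * n)"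
    and entry: "\<And>i p k q. i < n \<Longrightarrow> p < a \<Longrightarrow> k < n \<Longrightarrow> q < b \<Longrightarrow> A $$ (a * i + p, b * k + q) = M (i, p) (k, q)"
    and sm: "small ({..<n} \<times> {..<a}) ({..<n} \<times> {..<b})
      (\<lambda>x y. M x y - mat_prod ({..<n} \<times> {..<c}) (circulant_blocks n f) (circulant_blocks n g) x y) r t"
    and t: "0 \<le> t" and \<psi>: "test_fun L \<psi>"
  shows "\<bar>sv_sum \<psi> A - (\<Sum>l<n. sv_sum \<psi> (symbol_product a b c f g (node n l)))\<bar> \<le> r + real (b * n) * L * t"
proof -
  have "\<exists>v \<sigma>. sv_system {..<a} {..<b} (mat_prod {..<c} (f (node n l)) (g (node n l))) {..<b} v \<sigma> \<and>
      sv_sum \<psi> (symbol_product a b c f g (node n l)) = (\<Sum>k<b. \<psi> (\<sigma> k))" for l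
  proof -
    obtain v \<sigma> where S: "sv_system {..<a} {..<b} (\<lambda>i j. symbol_product a b c f g (node n l) $$ (i, j)) {..<b} v \<sigma>"
      and ms: "mset (sv_list (symbol_product a b c f g (node n l))) = image_mset \<sigma> (mset_set {..<b})"
      using sv_list_system[OF symbol_product_carrier] by blast
    have "sv_system {..<a} {..<b} (mat_prod {..<c} (f (node n l)) (g (node n l))) {..<b} v \<sigma>"
      by (rule sv_system_cong[OF _ S]) (simp add: symbol_product_def)
    then show ?thesis using sv_sum_eq_system[OF symbol_product_carrier ms] by blast
  qed
  then obtain v \<sigma> where S: "\<And>l. sv_system {..<a} {..<b} (mat_prod {..<c} (f (node n l)) (g (node n l))) {..<b} (v l) (\<sigma> l)"
    and sums: "\<And>l. sv_sum \<psi> (symbol_product a b c f g (node n l)) = (\<Sum>k<b. \<psi> (\<sigma> l k))" by metis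
  have "\<bar>sv_sum \<psi> A - (\<Sum>x\<in>{..<n} \<times> {..<b}. \<psi> ((\<lambda>(l, r). \<sigma> l r) x))\<bar> \<le> r + real (b * n) * L * t"
  proof (rule sv_sum_weyl[OF A pair_index_bij[OF ab(1)] pair_index_bij[OF ab(2)] _ _ t \<psi>])
    show "sv_system ({..<n} \<times> {..<a}) ({..<n} \<times> {..<b})
      (mat_prod ({..<n} \<times> {..<c}) (circulant_blocks n f) (circulant_blocks n g))
      ({..<n} \<times> {..<b}) (\<lambda>(l, r). plane_wave n l (v l r)) (\<lambda>(l, r). \<sigma> l r)"
      by (rule block_circulant_product_system[OF n]) (rule S)
    show "small ({..<n} \<times> {..<a}) ({..<n} \<times> {..<b})
      (\<lambda>i j. A $$ ((case i of (i, p) \<Rightarrow> a * i + p), (case j of (i, p) \<Rightarrow> b * i + p)) -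
        mat_prod ({..<n} \<times> {..<c}) (circulant_blocks n f) (circulant_blocks n g) i j) r t"
      by (rule small_cong[OF _ sm]) (auto simp: entry)
  qed
  also have "(\<Sum>x\<in>{..<n} \<times> {..<b}. \<psi> ((\<lambda>(l, r). \<sigma> l r) x)) = (\<Sum>l<n. sv_sum \<psi> (symbol_product a b c f g (node n l)))"
    by (simp add: sums sum.cartesian_product case_prod_unfold)
  finally show ?thesis .
qed

lemma sv_sum_bounds:
  assumes A: "A \<in> carrier_mat m N" and \<psi>: "test_fun L \<psi>"
  shows "0 \<le> sv_sum \<psi> A" "sv_sum \<psi> A \<le> real N"
proof -
  have b: "0 \<le> \<psi> (sv_list A ! j) \<and> \<psi> (sv_list A ! j) \<le> 1" if "j < N" for j
    using \<psi> sv_list_nonneg[OF A, of "sv_list A ! j"] length_sv_list[OF A] that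
    by (simp add: test_fun_def)
  show "0 \<le> sv_sum \<psi> A" unfolding sv_sum_def using b A by (intro sum_nonneg) auto
  have "sv_sum \<psi> A \<le> (\<Sum>j<N. 1)" unfolding sv_sum_def carrier_matD(2)[OF A] using b by (intro sum_mono) auto
  then show "sv_sum \<psi> A \<le> real N" by simp
qed

text \<open>By Weyl's inequality the sum is a Lipschitz function of the entries.\<close>

lemma sv_sum_tendsto:
  assumes A: "\<And>x. A x \<in> carrier_mat m N" "B \<in> carrier_mat m N" and \<psi>: "test_fun L \<psi>"
    and lim: "\<And>i j. i < m \<Longrightarrow> j < N \<Longrightarrow> ((\<lambda>x. A x $$ (i, j)) \<longlongrightarrow> B $$ (i, j)) F"
  shows "((\<lambda>x. sv_sum \<psi> (A x)) \<longlongrightarrow> sv_sum \<psi> B) F"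
proof -
  have "((\<lambda>x. sv_sum \<psi> (A x) - sv_sum \<psi> B) \<longlongrightarrow> 0) F"
  proof (rule Lim_null_comparison)
    show "\<forall>\<^sub>F x in F. norm (sv_sum \<psi> (A x) - sv_sum \<psi> B)
        \<le> real N * L * (\<Sum>i<m. \<Sum>j<N. cmod (A x $$ (i, j) - B $$ (i, j)))"
      using sv_sum_lipschitz[OF A \<psi>] by (intro always_eventually allI) simp
    have "((\<lambda>x. real N * L * (\<Sum>i<m. \<Sum>j<N. cmod (A x $$ (i, j) - B $$ (i, j))))
        \<longlongrightarrow> real N * L * (\<Sum>i<m. \<Sum>j<N. cmod (B $$ (i, j) - B $$ (i, j)))) F"
      by (intro tendsto_intros lim) auto
    then show "((\<lambda>x. real N * L * (\<Sum>i<m. \<Sum>j<N. cmod (A x $$ (i, j) - B $$ (i, j)))) \<longlongrightarrow> 0) F" by simp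
  qed
  then show ?thesis by (simp add: LIM_zero_iff)
qed

lemma symbol_product_tendsto:
  assumes "\<And>p q. p < a \<Longrightarrow> q < c \<Longrightarrow> ((\<lambda>x. f x p q) \<longlongrightarrow> f0 p q) F"
    and "\<And>p q. p < c \<Longrightarrow> q < b \<Longrightarrow> ((\<lambda>x. g x p q) \<longlongrightarrow> g0 p q) F" and "test_fun L \<psi>"
  shows "((\<lambda>x. sv_sum \<psi> (symbol_product a b c (\<lambda>_. f x) (\<lambda>_. g x) \<theta>)) \<longlongrightarrow>
    sv_sum \<psi> (symbol_product a b c (\<lambda>_. f0) (\<lambda>_. g0) \<theta>)) F"
proof (rule sv_sum_tendsto[OF symbol_product_carrier symbol_product_carrier assms(3)])
  fix i j assume ij: "i < a" "j < b"
  have "((\<lambda>x. \<Sum>k<c. f x i k * g x k j) \<longlongrightarrow> (\<Sum>k<c. f0 i k * g0 k j)) F"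
    using ij by (intro tendsto_intros assms) auto
  then show "((\<lambda>x. symbol_product a b c (\<lambda>_. f x) (\<lambda>_. g x) \<theta> $$ (i, j)) \<longlongrightarrow>
      symbol_product a b c (\<lambda>_. f0) (\<lambda>_. g0) \<theta> $$ (i, j)) F"
    using ij by (simp add: symbol_product_def mat_prod_def)
qed

lemma symbol_product_const: "symbol_product a b c f g \<theta> = symbol_product a b c (\<lambda>_. f \<theta>) (\<lambda>_. g \<theta>) 0"
  by (simp add: symbol_product_def)

section \<open>The limit for monotone Lipschitz test functions\<close>

lemma le_double_sum:
  fixes F :: "nat \<Rightarrow> nat \<Rightarrow> 'a::{semiring_1, ordered_comm_monoid_add}"
  assumes "\<And>p q. 0 \<le> F p q" "p < a" "q < c"
  shows "F p q \<le> (\<Sum>p<a. \<Sum>q<c. F p q)"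
proof -
  have "F p q \<le> (\<Sum>q<c. F p q)" using assms by (intro member_le_sum[of q _ "F p"]) auto
  also have "\<dots> \<le> (\<Sum>p<a. \<Sum>q<c. F p q)"
    using assms by (intro member_le_sum[of p _ "\<lambda>p. \<Sum>q<c. F p q"]) (auto intro: sum_nonneg)
  finally show ?thesis .
qed

lemma integral_double_sum:
  fixes F :: "nat \<Rightarrow> nat \<Rightarrow> 'b \<Rightarrow> real"
  assumes "\<And>p q. p < a \<Longrightarrow> q < c \<Longrightarrow> integrable M (F p q)"
  shows "integrable M (\<lambda>x. \<Sum>p<a. \<Sum>q<c. F p q x)"
    "(LINT x|M. (\<Sum>p<a. \<Sum>q<c. F p q x)) = (\<Sum>p<a. \<Sum>q<c. LINT x|M. F p q x)"
proof -
  have row: "integrable M (\<lambda>x. \<Sum>q<c. F p q x)" if "p < a" for p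
    using assms that by (intro Bochner_Integration.integrable_sum) auto
  then show "integrable M (\<lambda>x. \<Sum>p<a. \<Sum>q<c. F p q x)"
    by (rule Bochner_Integration.integrable_sum) auto
  have "(LINT x|M. (\<Sum>p<a. \<Sum>q<c. F p q x)) = (\<Sum>p<a. LINT x|M. (\<Sum>q<c. F p q x))"
    using row by (intro Bochner_Integration.integral_sum) auto
  also have "\<dots> = (\<Sum>p<a. \<Sum>q<c. LINT x|M. F p q x)"
    using assms by (intro sum.cong refl Bochner_Integration.integral_sum) auto
  finally show "(LINT x|M. (\<Sum>p<a. \<Sum>q<c. F p q x)) = (\<Sum>p<a. \<Sum>q<c. LINT x|M. F p q x)" .
qed

text \<open>The degree can be raised at will, which allows one common degree for all entries of both factors.\<close>

lemma trig_poly_dense_entries: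
  fixes f :: "real \<Rightarrow> nat \<Rightarrow> nat \<Rightarrow> complex"
  assumes f: "\<And>p q. p < a \<Longrightarrow> q < c \<Longrightarrow> integrable circle_measure (\<lambda>\<theta>. f \<theta> p q)" and \<epsilon>: "0 < \<epsilon>"
  shows "\<exists>d. \<forall>d'\<ge>d. \<exists>e. \<forall>p<a. \<forall>q<c. (LINT \<theta>|circle_measure. cmod (f \<theta> p q - trig_poly d' (e p q) \<theta>)) < \<epsilon>"
proof -
  define err where "err = (\<lambda>p q d e. LINT \<theta>|circle_measure. cmod (f \<theta> p q - trig_poly d e \<theta>))"
  have "\<exists>d e. p < a \<longrightarrow> q < c \<longrightarrow> err p q d e < \<epsilon>" for p q
    using trig_poly_dense[OF f \<epsilon>, of p q] unfolding err_def by blast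
  then obtain D E where DE: "\<And>p q. p < a \<Longrightarrow> q < c \<Longrightarrow> err p q (D p q) (E p q) < \<epsilon>" by metis
  show ?thesis
  proof (intro exI allI impI)
    fix d' p q assume d': "(\<Sum>p<a. \<Sum>q<c. D p q) \<le> d'" and pq: "p < a" "q < c"
    have "D p q \<le> d'" using le_double_sum[of D p a q c] pq d' by simp
    then show "(LINT \<theta>|circle_measure. cmod (f \<theta> p q - trig_poly d' ((\<lambda>p q j. if \<bar>j\<bar> \<le> int (D p q) then E p q j else 0) p q) \<theta>)) < \<epsilon>"
      using DE[OF pq] unfolding err_def by (simp add: trig_poly_extend[symmetric])
  qed
qed

text \<open>Two thresholds balance each other. Outside relative codimension \<open>O(\<delta>)\<close> the factors are
bounded by \<open>O(1 / \<delta>)\<close>. An \<open>L\<^sup>1\<close> error \<open>\<delta>\<^sup>4\<close> makes the differences to the circulants \<open>O(\<delta>\<^sup>2)\<close> outside relative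
codimension \<open>O(\<delta>\<^sup>2)\<close>, so that their products with the factors are still \<open>O(\<delta>)\<close>. The term with \<open>d\<close> is the fixed number
of columns in which Toeplitz matrix and circulant of a polynomial of degree \<open>d\<close> differ.\<close>

lemma small_toeplitz_minus_circulant_product:
  fixes f g :: "real \<Rightarrow> nat \<Rightarrow> nat \<Rightarrow> complex"
  assumes f: "\<And>p q. p < a \<Longrightarrow> q < c \<Longrightarrow> integrable circle_measure (\<lambda>\<theta>. f \<theta> p q)"
    and g: "\<And>p q. p < c \<Longrightarrow> q < b \<Longrightarrow> integrable circle_measure (\<lambda>\<theta>. g \<theta> p q)"
    and fK: "\<And>p q. p < a \<Longrightarrow> q < c \<Longrightarrow> (LINT \<theta>|circle_measure. cmod (f \<theta> p q)) \<le> K"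
    and gK: "\<And>p q. p < c \<Longrightarrow> q < b \<Longrightarrow> (LINT \<theta>|circle_measure. cmod (g \<theta> p q)) \<le> K"
    and \<delta>: "0 < \<delta>" "\<delta> \<le> 1" and K0: "0 \<le> K"
    and df: "\<And>p q. p < a \<Longrightarrow> q < c \<Longrightarrow> (LINT \<theta>|circle_measure. cmod (f \<theta> p q - trig_poly d (e p q) \<theta>)) \<le> \<delta> ^ 4"
    and dg: "\<And>p q. p < c \<Longrightarrow> q < b \<Longrightarrow> (LINT \<theta>|circle_measure. cmod (g \<theta> p q - trig_poly d (e' p q) \<theta>)) \<le> \<delta> ^ 4"
  defines "\<alpha> \<equiv> real (a * c)" and "\<beta> \<equiv> real (c * b)"
  shows "small ({..<n} \<times> {..<a}) ({..<n} \<times> {..<b})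
      (\<lambda>x y. mat_prod ({..<n} \<times> {..<c}) (toeplitz_blocks f) (toeplitz_blocks g) x y
        - mat_prod ({..<n} \<times> {..<c}) (circulant_blocks n (\<lambda>\<theta> p q. trig_poly d (e p q) \<theta>))
            (circulant_blocks n (\<lambda>\<theta> p q. trig_poly d (e' p q) \<theta>)) x y)
      ((\<alpha> + \<beta>) * (8 + 4 * K) * (real n * \<delta> + real d)) (48 * \<alpha> * \<beta> * \<delta>)"
proof -
  have ab0: "0 \<le> \<alpha>" "0 \<le> \<beta>" by (auto simp: \<alpha>_def \<beta>_def)
  have d2: "0 < \<delta>\<^sup>2" "0 < 1 / \<delta>" using \<delta> by auto
  have scalar: "small {..<n} {..<n} (toeplitz \<phi>) (4 * (real n * K / (1 / \<delta>))) (4 * (1 / \<delta>))"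
    if "integrable circle_measure \<phi>" "(LINT \<theta>|circle_measure. cmod (\<phi> \<theta>)) \<le> K" for \<phi>
  proof (rule small_mono[OF small_toeplitz[OF that(1) d2(2)] _ order_refl])
    have "real n * (LINT \<theta>|circle_measure. cmod (\<phi> \<theta>)) \<le> real n * K" using that(2) by (rule mult_left_mono) simp
    then show "4 * (real n * (LINT \<theta>|circle_measure. cmod (\<phi> \<theta>)) / (1 / \<delta>)) \<le> 4 * (real n * K / (1 / \<delta>))"
      using \<delta> by (simp only: divide_divide_eq_right div_by_1 mult_1_right) (simp add: mult_right_mono)
  qed
  have F: "small ({..<n} \<times> {..<a}) ({..<n} \<times> {..<c}) (toeplitz_blocks f)
      (\<alpha> * (4 * (real n * K / (1 / \<delta>)))) (\<alpha> * (4 * (1 / \<delta>)))"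
    unfolding block_def \<alpha>_def using \<delta> by (intro small_blocks scalar f fK) auto
  have G: "small ({..<n} \<times> {..<c}) ({..<n} \<times> {..<b}) (toeplitz_blocks g)
      (\<beta> * (4 * (real n * K / (1 / \<delta>)))) (\<beta> * (4 * (1 / \<delta>)))"
    unfolding block_def \<beta>_def using \<delta> by (intro small_blocks scalar g gK) auto
  have DF: "small ({..<n} \<times> {..<a}) ({..<n} \<times> {..<c})
      (block (\<lambda>p q i k. toeplitz (\<lambda>\<theta>. f \<theta> p q) i k - circulant n (trig_poly d (e p q)) i k))
      (\<alpha> * (4 * (real n * \<delta> ^ 4 / \<delta>\<^sup>2) + 2 * real d)) (\<alpha> * (4 * \<delta>\<^sup>2))"
    unfolding block_def \<alpha>_def by (intro small_blocks small_toeplitz_approx f df d2) auto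
  have DG: "small ({..<n} \<times> {..<c}) ({..<n} \<times> {..<b})
      (block (\<lambda>p q i k. toeplitz (\<lambda>\<theta>. g \<theta> p q) i k - circulant n (trig_poly d (e' p q)) i k))
      (\<beta> * (4 * (real n * \<delta> ^ 4 / \<delta>\<^sup>2) + 2 * real d)) (\<beta> * (4 * \<delta>\<^sup>2))"
    unfolding block_def \<beta>_def by (intro small_blocks small_toeplitz_approx g dg d2) auto
  have split: "block (\<lambda>p q i k. M p q i k - M' p q i k) = (\<lambda>x y. block M x y - block M' x y)" for M M'
    by (auto simp: block_def fun_eq_iff)
  \<comment> \<open>The threshold \<open>\<delta>\<^sup>2\<close> turns an error \<open>\<delta>\<^sup>4\<close> into the relative codimension \<open>\<delta>\<^sup>2\<close>.\<close>
  have sq: "\<delta> ^ 4 / \<delta>\<^sup>2 = \<delta>\<^sup>2" using \<delta> by (simp add: power2_eq_square power4_eq_xxxx)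
  have sq1: "\<delta>\<^sup>2 \<le> \<delta>" "\<delta> ^ 4 \<le> \<delta>"
    using \<delta> power_decreasing[of 1 2 \<delta>] power_decreasing[of 1 4 \<delta>] by simp_all
  show ?thesis
  proof (rule small_mono[OF small_product_difference[OF F G DF[unfolded split] DG[unfolded split]]])
    have "2 * ((\<alpha> + \<beta>) * (4 * (real n * \<delta>\<^sup>2) + 2 * real d)) + (\<alpha> + \<beta>) * (4 * (real n * K * \<delta>))
      \<le> 2 * ((\<alpha> + \<beta>) * (4 * (real n * \<delta>) + 2 * real d)) + (\<alpha> + \<beta>) * (4 * (real n * K * \<delta>))"
      using sq1 ab0 \<delta> K0 by (intro add_mono mult_left_mono) auto
    also have "\<dots> = (\<alpha> + \<beta>) * (8 * (real n * \<delta>) + 4 * real d + 4 * (K * (real n * \<delta>)))"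
      by (simp add: algebra_simps)
    also have "\<dots> \<le> (\<alpha> + \<beta>) * ((8 + 4 * K) * (real n * \<delta> + real d))"
      using ab0 K0 by (intro mult_left_mono) (auto simp: algebra_simps)
    finally show "\<alpha> * (4 * (real n * \<delta> ^ 4 / \<delta>\<^sup>2) + 2 * real d) + \<beta> * (4 * (real n * K / (1 / \<delta>))) +
        (\<alpha> * (4 * (real n * K / (1 / \<delta>))) + \<beta> * (4 * (real n * \<delta> ^ 4 / \<delta>\<^sup>2) + 2 * real d)) +
        (\<alpha> * (4 * (real n * \<delta> ^ 4 / \<delta>\<^sup>2) + 2 * real d) + \<beta> * (4 * (real n * \<delta> ^ 4 / \<delta>\<^sup>2) + 2 * real d))
        \<le> (\<alpha> + \<beta>) * (8 + 4 * K) * (real n * \<delta> + real d)"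
      unfolding times_divide_eq_right[symmetric] sq by (simp add: algebra_simps)
    have "\<alpha> * (4 * \<delta>\<^sup>2) * (\<beta> * (4 * (1 / \<delta>))) = 16 * \<alpha> * \<beta> * \<delta>"
      "\<alpha> * (4 * (1 / \<delta>)) * (\<beta> * (4 * \<delta>\<^sup>2)) = 16 * \<alpha> * \<beta> * \<delta>"
      using \<delta> by (simp_all add: power2_eq_square)
    moreover have "\<alpha> * (4 * \<delta>\<^sup>2) * (\<beta> * (4 * \<delta>\<^sup>2)) = 16 * \<alpha> * \<beta> * \<delta> ^ 4"
      by (simp add: power2_eq_square power4_eq_xxxx)
    moreover have "16 * \<alpha> * \<beta> * \<delta> ^ 4 \<le> 16 * \<alpha> * \<beta> * \<delta>" using sq1 ab0 by (intro mult_left_mono) auto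
    ultimately show "\<alpha> * (4 * \<delta>\<^sup>2) * (\<beta> * (4 * (1 / \<delta>))) + \<alpha> * (4 * (1 / \<delta>)) * (\<beta> * (4 * \<delta>\<^sup>2)) +
        \<alpha> * (4 * \<delta>\<^sup>2) * (\<beta> * (4 * \<delta>\<^sup>2)) \<le> 48 * \<alpha> * \<beta> * \<delta>"
      by linarith
  qed (use \<delta> ab0 in auto)
qed

text \<open>The completeness of Lebesgue measure makes an almost everywhere limit of measurable functions
measurable.\<close>

lemma borel_measurable_AE_limit:
  fixes h :: "real \<Rightarrow> real"
  assumes m: "\<And>k::nat. u k \<in> borel_measurable circle_measure"
    and lim: "AE \<theta> in circle_measure. (\<lambda>k. u k \<theta>) \<longlonglongrightarrow> h \<theta>"
  shows "h \<in> borel_measurable circle_measure"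
proof -
  have S: "{-pi..pi} \<in> sets lebesgue" by simp
  have "(\<lambda>\<theta>. lim (\<lambda>k. u k \<theta>)) \<in> borel_measurable circle_measure"
    by (rule borel_measurable_lim_metric[OF m])
  then have 1: "(\<lambda>\<theta>. if \<theta> \<in> {-pi..pi} then lim (\<lambda>k. u k \<theta>) else 0) \<in> borel_measurable lebesgue"
    by (subst borel_measurable_if[OF S])
  have "AE \<theta> in lebesgue. \<theta> \<in> {-pi..pi} \<longrightarrow> (\<lambda>k. u k \<theta>) \<longlonglongrightarrow> h \<theta>"
    using lim by (subst (asm) AE_restrict_space_iff) auto
  then have "AE \<theta> in lebesgue. (if \<theta> \<in> {-pi..pi} then lim (\<lambda>k. u k \<theta>) else 0) = (if \<theta> \<in> {-pi..pi} then h \<theta> else 0)"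
    by eventually_elim (auto simp: limI)
  from borel_measurable_AE[OF 1 this] show ?thesis by (subst (asm) borel_measurable_if[OF S])
qed

text \<open>For fixed \<open>m\<close>, the sum for the Toeplitz product is compared with that for the circulants of the \<open>m\<close>-th
approximation, which converges as a Riemann sum when \<open>n\<close> grows. The integrals then converge by dominated convergence
along a subsequence \<open>r\<close> on which all entries converge almost everywhere.\<close>

theorem limit_for_test_functions:
  fixes f g :: "real \<Rightarrow> nat \<Rightarrow> nat \<Rightarrow> complex"
  assumes ab: "0 < a" "0 < b"
    and f: "\<And>p q. p < a \<Longrightarrow> q < c \<Longrightarrow> integrable circle_measure (\<lambda>\<theta>. f \<theta> p q)"
    and g: "\<And>p q. p < c \<Longrightarrow> q < b \<Longrightarrow> integrable circle_measure (\<lambda>\<theta>. g \<theta> p q)"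
    and A: "\<And>n. A n \<in> carrier_mat (a * n) (b * n)"
    and entry: "\<And>n i p k q. i < n \<Longrightarrow> p < a \<Longrightarrow> k < n \<Longrightarrow> q < b \<Longrightarrow>
      A n $$ (a * i + p, b * k + q) = mat_prod ({..<n} \<times> {..<c}) (toeplitz_blocks f) (toeplitz_blocks g) (i, p) (k, q)"
    and \<psi>: "test_fun L \<psi>"
  shows "(\<lambda>\<theta>. sv_sum \<psi> (symbol_product a b c f g \<theta>)) \<in> borel_measurable circle_measure"
    and "(\<lambda>n. sv_sum \<psi> (A n) / real n) \<longlonglongrightarrow>
      (LINT \<theta>|circle_measure. sv_sum \<psi> (symbol_product a b c f g \<theta>)) / (2 * pi)"
proof -
  interpret finite_measure circle_measure by (rule finite_measure_circle)
  define \<delta> where "\<delta> = (\<lambda>m. 1 / real (Suc m))"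
  have \<delta>: "0 < \<delta> m" "\<delta> m \<le> 1" for m by (auto simp: \<delta>_def)
  define errf where "errf = (\<lambda>p q d e. LINT \<theta>|circle_measure. cmod (f \<theta> p q - trig_poly d e \<theta>))"
  define errg where "errg = (\<lambda>p q d e. LINT \<theta>|circle_measure. cmod (g \<theta> p q - trig_poly d e \<theta>))"
  have "\<exists>d e e'. (\<forall>p<a. \<forall>q<c. errf p q d (e p q) < \<delta> m ^ 4) \<and> (\<forall>p<c. \<forall>q<b. errg p q d (e' p q) < \<delta> m ^ 4)" for m
  proof -
    have pos: "0 < \<delta> m ^ 4" using \<delta>(1)[of m] by (rule zero_less_power)
    obtain d1 where d1: "\<And>d. d1 \<le> d \<Longrightarrow> \<exists>e. \<forall>p<a. \<forall>q<c. errf p q d (e p q) < \<delta> m ^ 4"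
      using trig_poly_dense_entries[of a c f, OF f pos] unfolding errf_def by blast
    obtain d2 where d2: "\<And>d. d2 \<le> d \<Longrightarrow> \<exists>e. \<forall>p<c. \<forall>q<b. errg p q d (e p q) < \<delta> m ^ 4"
      using trig_poly_dense_entries[of c b g, OF g pos] unfolding errg_def by blast
    show ?thesis using d1[of "max d1 d2"] d2[of "max d1 d2"] by auto
  qed
  then obtain d e e' where
    df': "\<And>m p q. p < a \<Longrightarrow> q < c \<Longrightarrow> errf p q (d m) (e m p q) < \<delta> m ^ 4" and
    dg': "\<And>m p q. p < c \<Longrightarrow> q < b \<Longrightarrow> errg p q (d m) (e' m p q) < \<delta> m ^ 4" by metis
  define fm where "fm = (\<lambda>m \<theta> p q. trig_poly (d m) (e m p q) \<theta>)"
  define gm where "gm = (\<lambda>m \<theta> p q. trig_poly (d m) (e' m p q) \<theta>)"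
  have df: "(LINT \<theta>|circle_measure. cmod (f \<theta> p q - fm m \<theta> p q)) \<le> \<delta> m ^ 4" if "p < a" "q < c" for m p q
    using df'[OF that, of m] by (simp add: errf_def fm_def)
  have dg: "(LINT \<theta>|circle_measure. cmod (g \<theta> p q - gm m \<theta> p q)) \<le> \<delta> m ^ 4" if "p < c" "q < b" for m p q
    using dg'[OF that, of m] by (simp add: errg_def gm_def)
  define K where "K = (\<Sum>p<a. \<Sum>q<c. LINT \<theta>|circle_measure. cmod (f \<theta> p q)) + (\<Sum>p<c. \<Sum>q<b. LINT \<theta>|circle_measure. cmod (g \<theta> p q))"
  have nnf: "0 \<le> (LINT \<theta>|circle_measure. cmod (f \<theta> p q))" and nng: "0 \<le> (LINT \<theta>|circle_measure. cmod (g \<theta> p q))" for p q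
    by (auto intro!: Bochner_Integration.integral_nonneg)
  have fK: "(LINT \<theta>|circle_measure. cmod (f \<theta> p q)) \<le> K" if "p < a" "q < c" for p q
    using le_double_sum[of "\<lambda>p q. LINT \<theta>|circle_measure. cmod (f \<theta> p q)", OF nnf that]
    unfolding K_def by (rule order_trans) (simp add: sum_nonneg)
  have gK: "(LINT \<theta>|circle_measure. cmod (g \<theta> p q)) \<le> K" if "p < c" "q < b" for p q
    using le_double_sum[of "\<lambda>p q. LINT \<theta>|circle_measure. cmod (g \<theta> p q)", OF nng that]
    unfolding K_def by (rule order_trans) (simp add: sum_nonneg)
  have K0: "0 \<le> K" unfolding K_def using nnf nng by (intro add_nonneg_nonneg sum_nonneg) auto
  define \<alpha> where "\<alpha> = real (a * c)"
  define \<beta> where "\<beta> = real (c * b)"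
  have ab0: "0 \<le> \<alpha>" "0 \<le> \<beta>" by (auto simp: \<alpha>_def \<beta>_def)
  define R where "R = (\<alpha> + \<beta>) * (8 + 4 * K)"
  define \<tau> where "\<tau> = 48 * \<alpha> * \<beta>"
  have R0: "0 \<le> R" "0 \<le> \<tau>" using ab0 K0 by (auto simp: R_def \<tau>_def)
  have approx: "small ({..<n} \<times> {..<a}) ({..<n} \<times> {..<b})
      (\<lambda>x y. mat_prod ({..<n} \<times> {..<c}) (toeplitz_blocks f) (toeplitz_blocks g) x y
        - mat_prod ({..<n} \<times> {..<c}) (circulant_blocks n (fm m)) (circulant_blocks n (gm m)) x y)
      (R * (real n * \<delta> m + real (d m))) (\<tau> * \<delta> m)" for n m
    unfolding R_def \<tau>_def \<alpha>_def \<beta>_def fm_def gm_def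
    by (rule small_toeplitz_minus_circulant_product[OF f g fK gK \<delta> K0])
       (use df dg in \<open>simp_all add: fm_def gm_def\<close>)
  define h where "h = (\<lambda>\<theta>. sv_sum \<psi> (symbol_product a b c f g \<theta>))"
  define hm where "hm = (\<lambda>m \<theta>. sv_sum \<psi> (symbol_product a b c (fm m) (gm m) \<theta>))"
  define C where "C = R + real b * L * \<tau>"
  have L0: "0 \<le> L" using \<psi> by (simp add: test_fun_def)
  have near: "\<bar>sv_sum \<psi> (A n) / real n - (\<Sum>l<n. hm m (node n l)) / real n\<bar> \<le> C * \<delta> m + R * real (d m) / real n"
    if n: "0 < n" for n m
  proof -
    have "\<bar>sv_sum \<psi> (A n) - (\<Sum>l<n. hm m (node n l))\<bar> \<le> R * (real n * \<delta> m + real (d m)) + real (b * n) * L * (\<tau> * \<delta> m)"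
      unfolding hm_def
      by (rule sv_sum_near_circulants[OF n ab A entry approx _ \<psi>]) (use R0 \<delta>[of m] in auto)
    also have "\<dots> = real n * (C * \<delta> m + R * real (d m) / real n)"
      using n by (simp add: C_def algebra_simps)
    finally have "\<bar>sv_sum \<psi> (A n) - (\<Sum>l<n. hm m (node n l))\<bar> / real n \<le> C * \<delta> m + R * real (d m) / real n"
      using n by (simp add: divide_le_eq mult.commute)
    moreover have "\<bar>sv_sum \<psi> (A n) / real n - (\<Sum>l<n. hm m (node n l)) / real n\<bar> = \<bar>sv_sum \<psi> (A n) - (\<Sum>l<n. hm m (node n l))\<bar> / real n"
      using n by (simp add: diff_divide_distrib[symmetric])
    ultimately show ?thesis by simp
  qed
  have cfm: "continuous_on S (\<lambda>\<theta>. fm m \<theta> p q)" "continuous_on S (\<lambda>\<theta>. gm m \<theta> p q)" for S m p q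
    unfolding fm_def gm_def by (intro continuous_on_trig_poly)+
  have chm: "continuous_on {-pi..pi} (hm m)" for m
    unfolding continuous_on_def hm_def
  proof
    fix \<theta> assume "\<theta> \<in> {-pi..pi}"
    then show "((\<lambda>\<theta>. sv_sum \<psi> (symbol_product a b c (fm m) (gm m) \<theta>)) \<longlongrightarrow> sv_sum \<psi> (symbol_product a b c (fm m) (gm m) \<theta>)) (at \<theta> within {-pi..pi})"
      unfolding symbol_product_const[of _ _ _ "fm m"]
      by (intro symbol_product_tendsto[OF _ _ \<psi>]) (use cfm in \<open>auto simp: continuous_on_def\<close>)
  qed
  have mhm: "hm m \<in> borel_measurable circle_measure" for m
    by (intro continuous_imp_measurable_on_sets_lebesgue chm) simp
  define u where "u = (\<lambda>m \<theta>. (\<Sum>p<a. \<Sum>q<c. cmod (f \<theta> p q - fm m \<theta> p q)) + (\<Sum>p<c. \<Sum>q<b. cmod (g \<theta> p q - gm m \<theta> p q)))"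
  have ifm: "integrable circle_measure (\<lambda>\<theta>. fm m \<theta> p q)" "integrable circle_measure (\<lambda>\<theta>. gm m \<theta> p q)" for m p q
    unfolding fm_def gm_def by (intro integrable_continuous_circle continuous_on_trig_poly)+
  have idf: "integrable circle_measure (\<lambda>\<theta>. cmod (f \<theta> p q - fm m \<theta> p q))" if "p < a" "q < c" for m p q
    using f[OF that] ifm by auto
  have idg: "integrable circle_measure (\<lambda>\<theta>. cmod (g \<theta> p q - gm m \<theta> p q))" if "p < c" "q < b" for m p q
    using g[OF that] ifm by auto
  have iu: "integrable circle_measure (u m)" for m
    unfolding u_def by (intro Bochner_Integration.integrable_add integral_double_sum(1) idf idg)
  have u0: "0 \<le> u m \<theta>" for m \<theta> unfolding u_def by (intro add_nonneg_nonneg sum_nonneg) auto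
  have "(LINT \<theta>|circle_measure. u m \<theta>) \<le> (\<alpha> + \<beta>) * \<delta> m" for m
  proof -
    have p4: "\<delta> m ^ 4 \<le> \<delta> m" using \<delta>[of m] power_decreasing[of 1 4 "\<delta> m"] by simp
    have "(LINT \<theta>|circle_measure. u m \<theta>) = (\<Sum>p<a. \<Sum>q<c. LINT \<theta>|circle_measure. cmod (f \<theta> p q - fm m \<theta> p q))
        + (\<Sum>p<c. \<Sum>q<b. LINT \<theta>|circle_measure. cmod (g \<theta> p q - gm m \<theta> p q))"
      unfolding u_def
      using integral_double_sum[of a c circle_measure "\<lambda>p q \<theta>. cmod (f \<theta> p q - fm m \<theta> p q)", OF idf]
        integral_double_sum[of c b circle_measure "\<lambda>p q \<theta>. cmod (g \<theta> p q - gm m \<theta> p q)", OF idg]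
      by (simp add: Bochner_Integration.integral_add)
    also have "\<dots> \<le> (\<Sum>p<a. \<Sum>q<c. \<delta> m) + (\<Sum>p<c. \<Sum>q<b. \<delta> m)"
      by (intro add_mono sum_mono order_trans[OF df p4] order_trans[OF dg p4]) auto
    also have "\<dots> = (\<alpha> + \<beta>) * \<delta> m" by (simp add: \<alpha>_def \<beta>_def distrib_right)
    finally show ?thesis .
  qed
  then have ule: "(LINT \<theta>|circle_measure. norm (u m \<theta>)) \<le> (\<alpha> + \<beta>) * \<delta> m" for m
    using u0 by simp
  have \<delta>lim: "\<delta> \<longlonglongrightarrow> 0" unfolding \<delta>_def by (rule LIMSEQ_Suc[OF lim_1_over_n])
  have "(\<lambda>m. LINT \<theta>|circle_measure. norm (u m \<theta>)) \<longlonglongrightarrow> 0"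
  proof (rule Lim_null_comparison)
    show "\<forall>\<^sub>F m in sequentially. norm (LINT \<theta>|circle_measure. norm (u m \<theta>)) \<le> (\<alpha> + \<beta>) * \<delta> m"
      using ule by (intro always_eventually allI) simp
    show "(\<lambda>m. (\<alpha> + \<beta>) * \<delta> m) \<longlonglongrightarrow> 0" using tendsto_mult_left[OF \<delta>lim, of "\<alpha> + \<beta>"] by simp
  qed
  then obtain r where r: "strict_mono r" "AE \<theta> in circle_measure. (\<lambda>m. u (r m) \<theta>) \<longlonglongrightarrow> 0"
    using tendsto_L1_AE_subseq[of circle_measure u, OF iu] by blast
  have ae: "AE \<theta> in circle_measure. (\<lambda>m. hm (r m) \<theta>) \<longlonglongrightarrow> h \<theta>"
    using r(2)
  proof eventually_elim
    case (elim \<theta>)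
    have lf: "(\<lambda>m. fm (r m) \<theta> p q) \<longlonglongrightarrow> f \<theta> p q" if "p < a" "q < c" for p q
    proof -
      have "norm (fm (r m) \<theta> p q - f \<theta> p q) \<le> u (r m) \<theta>" for m
        using le_double_sum[of "\<lambda>p q. cmod (f \<theta> p q - fm (r m) \<theta> p q)", OF _ that]
        unfolding u_def norm_minus_commute[of "fm (r m) \<theta> p q"]
        by (rule order_trans) (simp_all add: sum_nonneg)
      then have "(\<lambda>m. fm (r m) \<theta> p q - f \<theta> p q) \<longlonglongrightarrow> 0"
        by (intro Lim_null_comparison[OF _ elim] always_eventually allI)
      then show ?thesis by (simp add: LIM_zero_iff)
    qed
    have lg: "(\<lambda>m. gm (r m) \<theta> p q) \<longlonglongrightarrow> g \<theta> p q" if "p < c" "q < b" for p q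
    proof -
      have "norm (gm (r m) \<theta> p q - g \<theta> p q) \<le> u (r m) \<theta>" for m
        using le_double_sum[of "\<lambda>p q. cmod (g \<theta> p q - gm (r m) \<theta> p q)", OF _ that]
        unfolding u_def norm_minus_commute[of "gm (r m) \<theta> p q"]
        by (rule order_trans) (simp_all add: sum_nonneg)
      then have "(\<lambda>m. gm (r m) \<theta> p q - g \<theta> p q) \<longlonglongrightarrow> 0"
        by (intro Lim_null_comparison[OF _ elim] always_eventually allI)
      then show ?thesis by (simp add: LIM_zero_iff)
    qed
    show ?case unfolding hm_def h_def
      unfolding symbol_product_const[of _ _ _ "fm _" "gm _"] symbol_product_const[of _ _ _ f g]
      by (rule symbol_product_tendsto[OF lf lg \<psi>])
  qed
  show hmeas: "(\<lambda>\<theta>. sv_sum \<psi> (symbol_product a b c f g \<theta>)) \<in> borel_measurable circle_measure"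
    using borel_measurable_AE_limit[OF mhm ae] by (simp add: h_def[abs_def])
  have Zlim: "(\<lambda>m. LINT \<theta>|circle_measure. hm (r m) \<theta>) \<longlonglongrightarrow> (LINT \<theta>|circle_measure. h \<theta>)"
  proof (rule integral_dominated_convergence[where w = "\<lambda>_. real b", OF _ mhm _ ae])
    show "h \<in> borel_measurable circle_measure" unfolding h_def by (rule hmeas)
    show "AE \<theta> in circle_measure. norm (hm (r m) \<theta>) \<le> real b" for m
      using sv_sum_bounds[OF symbol_product_carrier \<psi>] unfolding hm_def by (intro always_eventually allI) simp
  qed simp
  have "(\<lambda>n. sv_sum \<psi> (A n) / real n) \<longlonglongrightarrow> (LINT \<theta>|circle_measure. h \<theta>) / (2 * pi)"
  proof (rule LIMSEQ_I)
    fix e :: real assume e: "0 < e"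
    have "(\<lambda>m. (LINT \<theta>|circle_measure. hm (r m) \<theta>) / (2 * pi)) \<longlonglongrightarrow> (LINT \<theta>|circle_measure. h \<theta>) / (2 * pi)"
      by (intro tendsto_divide Zlim tendsto_const) auto
    then have e1: "eventually (\<lambda>m. dist ((LINT \<theta>|circle_measure. hm (r m) \<theta>) / (2 * pi)) ((LINT \<theta>|circle_measure. h \<theta>) / (2 * pi)) < e / 4) sequentially"
      by (rule tendstoD) (use e in simp)
    have "(\<lambda>m. C * \<delta> (r m)) \<longlonglongrightarrow> C * 0"
      using LIMSEQ_subseq_LIMSEQ[OF \<delta>lim r(1)] by (intro tendsto_mult_left) (simp add: comp_def)
    then have e2: "eventually (\<lambda>m. C * \<delta> (r m) < e / 4) sequentially"
      using e by (intro order_tendstoD(2)) auto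
    from eventually_conj[OF e1 e2] obtain m where
      m: "dist ((LINT \<theta>|circle_measure. hm (r m) \<theta>) / (2 * pi)) ((LINT \<theta>|circle_measure. h \<theta>) / (2 * pi)) < e / 4" "C * \<delta> (r m) < e / 4"
      by (auto simp: eventually_sequentially)
    have e3: "eventually (\<lambda>n. dist ((\<Sum>l<n. hm (r m) (node n l)) / real n) ((LINT \<theta>|circle_measure. hm (r m) \<theta>) / (2 * pi)) < e / 4) sequentially"
      using riemann_sum_tendsto[OF chm] by (rule tendstoD) (use e in simp)
    have "(\<lambda>n. R * real (d (r m)) * (1 / real n)) \<longlonglongrightarrow> R * real (d (r m)) * 0"
      by (intro tendsto_mult_left lim_1_over_n)
    then have e4: "eventually (\<lambda>n. R * real (d (r m)) * (1 / real n) < e / 4) sequentially"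
      using e by (intro order_tendstoD(2)) auto
    have "eventually (\<lambda>n. norm (sv_sum \<psi> (A n) / real n - (LINT \<theta>|circle_measure. h \<theta>) / (2 * pi)) < e) sequentially"
      using e3 e4 eventually_gt_at_top[of 0]
    proof eventually_elim
      case (elim n)
      have "R * real (d (r m)) / real n < e / 4" using elim(2) by (simp only: times_divide_eq_right mult_1_right)
      then show ?case
        using near[OF elim(3), of "r m"] m elim(1) unfolding dist_real_def real_norm_def by linarith
    qed
    then show "\<exists>no. \<forall>n\<ge>no. norm (sv_sum \<psi> (A n) / real n - (LINT \<theta>|circle_measure. h \<theta>) / (2 * pi)) < e"
      by (auto simp: eventually_sequentially)
  qed
  then show "(\<lambda>n. sv_sum \<psi> (A n) / real n) \<longlonglongrightarrow>
      (LINT \<theta>|circle_measure. sv_sum \<psi> (symbol_product a b c f g \<theta>)) / (2 * pi)" by (simp add: h_def)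
qed

section \<open>The limit for continuous test functions\<close>

lemma power_diff_le:
  fixes u v :: real
  assumes "0 \<le> v" "v \<le> u" "u \<le> 1"
  shows "u ^ k - v ^ k \<le> real k * (u - v)"
proof (induction k)
  case (Suc k)
  have "u ^ Suc k - v ^ Suc k = u * (u ^ k - v ^ k) + v ^ k * (u - v)" by (simp add: algebra_simps)
  also have "\<dots> \<le> 1 * (real k * (u - v)) + 1 * (u - v)"
  proof (intro add_mono)
    have "u * (u ^ k - v ^ k) \<le> u * (real k * (u - v))" using Suc assms by (intro mult_left_mono) auto
    also have "\<dots> \<le> 1 * (real k * (u - v))" using assms by (intro mult_right_mono) auto
    finally show "u * (u ^ k - v ^ k) \<le> 1 * (real k * (u - v))" .
    show "v ^ k * (u - v) \<le> 1 * (u - v)" using assms by (intro mult_right_mono power_le_one) auto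
  qed
  finally show ?case by (simp add: algebra_simps)
qed simp

text \<open>The powers of \<open>1 / (1 + x)\<close> are the monomials in a variable that maps \<open>[0, \<infinity>)\<close> to \<open>(0, 1]\<close>, so their
combinations are dense by the Weierstrass theorem.\<close>

lemma test_fun_power: "test_fun (real k) (\<lambda>x. (1 / (1 + x)) ^ k)"
  unfolding test_fun_def
proof (intro conjI allI impI)
  fix x y :: real assume xy: "0 \<le> x" "x \<le> y"
  have le: "1 / (1 + y) \<le> 1 / (1 + x)" using xy by (simp add: frac_le)
  then show "(1 / (1 + y)) ^ k \<le> (1 / (1 + x)) ^ k" using xy by (intro power_mono) auto
  have "(1 / (1 + x)) ^ k - (1 / (1 + y)) ^ k \<le> real k * (1 / (1 + x) - 1 / (1 + y))"
    using xy le by (intro power_diff_le) auto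
  also have "1 / (1 + x) - 1 / (1 + y) = (y - x) / ((1 + x) * (1 + y))" using xy by (simp add: field_simps)
  also have "real k * \<dots> \<le> real k * ((y - x) / 1)"
  proof (intro mult_left_mono divide_left_mono)
    show "1 \<le> (1 + x) * (1 + y)" using xy mult_mono[of 1 "1 + x" 1 "1 + y"] by simp
  qed (use xy in auto)
  finally show "(1 / (1 + x)) ^ k - (1 / (1 + y)) ^ k \<le> real k * (y - x)" by simp
qed (auto intro: power_le_one)

lemma approx_by_powers_real:
  fixes F :: "real \<Rightarrow> real"
  assumes cont: "continuous_on UNIV F" and B: "\<And>x. B \<le> x \<Longrightarrow> F x = 0" "0 \<le> B" and e: "0 < e"
  shows "\<exists>n a. \<forall>x\<ge>0. \<bar>F x - (\<Sum>k\<le>n. a k * (1 / (1 + x)) ^ k)\<bar> < e"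
proof -
  define u0 where "u0 = 1 / (1 + B)"
  have u0: "0 < u0" "u0 \<le> 1" using B(2) by (auto simp: u0_def)
  \<comment> \<open>Cutting off at \<open>u0\<close> avoids the singularity at \<open>0\<close> and changes nothing, because \<open>F\<close> vanishes beyond \<open>B\<close>.\<close>
  define G where "G = (\<lambda>u. F (1 / max u u0 - 1))"
  have "continuous_on {0..1} G" unfolding G_def
    by (intro continuous_on_compose2[OF cont] continuous_intros) (use u0 in \<open>auto simp: max_def\<close>)
  then obtain p where p: "real_polynomial_function p" "\<And>u. u \<in> {0..1} \<Longrightarrow> \<bar>G u - p u\<bar> < e"
    using Stone_Weierstrass_real_polynomial_function[of "{0..1::real}" G e] e by auto
  obtain a n where an: "p = (\<lambda>x. \<Sum>i\<le>n. a i * x ^ i)"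
    using p(1) unfolding real_polynomial_function_iff_sum by blast
  have "\<bar>F x - (\<Sum>k\<le>n. a k * (1 / (1 + x)) ^ k)\<bar> < e" if x: "0 \<le> x" for x
  proof -
    have "G (1 / (1 + x)) = F x"
    proof (cases "x \<le> B")
      case True
      then have "u0 \<le> 1 / (1 + x)" using x B(2) by (simp add: u0_def frac_le)
      then have "G (1 / (1 + x)) = F (1 / (1 / (1 + x)) - 1)" by (simp only: G_def max_absorb1)
      then show ?thesis by simp
    next
      case False
      then have "1 / (1 + x) \<le> u0" using x B(2) by (simp add: u0_def frac_le)
      then have "G (1 / (1 + x)) = F (1 / u0 - 1)" by (simp add: G_def max_def)
      also have "1 / u0 - 1 = B" using B(2) by (simp add: u0_def)
      finally show ?thesis using False B(1) by simp
    qed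
    moreover have "1 / (1 + x) \<in> {0..1}" using x by simp
    ultimately show ?thesis using p(2)[of "1 / (1 + x)"] by (simp add: an)
  qed
  then show ?thesis by blast
qed

lemma approx_by_powers:
  fixes F :: "real \<Rightarrow> complex"
  assumes cont: "continuous_on UNIV F" and comp: "compact (closure {x. F x \<noteq> 0})" and e: "0 < e"
  shows "\<exists>n c. \<forall>x\<ge>0. cmod (F x - (\<Sum>k\<le>n. c k * of_real ((1 / (1 + x)) ^ k))) \<le> e"
proof -
  obtain B0 where B0: "\<And>x. x \<in> closure {x. F x \<noteq> 0} \<Longrightarrow> norm x \<le> B0"
    using compact_imp_bounded[OF comp] unfolding bounded_iff by blast
  define B where "B = max 0 (B0 + 1)"
  have B: "F x = 0" if "B \<le> x" for x
  proof (rule ccontr)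
    assume "F x \<noteq> 0"
    then have "x \<in> closure {x. F x \<noteq> 0}" by (intro subsetD[OF closure_subset]) simp
    then have "norm x \<le> B0" by (rule B0)
    then show False using that by (simp add: B_def)
  qed
  have "\<exists>n a. \<forall>x\<ge>0. \<bar>Re (F x) - (\<Sum>k\<le>n. a k * (1 / (1 + x)) ^ k)\<bar> < e / 2"
  proof (rule approx_by_powers_real[where B = B])
    show "continuous_on UNIV (\<lambda>x. Re (F x))" by (intro continuous_intros cont)
    show "Re (F x) = 0" if "B \<le> x" for x using B[OF that] by simp
    show "0 \<le> B" by (simp add: B_def)
  qed (use e in simp)
  then obtain n a where na: "\<And>x. 0 \<le> x \<Longrightarrow> \<bar>Re (F x) - (\<Sum>k\<le>n. a k * (1 / (1 + x)) ^ k)\<bar> < e / 2" by blast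
  have "\<exists>n a. \<forall>x\<ge>0. \<bar>Im (F x) - (\<Sum>k\<le>n. a k * (1 / (1 + x)) ^ k)\<bar> < e / 2"
  proof (rule approx_by_powers_real[where B = B])
    show "continuous_on UNIV (\<lambda>x. Im (F x))" by (intro continuous_intros cont)
    show "Im (F x) = 0" if "B \<le> x" for x using B[OF that] by simp
    show "0 \<le> B" by (simp add: B_def)
  qed (use e in simp)
  then obtain m b where mb: "\<And>x. 0 \<le> x \<Longrightarrow> \<bar>Im (F x) - (\<Sum>k\<le>m. b k * (1 / (1 + x)) ^ k)\<bar> < e / 2" by blast
  define c where "c = (\<lambda>k. Complex (if k \<le> n then a k else 0) (if k \<le> m then b k else 0))"
  have "cmod (F x - (\<Sum>k\<le>max n m. c k * of_real ((1 / (1 + x)) ^ k))) \<le> e" if x: "0 \<le> x" for x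
  proof -
    have pad: "(\<Sum>k\<le>max n m. (if k \<le> n' then a' k else 0) * y ^ k) = (\<Sum>k\<le>n'. a' k * y ^ k)"
      if "n' \<le> max n m" for n' a' and y :: real
      using that by (intro sum.mono_neutral_cong_right) auto
    have "Re (\<Sum>k\<le>max n m. c k * of_real ((1 / (1 + x)) ^ k)) = (\<Sum>k\<le>n. a k * (1 / (1 + x)) ^ k)"
      unfolding Re_sum using pad[of n a] by (simp add: c_def)
    moreover have "Im (\<Sum>k\<le>max n m. c k * of_real ((1 / (1 + x)) ^ k)) = (\<Sum>k\<le>m. b k * (1 / (1 + x)) ^ k)"
      unfolding Im_sum using pad[of m b] by (simp add: c_def)
    ultimately show ?thesis
      using na[OF x] mb[OF x] cmod_le[of "F x - (\<Sum>k\<le>max n m. c k * of_real ((1 / (1 + x)) ^ k))"]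
      by (simp only: minus_complex.sel)
  qed
  then show ?thesis by blast
qed

lemma sv_sum_linear_combination:
  "sv_sum (\<lambda>x. \<Sum>k\<le>n. c k * complex_of_real (\<psi> k x)) A = (\<Sum>k\<le>n. c k * of_real (sv_sum (\<psi> k) A))"
proof -
  have "sv_sum (\<lambda>x. \<Sum>k\<le>n. c k * complex_of_real (\<psi> k x)) A
      = (\<Sum>k\<le>n. \<Sum>j<dim_col A. c k * complex_of_real (\<psi> k (sv_list A ! j)))"
    unfolding sv_sum_def by (rule sum.swap)
  then show ?thesis by (simp add: sv_sum_def sum_distrib_left)
qed

lemma sv_sum_close:
  fixes F P :: "real \<Rightarrow> complex"
  assumes A: "A \<in> carrier_mat m N" and close: "\<And>x. 0 \<le> x \<Longrightarrow> cmod (F x - P x) \<le> e"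
  shows "cmod (sv_sum F A - sv_sum P A) \<le> real N * e"
proof -
  have "cmod (sv_sum F A - sv_sum P A) = cmod (\<Sum>j<N. F (sv_list A ! j) - P (sv_list A ! j))"
    using A by (simp add: sv_sum_def sum_subtractf)
  also have "\<dots> \<le> (\<Sum>j<N. e)"
    using sv_list_nonneg[OF A] length_sv_list[OF A] by (intro order_trans[OF norm_sum] sum_mono close) auto
  finally show ?thesis by simp
qed

text \<open>Both sides of the limit depend linearly on \<open>F\<close> and change by at most \<open>b \<epsilon>\<close> when \<open>F\<close> changes by at
most \<open>\<epsilon>\<close> on \<open>[0, \<infinity>)\<close>, so the class of admissible \<open>F\<close> is closed under linear combinations and uniform limits.\<close>

theorem limit_for_continuous_functions:
  fixes f g :: "real \<Rightarrow> nat \<Rightarrow> nat \<Rightarrow> complex" and F :: "real \<Rightarrow> complex"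
  assumes ab: "0 < a" "0 < b"
    and f: "\<And>p q. p < a \<Longrightarrow> q < c \<Longrightarrow> integrable circle_measure (\<lambda>\<theta>. f \<theta> p q)"
    and g: "\<And>p q. p < c \<Longrightarrow> q < b \<Longrightarrow> integrable circle_measure (\<lambda>\<theta>. g \<theta> p q)"
    and A: "\<And>n. A n \<in> carrier_mat (a * n) (b * n)"
    and entry: "\<And>n i p k q. i < n \<Longrightarrow> p < a \<Longrightarrow> k < n \<Longrightarrow> q < b \<Longrightarrow>
      A n $$ (a * i + p, b * k + q) = mat_prod ({..<n} \<times> {..<c}) (toeplitz_blocks f) (toeplitz_blocks g) (i, p) (k, q)"
    and cont: "continuous_on UNIV F" and comp: "compact (closure {x. F x \<noteq> 0})"
  shows "integrable circle_measure (\<lambda>\<theta>. sv_sum F (symbol_product a b c f g \<theta>))"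
    and "(\<lambda>n. sv_sum F (A n) / of_nat n) \<longlonglongrightarrow>
      (LINT \<theta>|circle_measure. sv_sum F (symbol_product a b c f g \<theta>)) / (2 * of_real pi)"
proof -
  interpret finite_measure circle_measure by (rule finite_measure_circle)
  define M where "M = symbol_product a b c f g"
  have Mc: "M \<theta> \<in> carrier_mat a b" for \<theta> unfolding M_def by (rule symbol_product_carrier)
  define \<psi> where "\<psi> = (\<lambda>k x. (1 / (1 + x :: real)) ^ k)"
  have \<psi>: "test_fun (real k) (\<psi> k)" for k unfolding \<psi>_def by (rule test_fun_power)
  have i\<psi>: "integrable circle_measure (\<lambda>\<theta>. sv_sum (\<psi> k) (M \<theta>))" for k
  proof (rule integrable_const_bound[where B = "real b"])
    show "(\<lambda>\<theta>. sv_sum (\<psi> k) (M \<theta>)) \<in> borel_measurable circle_measure"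
      unfolding M_def by (rule limit_for_test_functions(1)[OF ab f g A entry \<psi>])
    show "AE \<theta> in circle_measure. norm (sv_sum (\<psi> k) (M \<theta>)) \<le> real b"
      using sv_sum_bounds[OF Mc \<psi>] by (intro always_eventually allI) simp
  qed
  have lim\<psi>: "(\<lambda>n. sv_sum (\<psi> k) (A n) / real n) \<longlonglongrightarrow> (LINT \<theta>|circle_measure. sv_sum (\<psi> k) (M \<theta>)) / (2 * pi)" for k
    unfolding M_def by (rule limit_for_test_functions(2)[OF ab f g A entry \<psi>])
  have "\<exists>n c. \<forall>x\<ge>0. cmod (F x - (\<Sum>k\<le>n. c k * of_real (\<psi> k x))) \<le> 1 / real (Suc m)" for m
    unfolding \<psi>_def by (rule approx_by_powers[OF cont comp]) simp
  then obtain d e where de: "\<And>m x. 0 \<le> x \<Longrightarrow> cmod (F x - (\<Sum>k\<le>d m. e m k * of_real (\<psi> k x))) \<le> 1 / real (Suc m)"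
    by metis
  define P where "P = (\<lambda>m x. \<Sum>k\<le>d m. e m k * complex_of_real (\<psi> k x))"
  have PF: "cmod (F x - P m x) \<le> 1 / real (Suc m)" if "0 \<le> x" for m x using de[OF that] by (simp add: P_def)
  have svP: "sv_sum (P m) B = (\<Sum>k\<le>d m. e m k * of_real (sv_sum (\<psi> k) B))" for m B
    unfolding P_def by (rule sv_sum_linear_combination)
  have iP: "integrable circle_measure (\<lambda>\<theta>. sv_sum (P m) (M \<theta>))" for m
    unfolding svP by (intro Bochner_Integration.integrable_sum integrable_mult_right integrable_of_real i\<psi>)
  have limP: "(\<lambda>n. sv_sum (P m) (A n) / of_nat n) \<longlonglongrightarrow> (LINT \<theta>|circle_measure. sv_sum (P m) (M \<theta>)) / (2 * of_real pi)" for m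
  proof -
    have "(\<lambda>n. \<Sum>k\<le>d m. e m k * of_real (sv_sum (\<psi> k) (A n) / real n)) \<longlonglongrightarrow>
        (\<Sum>k\<le>d m. e m k * of_real ((LINT \<theta>|circle_measure. sv_sum (\<psi> k) (M \<theta>)) / (2 * pi)))"
      by (intro tendsto_intros lim\<psi>)
    moreover have "(LINT \<theta>|circle_measure. sv_sum (P m) (M \<theta>)) = (\<Sum>k\<le>d m. e m k * of_real (LINT \<theta>|circle_measure. sv_sum (\<psi> k) (M \<theta>)))"
      unfolding svP
      by (subst Bochner_Integration.integral_sum) (auto intro!: integrable_mult_right integrable_of_real i\<psi>)
    ultimately show ?thesis by (simp add: svP sum_divide_distrib)
  qed
  have close: "cmod (sv_sum F (M \<theta>) - sv_sum (P m) (M \<theta>)) \<le> real b * (1 / real (Suc m))" for m \<theta>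
    by (rule sv_sum_close[OF Mc PF])
  have inv0: "(\<lambda>m. real b * (1 / real (Suc m))) \<longlonglongrightarrow> 0"
    using tendsto_mult_left[OF LIMSEQ_Suc[OF lim_1_over_n], of "real b"] by simp
  have meas: "(\<lambda>\<theta>. sv_sum F (M \<theta>)) \<in> borel_measurable circle_measure"
  proof (rule borel_measurable_LIMSEQ_metric)
    show "(\<lambda>\<theta>. sv_sum (P m) (M \<theta>)) \<in> borel_measurable circle_measure" for m using iP by auto
    fix \<theta>
    have "(\<lambda>m. sv_sum (P m) (M \<theta>) - sv_sum F (M \<theta>)) \<longlonglongrightarrow> 0"
      by (rule Lim_null_comparison[OF _ inv0]) (use close[of \<theta>] in \<open>simp add: norm_minus_commute\<close>)
    then show "(\<lambda>m. sv_sum (P m) (M \<theta>)) \<longlonglongrightarrow> sv_sum F (M \<theta>)" by (simp add: LIM_zero_iff)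
  qed
  have iF: "integrable circle_measure (\<lambda>\<theta>. sv_sum F (M \<theta>))"
  proof (rule Bochner_Integration.integrable_bound[OF _ meas])
    show "integrable circle_measure (\<lambda>\<theta>. cmod (sv_sum (P 0) (M \<theta>)) + real b)" using iP[of 0] by auto
    show "AE \<theta> in circle_measure. norm (sv_sum F (M \<theta>)) \<le> norm (cmod (sv_sum (P 0) (M \<theta>)) + real b)"
    proof (intro always_eventually allI)
      fix \<theta>
      show "norm (sv_sum F (M \<theta>)) \<le> norm (cmod (sv_sum (P 0) (M \<theta>)) + real b)"
        using close[of \<theta> 0] norm_triangle_sub[of "sv_sum F (M \<theta>)" "sv_sum (P 0) (M \<theta>)"] by simp
    qed
  qed
  then show "integrable circle_measure (\<lambda>\<theta>. sv_sum F (symbol_product a b c f g \<theta>))" by (simp add: M_def)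
  define Z where "Z = (\<lambda>G. (LINT \<theta>|circle_measure. sv_sum G (M \<theta>)) / (2 * complex_of_real pi))"
  have ZP: "cmod (Z F - Z (P m)) \<le> real b * (1 / real (Suc m))" for m
  proof -
    have "Z F - Z (P m) = (LINT \<theta>|circle_measure. sv_sum F (M \<theta>) - sv_sum (P m) (M \<theta>)) / (2 * of_real pi)"
      using iF iP by (simp add: Z_def diff_divide_distrib)
    then have "cmod (Z F - Z (P m)) = cmod (LINT \<theta>|circle_measure. sv_sum F (M \<theta>) - sv_sum (P m) (M \<theta>)) / (2 * pi)"
      by (simp add: norm_divide norm_mult)
    also have "\<dots> \<le> (LINT \<theta>|circle_measure. real b * (1 / real (Suc m))) / (2 * pi)"
      using iF iP close
      by (intro divide_right_mono order_trans[OF integral_norm_bound] integral_mono) auto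
    also have "(LINT \<theta>|circle_measure. real b * (1 / real (Suc m))) = (2 * pi) * (real b * (1 / real (Suc m)))"
      using measure_circle by simp
    finally show ?thesis by simp
  qed
  have AP: "cmod (sv_sum F (A n) / of_nat n - sv_sum (P m) (A n) / of_nat n) \<le> real b * (1 / real (Suc m))" if "0 < n" for n m
  proof -
    have "cmod (sv_sum F (A n) - sv_sum (P m) (A n)) \<le> real (b * n) * (1 / real (Suc m))"
      by (rule sv_sum_close[OF A PF])
    then have "cmod (sv_sum F (A n) - sv_sum (P m) (A n)) / real n \<le> real b * (1 / real (Suc m))"
      using that by (simp add: divide_le_eq mult_ac)
    then show ?thesis by (simp add: diff_divide_distrib[symmetric] norm_divide)
  qed
  have "(\<lambda>n. sv_sum F (A n) / of_nat n) \<longlonglongrightarrow> Z F"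
  proof (rule LIMSEQ_I)
    fix \<epsilon> :: real assume \<epsilon>: "0 < \<epsilon>"
    have "eventually (\<lambda>m. real b * (1 / real (Suc m)) < \<epsilon> / 3) sequentially"
      using inv0 \<epsilon> by (intro order_tendstoD(2)) auto
    then obtain m where m: "real b * (1 / real (Suc m)) < \<epsilon> / 3" by (auto simp: eventually_sequentially)
    have "eventually (\<lambda>n. dist (sv_sum (P m) (A n) / of_nat n) (Z (P m)) < \<epsilon> / 3) sequentially"
      using limP[of m] unfolding Z_def by (rule tendstoD) (use \<epsilon> in simp)
    then have "eventually (\<lambda>n. norm (sv_sum F (A n) / of_nat n - Z F) < \<epsilon>) sequentially"
      using eventually_gt_at_top[of 0]
    proof eventually_elim
      case (elim n)
      define x where "x = sv_sum F (A n) / of_nat n"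
      define y where "y = sv_sum (P m) (A n) / of_nat n"
      have "norm (x - Z F) \<le> norm (x - y) + norm (y - Z (P m)) + norm (Z (P m) - Z F)"
        using norm_triangle_ineq[of "x - y" "y - Z F"] norm_triangle_ineq[of "y - Z (P m)" "Z (P m) - Z F"] by simp
      moreover have "norm (Z (P m) - Z F) \<le> real b * (1 / real (Suc m))" using ZP by (simp add: norm_minus_commute)
      moreover have "norm (x - y) \<le> real b * (1 / real (Suc m))" unfolding x_def y_def by (rule AP[OF elim(2)])
      moreover have "norm (y - Z (P m)) < \<epsilon> / 3" using elim(1) by (simp add: y_def dist_norm)
      ultimately show ?case using m unfolding x_def by linarith
    qed
    then show "\<exists>no. \<forall>n\<ge>no. norm (sv_sum F (A n) / of_nat n - Z F) < \<epsilon>" by (auto simp: eventually_sequentially)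
  qed
  then show "(\<lambda>n. sv_sum F (A n) / of_nat n) \<longlonglongrightarrow>
      (LINT \<theta>|circle_measure. sv_sum F (symbol_product a b c f g \<theta>)) / (2 * of_real pi)"
    by (simp add: Z_def M_def)
qed

theorem sv_distributed_toeplitz_product:
  assumes abc: "0 < a" "0 < b" "0 < c"
    and f: "mat_L1_on {-pi..pi} a c f" and g: "mat_L1_on {-pi..pi} c b g"
  shows "sv_distributed a b (\<lambda>n. n) (\<lambda>n. n)
    (\<lambda>n. block_toeplitz a c n f * block_toeplitz c b n g) (\<lambda>\<theta>. f \<theta> * g \<theta>) (-pi) pi"
proof -
  define A where "A = (\<lambda>n. block_toeplitz a c n f * block_toeplitz c b n g)"
  define f' where "f' = (\<lambda>\<theta> p q. f \<theta> $$ (p, q))"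
  define g' where "g' = (\<lambda>\<theta> p q. g \<theta> $$ (p, q))"
  have f_carrier: "f \<theta> \<in> carrier_mat a c" and g_carrier: "g \<theta> \<in> carrier_mat c b" if "\<theta> \<in> {-pi..pi}" for \<theta>
    using f g that by (auto simp: mat_L1_on_def mat_valued_on_def)
  have fi: "integrable circle_measure (\<lambda>\<theta>. f' \<theta> p q)" if "p < a" "q < c" for p q
    using f that by (simp add: mat_L1_on_def f'_def)
  have gi: "integrable circle_measure (\<lambda>\<theta>. g' \<theta> p q)" if "p < c" "q < b" for p q
    using g that by (simp add: mat_L1_on_def g'_def)
  have Ac: "A n \<in> carrier_mat (a * n) (b * n)" for n
    unfolding A_def by (rule mult_carrier_mat[OF block_toeplitz_carrier block_toeplitz_carrier])
  have entry: "A n $$ (a * i + p, b * k + q) = mat_prod ({..<n} \<times> {..<c}) (toeplitz_blocks f') (toeplitz_blocks g') (i, p) (k, q)"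
    if "i < n" "p < a" "k < n" "q < b" for n i p k q
    unfolding A_def f'_def g'_def by (rule block_toeplitz_product_entry[OF abc(3) that])
  have M: "f \<theta> * g \<theta> = symbol_product a b c f' g' \<theta>" if "\<theta> \<in> {-pi..pi}" for \<theta>
  proof (rule eq_matI)
    fix i j assume "i < dim_row (symbol_product a b c f' g' \<theta>)" "j < dim_col (symbol_product a b c f' g' \<theta>)"
    then have ij: "i < a" "j < b" by (auto simp: symbol_product_def)
    show "(f \<theta> * g \<theta>) $$ (i, j) = symbol_product a b c f' g' \<theta> $$ (i, j)"
      using mat_mult_index[OF f_carrier[OF that] g_carrier[OF that] ij] ij by (simp add: symbol_product_def mat_prod_def f'_def g'_def)
  qed (use f_carrier[OF that] g_carrier[OF that] in \<open>auto simp: symbol_product_def\<close>)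
  have meas: "mat_measurable_on {-pi..pi} a b (\<lambda>\<theta>. f \<theta> * g \<theta>)"
    unfolding mat_measurable_on_def mat_valued_on_def
  proof (intro conjI ballI allI impI)
    show "f \<theta> * g \<theta> \<in> carrier_mat a b" if "\<theta> \<in> {-pi..pi}" for \<theta>
      using f_carrier[OF that] g_carrier[OF that] by (rule mult_carrier_mat)
    fix i j assume ij: "i < a" "j < b"
    have "(\<lambda>\<theta>. \<Sum>k<c. f' \<theta> i k * g' \<theta> k j) \<in> borel_measurable circle_measure"
      using fi gi ij by (intro borel_measurable_sum borel_measurable_times) auto
    then show "(\<lambda>\<theta>. (f \<theta> * g \<theta>) $$ (i, j)) \<in> borel_measurable (lebesgue_on {-pi..pi})"
      by (rule measurable_cong[THEN iffD1, rotated]) (use ij in \<open>simp add: M symbol_product_def mat_prod_def\<close>)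
  qed
  \<comment> \<open>The limit for full lists of singular values is corrected by the multiple of \<open>F 0\<close> that accounts for the values cut off.\<close>
  define \<mu> where "\<mu> = min a b"
  have \<mu>: "0 < \<mu>" "\<mu> \<le> b" using abc by (auto simp: \<mu>_def)
  have limit: "(\<lambda>n. 1 / of_nat (min (a * n) (b * n)) * (\<Sum>j<min (a * n) (b * n). F (singular_values (A n) ! j)))
      \<longlonglongrightarrow> 1 / of_real (pi - (- pi)) *
        (LINT t|lebesgue_on {-pi..pi}. (\<Sum>i<min a b. F (singular_values (f t * g t) ! i)) / of_nat (min a b))"
    if F: "continuous_on UNIV F" "compact (closure {x. F x \<noteq> 0})" for F :: "real \<Rightarrow> complex"
  proof -
    interpret finite_measure circle_measure by (rule finite_measure_circle)
    define I where "I = (LINT \<theta>|circle_measure. sv_sum F (symbol_product a b c f' g' \<theta>))"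
    have iF: "integrable circle_measure (\<lambda>\<theta>. sv_sum F (symbol_product a b c f' g' \<theta>))"
      by (rule limit_for_continuous_functions(1)[OF abc(1,2) fi gi Ac entry F])
    have lim: "(\<lambda>n. sv_sum F (A n) / of_nat n) \<longlonglongrightarrow> I / (2 * of_real pi)"
      unfolding I_def by (rule limit_for_continuous_functions(2)[OF abc(1,2) fi gi Ac entry F])
    have "(\<lambda>n. (sv_sum F (A n) / of_nat n - of_nat (b - \<mu>) * F 0) / of_nat \<mu>) \<longlonglongrightarrow>
        (I / (2 * of_real pi) - of_nat (b - \<mu>) * F 0) / of_nat \<mu>"
      by (intro tendsto_intros lim) (use \<mu> in auto)
    also have "(I / (2 * of_real pi) - of_nat (b - \<mu>) * F 0) / of_nat \<mu> = 1 / of_real (pi - (- pi)) *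
        (LINT t|lebesgue_on {-pi..pi}. (\<Sum>i<min a b. F (singular_values (f t * g t) ! i)) / of_nat (min a b))"
    proof -
      have "(LINT t|lebesgue_on {-pi..pi}. (\<Sum>i<min a b. F (singular_values (f t * g t) ! i)) / of_nat (min a b))
          = (LINT t|circle_measure. (sv_sum F (symbol_product a b c f' g' t) - of_nat (b - \<mu>) * F 0) / of_nat \<mu>)"
        by (intro Bochner_Integration.integral_cong refl)
           (simp add: M singular_values_sum[OF symbol_product_carrier] \<mu>_def)
      also have "\<dots> = (I - 2 * of_real pi * (of_nat (b - \<mu>) * F 0)) / of_nat \<mu>"
        using iF measure_circle by (simp add: I_def scaleR_conv_of_real)
      finally show ?thesis using \<mu> by (simp add: field_simps)
    qed
    finally show ?thesis
    proof (rule Lim_transform_eventually)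
      show "eventually (\<lambda>n. (sv_sum F (A n) / of_nat n - of_nat (b - \<mu>) * F 0) / of_nat \<mu>
          = 1 / of_nat (min (a * n) (b * n)) * (\<Sum>j<min (a * n) (b * n). F (singular_values (A n) ! j))) sequentially"
        using eventually_gt_at_top[of 0]
      proof eventually_elim
        case (elim n)
        have mn: "min (a * n) (b * n) = \<mu> * n" using elim by (auto simp: \<mu>_def min_def)
        have "b * n - \<mu> * n = (b - \<mu>) * n" by (simp add: diff_mult_distrib)
        then have "(\<Sum>j<\<mu> * n. F (singular_values (A n) ! j)) = sv_sum F (A n) - of_nat ((b - \<mu>) * n) * F 0"
          using singular_values_sum[OF Ac[of n], of F] unfolding mn by simp
        then show ?case
          unfolding mn using elim \<mu> by (simp add: field_simps)
      qed
    qed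
  qed
  show ?thesis
    unfolding sv_distributed_def
    using abc meas limit Ac by (auto simp: A_def filterlim_ident)
qed

theorem theorem14:
  fixes s q :: nat and f g h :: "real \<Rightarrow> complex Matrix.mat"
  assumes "0 < q" and "q < s"
    and "mat_L1_on {-pi..pi} s s f"
    and "mat_L1_on {-pi..pi} s q g"
    and "mat_L1_on {-pi..pi} q s h"
  shows "sv_distributed s q (\<lambda>n. n) (\<lambda>n. n)
           (\<lambda>n. block_toeplitz s s n f * block_toeplitz s q n g) (\<lambda>\<theta>. f \<theta> * g \<theta>) (-pi) pi \<and>
         sv_distributed q s (\<lambda>n. n) (\<lambda>n. n)
           (\<lambda>n. block_toeplitz q s n h * block_toeplitz s s n f) (\<lambda>\<theta>. h \<theta> * f \<theta>) (-pi) pi"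
  using assms by (intro conjI sv_distributed_toeplitz_product) auto

end
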